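(* Every irreducible generalized root system of rank 2 is equivalent to a quotient of a root system.
   Context: A generalized root system (GRS) is a pair $(R,V)$ where $V$ is a finite-dimensional Euclidean space and $R\subset V$ is a non-empty finite set such that: (i) $V=\operatorname{span} R$; (ii) for all $\alpha,\beta\in R$: if $\langle\alpha,\beta\rangle<0$ then $\alpha+\beta\in R$; if $\langle\alpha,\beta\rangle>0$ then $\alpha-\beta\in R$; if $\langle\alpha,\beta\rangle=0$ then $\alpha+\beta\in R$ if and only if $\alpha-\beta\in R$. (It follows that $0\in R$ and $R=-R$.) The rank of $(R,V)$ is $\dim V$. The sum of GRSs $(R_1,V_1)$ and $(R_2,V_2)$ is $(R_1\cup R_2,V_1\oplus V_2)$ with $V_1\oplus V_2$ the orthogonal direct sum. A GRS is irreducible if it is not the sum of two non-trivial GRSs (the trivial GRS being $R=\{0\}$, $V=0$). Two irreducible GRSs $(R_1,V_1)$, $(R_2,V_2)$ are equivalent if there is a vector space isomorphism $V_1\to V_2$ (not necessarily respecting the inner products) mapping $R_1$ bijectively onto $R_2$. A quotient of a root system: let $R$ be an irreducible reduced crystallographic root system (of type $A_l,B_l,C_l,D_l,E_6,E_7,E_8,F_4$ or $G_2$), with $0$ included, in the Euclidean space $V=\operatorname{span}R$; let $S$ be a base (set of simple roots) of $R$ and $I\subset S$. The quotient is $R/I:=\pi_I(R)\subset(\operatorname{span}I)^\perp$, where $\pi_I:V\to(\operatorname{span}I)^\perp$ is the orthogonal projection; it is a GRS in $(\operatorname{span}I)^\perp$. *)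

theory Defs
  imports "HOL-Analysis.Analysis"
begin

section \<open>Euclidean spaces of arbitrary finite dimension\<close>

text \<open>
  A Euclidean space is rendered as a finite-dimensional subspace \<open>V\<close> of a real inner product space.
  The root systems whose existence is asserted may have any rank, so they need one type that
  contains an isometric copy of every Euclidean space: the type \<open>fseq\<close> of finitely supported
  real sequences with the standard inner product (the union of all coordinate spaces).
\<close>

typedef fseq = "{f :: nat \<Rightarrow> real. finite {i. f i \<noteq> 0}}"
  morphisms coord Abs_fseq
  by (rule exI[of _ "\<lambda>_. 0"]) simp

setup_lifting type_definition_fseq

lemma finite_supp_coord [simp]: "finite {i. coord x i \<noteq> 0}"
  using coord by auto

lemma fseq_eqI: "(\<And>i. coord x i = coord y i) \<Longrightarrow> x = y"
  by (metis coord_inject ext)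

instantiation fseq :: real_vector
begin

lift_definition zero_fseq :: fseq is "\<lambda>_. 0"
  by simp

lift_definition plus_fseq :: "fseq \<Rightarrow> fseq \<Rightarrow> fseq" is "\<lambda>f g i. f i + g i"
proof -
  fix f g :: "nat \<Rightarrow> real"
  assume "finite {i. f i \<noteq> 0}" "finite {i. g i \<noteq> 0}"
  then show "finite {i. f i + g i \<noteq> 0}"
    by (rule_tac finite_subset[of _ "{i. f i \<noteq> 0} \<union> {i. g i \<noteq> 0}"]) auto
qed

lift_definition uminus_fseq :: "fseq \<Rightarrow> fseq" is "\<lambda>f i. - f i"
  by simp

definition minus_fseq :: "fseq \<Rightarrow> fseq \<Rightarrow> fseq" where
  "minus_fseq x y = x + - y"

lift_definition scaleR_fseq :: "real \<Rightarrow> fseq \<Rightarrow> fseq" is "\<lambda>c f i. c * f i"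
  by (erule finite_subset[rotated]) auto

instance
  by standard
    (auto intro!: fseq_eqI simp: minus_fseq_def zero_fseq.rep_eq plus_fseq.rep_eq
      uminus_fseq.rep_eq scaleR_fseq.rep_eq algebra_simps)

end

lemma coord_simps [simp]:
  "coord 0 i = 0"
  "coord (x + y) i = coord x i + coord y i"
  "coord (- x) i = - coord x i"
  "coord (x - y) i = coord x i - coord y i"
  "coord (c *\<^sub>R x) i = c * coord x i"
  by (simp_all add: minus_fseq_def zero_fseq.rep_eq plus_fseq.rep_eq uminus_fseq.rep_eq
      scaleR_fseq.rep_eq del: add_uminus_conv_diff)

instantiation fseq :: real_inner
begin

definition inner_fseq :: "fseq \<Rightarrow> fseq \<Rightarrow> real" where
  "inner_fseq x y = (\<Sum>i | coord x i \<noteq> 0. coord x i * coord y i)"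

definition norm_fseq :: "fseq \<Rightarrow> real" where
  "norm_fseq x = sqrt (inner x x)"

definition sgn_fseq :: "fseq \<Rightarrow> fseq" where
  "sgn_fseq x = x /\<^sub>R norm x"

definition dist_fseq :: "fseq \<Rightarrow> fseq \<Rightarrow> real" where
  "dist_fseq x y = norm (x - y)"

definition uniformity_fseq :: "(fseq \<times> fseq) filter" where
  "uniformity_fseq = (INF e\<in>{0<..}. principal {(x, y). dist x y < e})"

definition open_fseq :: "fseq set \<Rightarrow> bool" where
  "open_fseq U \<longleftrightarrow> (\<forall>x\<in>U. eventually (\<lambda>(x', y). x' = x \<longrightarrow> y \<in> U) uniformity)"

lemma inner_fseq_superset:
  assumes "finite A" "{i. coord x i \<noteq> 0} \<subseteq> A"
  shows "inner x y = (\<Sum>i\<in>A. coord x i * coord y i)"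
  unfolding inner_fseq_def by (rule sum.mono_neutral_left) (use assms in auto)

instance
proof
  fix x y z :: fseq and r :: real
  let ?A = "{i. coord x i \<noteq> 0} \<union> {i. coord y i \<noteq> 0}"
  have fin: "finite ?A" by simp
  show "inner x y = inner y x"
    using fin by (subst (1 2) inner_fseq_superset[of ?A]) (auto simp: mult.commute)
  have "{i. coord (x + y) i \<noteq> 0} \<subseteq> ?A" by auto
  then show "inner (x + y) z = inner x z + inner y z"
    using fin by (subst (1 2 3) inner_fseq_superset[of ?A])
      (auto simp: sum.distrib distrib_right)
  have "{i. coord (r *\<^sub>R x) i \<noteq> 0} \<subseteq> {i. coord x i \<noteq> 0}" by auto
  then show "inner (r *\<^sub>R x) y = r * inner x y"
    by (subst inner_fseq_superset[of "{i. coord x i \<noteq> 0}"])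
      (auto simp: inner_fseq_def sum_distrib_left mult.assoc)
  show "0 \<le> inner x x"
    unfolding inner_fseq_def by (rule sum_nonneg) simp
  show "inner x x = 0 \<longleftrightarrow> x = 0"
    unfolding inner_fseq_def
    by (subst sum_nonneg_eq_0_iff) (auto intro: fseq_eqI)
qed (simp_all add: norm_fseq_def sgn_fseq_def dist_fseq_def uniformity_fseq_def open_fseq_def)

end


section \<open>Generalized root systems\<close>

definition grs :: "'a::real_inner set \<Rightarrow> 'a set \<Rightarrow> bool" where
  "grs R V \<longleftrightarrow> R \<noteq> {} \<and> finite R \<and> V = span R \<and>
    (\<forall>\<alpha>\<in>R. \<forall>\<beta>\<in>R.
      (\<alpha> \<bullet> \<beta> < 0 \<longrightarrow> \<alpha> + \<beta> \<in> R) \<and>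
      (\<alpha> \<bullet> \<beta> > 0 \<longrightarrow> \<alpha> - \<beta> \<in> R) \<and>
      (\<alpha> \<bullet> \<beta> = 0 \<longrightarrow> (\<alpha> + \<beta> \<in> R \<longleftrightarrow> \<alpha> - \<beta> \<in> R)))"

text \<open>
  The orthogonal direct sum is taken internally: \<open>V1\<close> and \<open>V2\<close> are mutually orthogonal subspaces
  of the ambient space. Orthogonality makes the sum of subspaces direct.
\<close>

definition grs_sum ::
  "'a::real_inner set \<Rightarrow> 'a set \<Rightarrow> 'a set \<Rightarrow> 'a set \<Rightarrow> 'a set \<Rightarrow> 'a set \<Rightarrow> bool" where
  "grs_sum R V R1 V1 R2 V2 \<longleftrightarrow>
    (\<forall>x\<in>V1. \<forall>y\<in>V2. orthogonal x y) \<and>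
    V = {x + y | x y. x \<in> V1 \<and> y \<in> V2} \<and> R = R1 \<union> R2"

definition grs_trivial :: "'a::real_inner set \<Rightarrow> 'a set \<Rightarrow> bool" where
  "grs_trivial R V \<longleftrightarrow> R = {0} \<and> V = {0}"

definition grs_irreducible :: "'a::real_inner set \<Rightarrow> 'a set \<Rightarrow> bool" where
  "grs_irreducible R V \<longleftrightarrow> grs R V \<and>
    \<not> (\<exists>R1 V1 R2 V2. grs R1 V1 \<and> \<not> grs_trivial R1 V1 \<and>
         grs R2 V2 \<and> \<not> grs_trivial R2 V2 \<and> grs_sum R V R1 V1 R2 V2)"

text \<open>
  A vector space isomorphism between the subspaces \<open>V1\<close> and \<open>V2\<close> is the restriction of a linear
  map of the ambient spaces; conversely every linear map on a subspace extends.
  Equivalence is a relation between irreducible systems only.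
\<close>

definition grs_equivalent ::
  "'a::real_inner set \<Rightarrow> 'a set \<Rightarrow> 'b::real_inner set \<Rightarrow> 'b set \<Rightarrow> bool" where
  "grs_equivalent R1 V1 R2 V2 \<longleftrightarrow>
    grs_irreducible R1 V1 \<and> grs_irreducible R2 V2 \<and>
    (\<exists>f. linear f \<and> bij_betw f V1 V2 \<and> bij_betw f R1 R2)"


section \<open>Root systems and their quotients\<close>

definition reduced_root_system :: "'a::real_inner set \<Rightarrow> 'a set \<Rightarrow> bool" where
  "reduced_root_system \<Phi> V \<longleftrightarrow> finite \<Phi> \<and> V = span \<Phi> \<and> 0 \<notin> \<Phi> \<and>
    (\<forall>\<alpha>\<in>\<Phi>. \<forall>c. c *\<^sub>R \<alpha> \<in> \<Phi> \<longleftrightarrow> c = 1 \<or> c = - 1) \<and>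
    (\<forall>\<alpha>\<in>\<Phi>. \<forall>\<beta>\<in>\<Phi>. 2 * (\<beta> \<bullet> \<alpha>) / (\<alpha> \<bullet> \<alpha>) \<in> \<int> \<and>
                  \<beta> - (2 * (\<beta> \<bullet> \<alpha>) / (\<alpha> \<bullet> \<alpha>)) *\<^sub>R \<alpha> \<in> \<Phi>)"

definition irreducible_root_system :: "'a::real_inner set \<Rightarrow> 'a set \<Rightarrow> bool" where
  "irreducible_root_system \<Phi> V \<longleftrightarrow> reduced_root_system \<Phi> V \<and> \<Phi> \<noteq> {} \<and>
    \<not> (\<exists>A B. A \<noteq> {} \<and> B \<noteq> {} \<and> \<Phi> = A \<union> B \<and> (\<forall>\<alpha>\<in>A. \<forall>\<beta>\<in>B. orthogonal \<alpha> \<beta>))"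

definition root_base :: "'a::real_inner set \<Rightarrow> 'a set \<Rightarrow> 'a set \<Rightarrow> bool" where
  "root_base S \<Phi> V \<longleftrightarrow> S \<subseteq> \<Phi> \<and> independent S \<and> span S = V \<and>
    (\<forall>\<beta>\<in>\<Phi>. \<exists>c :: 'a \<Rightarrow> int. \<beta> = (\<Sum>\<alpha>\<in>S. of_int (c \<alpha>) *\<^sub>R \<alpha>) \<and>
        ((\<forall>\<alpha>\<in>S. 0 \<le> c \<alpha>) \<or> (\<forall>\<alpha>\<in>S. c \<alpha> \<le> 0)))"

definition orth_proj :: "'a::real_inner set \<Rightarrow> 'a \<Rightarrow> 'a" where
  "orth_proj W x = (THE y. y \<in> W \<and> (\<forall>w\<in>W. orthogonal (x - y) w))"

definition quotient_space :: "'a::real_inner set \<Rightarrow> 'a set \<Rightarrow> 'a set" where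
  "quotient_space V I = V \<inter> (span I)\<^sup>\<bottom>"

text \<open>Root systems above exclude 0, generalized root systems contain it; hence the \<open>insert\<close>.\<close>

definition quotient_roots :: "'a::real_inner set \<Rightarrow> 'a set \<Rightarrow> 'a set \<Rightarrow> 'a set" where
  "quotient_roots \<Phi> V I = orth_proj (quotient_space V I) ` insert 0 \<Phi>"

definition root_system_quotient :: "'a::real_inner set \<Rightarrow> 'a set \<Rightarrow> bool" where
  "root_system_quotient R V \<longleftrightarrow>
    (\<exists>\<Phi> U S I. irreducible_root_system \<Phi> U \<and> root_base S \<Phi> U \<and> I \<subseteq> S \<and>
       V = quotient_space U I \<and> R = quotient_roots \<Phi> U I)"


subsection \<open>The projection is well defined\<close>

lemma orth_proj_eqI:
  assumes "subspace W" "y \<in> W" "\<And>w. w \<in> W \<Longrightarrow> orthogonal (x - y) w"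
  shows "orth_proj W x = y"
  unfolding orth_proj_def
proof (rule the_equality)
  fix z assume z: "z \<in> W \<and> (\<forall>w\<in>W. orthogonal (x - z) w)"
  then have "y - z \<in> W" using assms by (simp add: subspace_diff)
  then have "(x - z) \<bullet> (y - z) = 0" "(x - y) \<bullet> (y - z) = 0"
    using z assms by (auto simp: orthogonal_def)
  then have "(y - z) \<bullet> (y - z) = 0" by (simp add: inner_diff_left)
  then show "z = y" by simp
qed (use assms in auto)

lemma orthogonal_decomp_finite_span:
  fixes x :: "'a::real_inner"
  assumes "finite B"
  obtains y where "y \<in> span B" "\<And>w. w \<in> span B \<Longrightarrow> orthogonal (x - y) w"
proof -
  obtain C where C: "finite C" "span C = span B" "pairwise orthogonal C"
    using basis_orthogonal[OF assms] by blast
  define y where "y = (\<Sum>b\<in>C. (b \<bullet> x / (b \<bullet> b)) *\<^sub>R b)"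
  have "y \<in> span B"
    unfolding y_def C(2)[symmetric] by (intro span_sum span_scale span_base)
  moreover have "orthogonal (x - y) w" if "w \<in> span B" for w
  proof -
    have "orthogonal (x - y) c" if c: "c \<in> C" for c
    proof -
      have "y \<bullet> c = (\<Sum>b\<in>C. (b \<bullet> x / (b \<bullet> b)) * (b \<bullet> c))"
        unfolding y_def by (simp add: inner_sum_left)
      also have "\<dots> = (\<Sum>b\<in>C. if b = c then c \<bullet> x else 0)"
        using C(3) c by (intro sum.cong) (auto simp: pairwise_def orthogonal_def)
      also have "\<dots> = c \<bullet> x"
        using C(1) c by simp
      finally show ?thesis
        by (simp add: orthogonal_def inner_diff_right inner_commute)
    qed
    then show ?thesis
      using that unfolding C(2)[symmetric] by (rule orthogonal_to_span[rotated])
  qed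
  ultimately show thesis by (rule that)
qed

lemma orth_proj_quotient_space:
  fixes I :: "'a::real_inner set"
  assumes "finite I" "subspace V" "I \<subseteq> V" "x \<in> V"
  shows "orth_proj (quotient_space V I) x \<in> quotient_space V I"
    and "x - orth_proj (quotient_space V I) x \<in> span I"
proof -
  have IV: "span I \<subseteq> V" using assms by (simp add: span_minimal)
  obtain z where z: "z \<in> span I" "\<And>w. w \<in> span I \<Longrightarrow> orthogonal (x - z) w"
    using orthogonal_decomp_finite_span[OF assms(1)] by blast
  have mem: "x - z \<in> quotient_space V I"
    using z IV assms unfolding quotient_space_def
    by (auto simp: orthogonal_comp_def orthogonal_commute intro: subspace_diff)
  have "subspace (quotient_space V I)"
    unfolding quotient_space_def using assms
    by (intro subspace_inter subspace_orthogonal_comp) auto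
  then have "orth_proj (quotient_space V I) x = x - z"
    using mem z(1) by (intro orth_proj_eqI) (auto simp: quotient_space_def orthogonal_comp_def)
  with mem z(1) show "orth_proj (quotient_space V I) x \<in> quotient_space V I"
    and "x - orth_proj (quotient_space V I) x \<in> span I" by simp_all
qed

end

theory Submission
  imports Defs
begin

text \<open>
  Let \<open>\<theta> = m \<alpha>\<close> be a longest root, with \<open>\<alpha>\<close> primitive, and cut the system into rows parallel to \<open>\<alpha>\<close>.
  Since no root is longer than \<open>\<theta>\<close>, the positions in a row, measured in units of \<open>\<alpha>\<close> from the
  perpendicular, lie in \<open>(-m, m)\<close>, and the root string axioms leave only two possibilities: a row
  consists of all admissible positions of its residue class modulo 1, or of the position 0 alone.
  So the system is determined by \<open>m\<close>, the offset \<open>s\<close> of the first row, the number \<open>k\<close> of rows and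
  the rows of the second kind. Two roots in distinct rows \<open>p, q\<close> with \<open>p + q > k\<close> whose positions
  \<open>x, y\<close> differ by at least \<open>m\<close> can have neither their sum nor their difference in the system; hence
  they are orthogonal: \<open>x y + p q t = 0\<close>, where \<open>t\<close> is the squared distance of adjacent rows. These
  equations in \<open>s\<close> and \<open>t\<close> are so restrictive that thirty row patterns remain, each of which is
  linearly equivalent to the projection of a subsystem of \<open>E\<^sub>8\<close> to two of its simple coordinates.
\<close>

section \<open>The lattice of type E8\<close>

text \<open>Equivalence ignores the inner product, and this shapes both ends of the argument. The
  numbers \<open>s\<close> and \<open>t\<close> need not be determined: in several cases a whole
  interval of values of \<open>s\<close> gives the same row pattern. One system may carry inner
  products with different longest roots and so appear under several patterns; the thirty entries of
  \<open>rank2_table\<close> use only sixteen triples \<open>n, p, r\<close>. Irreducibility of the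
  quotient must be carried over along a map that is no isometry, which calls for a criterion of
  reducibility without orthogonality (\<open>not_grs_irreducibleI\<close>).

  The number of rows is not bounded in advance. If the longest root is a proper multiple, a root is
  often opposite to two neighbours in another row, and the difference of the two equations is
  absurd.

  Since E8 alone supplies all quotients, a single list of 120 positive roots decides the table by
  evaluation.\<close>

definition fseq_of_list :: "real list \<Rightarrow> fseq" where
  "fseq_of_list xs = Abs_fseq (\<lambda>i. if i < length xs then xs ! i else 0)"

lemma coord_fseq_of_list: "coord (fseq_of_list xs) i = (if i < length xs then xs ! i else 0)"
proof -
  have "finite {i. (if i < length xs then xs ! i else 0) \<noteq> 0}"
    by (rule finite_subset[of _ "{..<length xs}"]) auto
  then show ?thesis
    unfolding fseq_of_list_def by (subst Abs_fseq_inverse) auto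
qed

lemma inner_fseq_of_list:
  "fseq_of_list xs \<bullet> y = (\<Sum>i<length xs. xs ! i * coord y i)"
  by (subst inner_fseq_superset[of "{..<length xs}"]) (auto simp: coord_fseq_of_list)

text \<open>The simple roots in Bourbaki's coordinates, in the order 1, 3, 4, 2, 5, 6, 7, 8 of his labels: then
  the first \<open>n\<close> of them span root systems of type \<open>A\<^sub>2\<close>, \<open>D\<^sub>5\<close>, \<open>E\<^sub>6\<close>, \<open>E\<^sub>7\<close>, \<open>E\<^sub>8\<close>
  for \<open>n = 2, 5, 6, 7, 8\<close>.\<close>

definition e8_simple :: "nat \<Rightarrow> fseq" where
  "e8_simple i = fseq_of_list
    ([[1/2, -1/2, -1/2, -1/2, -1/2, -1/2, -1/2, 1/2],
      [-1, 1, 0, 0, 0, 0, 0, 0],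
      [0, -1, 1, 0, 0, 0, 0, 0],
      [1, 1, 0, 0, 0, 0, 0, 0],
      [0, 0, -1, 1, 0, 0, 0, 0],
      [0, 0, 0, -1, 1, 0, 0, 0],
      [0, 0, 0, 0, -1, 1, 0, 0],
      [0, 0, 0, 0, 0, -1, 1, 0]] ! i)"

text \<open>The Dynkin diagram as a tree with root 0: a path, except that 4 (Bourbaki's 5) is
  attached to 2 (Bourbaki's 4). The value at 0 is a mere default, whence the tests for positive
  indices in \<open>e8_cartan\<close>.\<close>

definition e8_parent :: "nat \<Rightarrow> nat" where
  "e8_parent i = (if i = 4 then 2 else i - 1)"

definition e8_cartan :: "nat \<Rightarrow> nat \<Rightarrow> int" where
  "e8_cartan i j = (if i = j then 2
     else if 0 < i \<and> j = e8_parent i \<or> 0 < j \<and> i = e8_parent j then -1 else 0)"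

lemma less_8_cases:
  "i < (8::nat) \<longleftrightarrow> i = 0 \<or> i = 1 \<or> i = 2 \<or> i = 3 \<or> i = 4 \<or> i = 5 \<or> i = 6 \<or> i = 7"
  by presburger

lemma sum_less_8:
  fixes f :: "nat \<Rightarrow> 'a::comm_monoid_add"
  shows "(\<Sum>i<8. f i) = f 0 + f 1 + f 2 + f 3 + f 4 + f 5 + f 6 + f 7"
  by (simp add: eval_nat_numeral lessThan_Suc ac_simps)

lemma inner_e8_simple:
  assumes "i < 8" "j < 8"
  shows "e8_simple i \<bullet> e8_simple j = of_int (e8_cartan i j)"
  using assms unfolding less_8_cases
  by (elim disjE; simp add: e8_simple_def inner_fseq_of_list coord_fseq_of_list
      eval_nat_numeral lessThan_Suc e8_cartan_def e8_parent_def)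

definition e8_comb :: "(nat \<Rightarrow> real) \<Rightarrow> fseq" where
  "e8_comb c = (\<Sum>i<8. c i *\<^sub>R e8_simple i)"

lemma coord_sum: "coord (sum f A) i = (\<Sum>a\<in>A. coord (f a) i)"
  by (induction A rule: infinite_finite_induct) auto

lemma e8_comb_eq_0:
  assumes "e8_comb c = 0" "i < 8"
  shows "c i = 0"
proof -
  have "coord (e8_comb c) j = 0" for j using assms by simp
  then have *: "(\<Sum>i<8. c i * coord (e8_simple i) j) = 0" for j
    by (simp add: e8_comb_def coord_sum)
  show ?thesis
    using *[of 0] *[of 1] *[of 2] *[of 3] *[of 4] *[of 5] *[of 6] *[of 7] assms(2)
    unfolding less_8_cases sum_less_8
    by (elim disjE; simp add: e8_simple_def coord_fseq_of_list eval_nat_numeral)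
qed

lemma e8_comb_add: "e8_comb c + e8_comb d = e8_comb (\<lambda>i. c i + d i)"
  by (simp add: e8_comb_def scaleR_add_left sum.distrib)

lemma e8_comb_diff: "e8_comb c - e8_comb d = e8_comb (\<lambda>i. c i - d i)"
  by (simp add: e8_comb_def scaleR_diff_left sum_subtractf)

lemma e8_comb_scale: "a *\<^sub>R e8_comb c = e8_comb (\<lambda>i. a * c i)"
  by (simp add: e8_comb_def scaleR_sum_right)

lemma e8_comb_inj: "e8_comb c = e8_comb d \<Longrightarrow> i < 8 \<Longrightarrow> c i = d i"
  using e8_comb_eq_0[of "\<lambda>i. c i - d i" i] by (simp flip: e8_comb_diff)

definition e8_lat :: "(nat \<Rightarrow> int) \<Rightarrow> fseq" where
  "e8_lat c = e8_comb (\<lambda>i. of_int (c i))"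

definition e8_form :: "(nat \<Rightarrow> int) \<Rightarrow> (nat \<Rightarrow> int) \<Rightarrow> int" where
  "e8_form c d = (\<Sum>i<8. \<Sum>j<8. c i * d j * e8_cartan i j)"

lemma inner_e8_lat: "e8_lat c \<bullet> e8_lat d = of_int (e8_form c d)"
proof -
  have "e8_lat c \<bullet> e8_lat d =
      (\<Sum>i<8. \<Sum>j<8. of_int (c i) * (of_int (d j) * (e8_simple i \<bullet> e8_simple j)))"
    unfolding e8_lat_def e8_comb_def inner_sum_left
    by (simp add: inner_sum_right sum_distrib_left mult.left_commute)
  then show ?thesis
    by (simp add: e8_form_def inner_e8_simple mult.assoc)
qed

lemma e8_form_explicit:
  "e8_form c d = 2 * (c 0 * d 0 + c 1 * d 1 + c 2 * d 2 + c 3 * d 3 + c 4 * d 4 + c 5 * d 5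
      + c 6 * d 6 + c 7 * d 7)
    - (c 0 * d 1 + c 1 * d 0) - (c 1 * d 2 + c 2 * d 1) - (c 2 * d 3 + c 3 * d 2)
    - (c 2 * d 4 + c 4 * d 2) - (c 4 * d 5 + c 5 * d 4) - (c 5 * d 6 + c 6 * d 5)
    - (c 6 * d 7 + c 7 * d 6)"
  unfolding e8_form_def sum_less_8 by (simp add: e8_cartan_def e8_parent_def)

definition e8_unit :: "nat \<Rightarrow> nat \<Rightarrow> int" where
  "e8_unit i j = (if j = i then 1 else 0)"

lemma e8_lat_unit:
  assumes "i < 8"
  shows "e8_lat (e8_unit i) = e8_simple i"
proof -
  have "e8_lat (e8_unit i) = (\<Sum>j<8. if j = i then e8_simple i else 0)"
    unfolding e8_lat_def e8_comb_def e8_unit_def by (intro sum.cong) auto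
  with assms show ?thesis by simp
qed

lemma e8_lat_add: "e8_lat c + e8_lat d = e8_lat (\<lambda>i. c i + d i)"
  by (simp add: e8_lat_def e8_comb_add)

lemma e8_lat_scale: "of_int a *\<^sub>R e8_lat c = e8_lat (\<lambda>i. a * c i)"
  by (simp add: e8_lat_def e8_comb_scale)

lemma e8_lat_eq_0: "e8_lat c = 0 \<Longrightarrow> i < 8 \<Longrightarrow> c i = 0"
  unfolding e8_lat_def using e8_comb_eq_0 by fastforce

lemma e8_lat_inj: "e8_lat c = e8_lat d \<Longrightarrow> i < 8 \<Longrightarrow> c i = d i"
  unfolding e8_lat_def using e8_comb_inj by fastforce

lemma even_e8_form: "even (e8_form c c)"
  unfolding e8_form_explicit by (simp add: mult.commute)

text \<open>Positive definiteness is read off from the realization in \<open>fseq\<close>; with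
  evenness, 2 becomes the least nonzero value.\<close>

lemma e8_form_nonneg: "e8_form c c \<ge> 0"
  using inner_ge_zero[of "e8_lat c"] unfolding inner_e8_lat by simp

lemma e8_form_eq_0: "e8_form c c = 0 \<Longrightarrow> i < 8 \<Longrightarrow> c i = 0"
  using inner_e8_lat[of c c] e8_lat_eq_0 by fastforce

lemma e8_form_ge_2: "i < 8 \<Longrightarrow> c i \<noteq> 0 \<Longrightarrow> e8_form c c \<ge> 2"
  using e8_form_eq_0[of c i] e8_form_nonneg[of c] even_e8_form[of c] by (smt (verit) odd_one)

lemma e8_form_diff_diff:
  "e8_form (\<lambda>i. c i - d i) (\<lambda>i. c i - d i) = e8_form c c - 2 * e8_form c d + e8_form d d"
  unfolding e8_form_explicit by algebra

lemma e8_form_add_add: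
  "e8_form (\<lambda>i. c i + d i) (\<lambda>i. c i + d i) = e8_form c c + 2 * e8_form c d + e8_form d d"
  unfolding e8_form_explicit by algebra

lemma e8_form_unit_unit: "i < 8 \<Longrightarrow> e8_form (e8_unit i) (e8_unit i) = 2"
  unfolding less_8_cases by (elim disjE) (simp_all add: e8_form_explicit e8_unit_def)

text \<open>Distinct simple roots have nonpositive inner products. So the positive and negative part \<open>p, n\<close> of a
  root satisfy \<open>\<langle>p, n\<rangle> \<le> 0\<close>, and if both were nonzero its squared length would be at least 4.\<close>

lemma e8_root_sign:
  assumes "e8_form c c = 2"
  shows "(\<forall>i<8. c i \<ge> 0) \<or> (\<forall>i<8. c i \<le> 0)"
proof (rule ccontr)
  assume "\<not> ?thesis"
  then obtain i j where ij: "i < 8" "c i < 0" "j < 8" "c j > 0" by (auto simp: not_le)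
  define p where "p = (\<lambda>i. max (c i) 0)"
  define n where "n = (\<lambda>i. max (- c i) 0)"
  have "e8_form p n \<le> 0"
    unfolding e8_form_def
    by (intro sum_nonpos) (auto simp: p_def n_def e8_cartan_def max_def mult_nonneg_nonpos
        mult_nonpos_nonneg)
  moreover have "e8_form p p \<ge> 2" "e8_form n n \<ge> 2"
    using ij e8_form_ge_2[of j p] e8_form_ge_2[of i n] by (auto simp: p_def n_def)
  moreover have "c = (\<lambda>i. p i - n i)" by (auto simp: p_def n_def)
  ultimately show False
    using assms e8_form_diff_diff[of p n] by simp
qed

section \<open>Enumeration of the positive roots by height\<close>

definition e8_dots :: "int list \<Rightarrow> int list" where
  "e8_dots v = (let a = v ! 0; b = v ! 1; c = v ! 2; d = v ! 3; e = v ! 4; f = v ! 5; g = v ! 6; h = v ! 7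
    in [2 * a - b, 2 * b - a - c, 2 * c - b - d - e, 2 * d - c, 2 * e - c - f, 2 * f - e - g,
        2 * g - f - h, 2 * h - g])"

text \<open>\<open>e8_dots\<close> spells out the pairings with the simple roots without sums, so
  that the enumeration can be evaluated.\<close>

lemma nth_e8_dots: "i < 8 \<Longrightarrow> e8_dots v ! i = e8_form (nth v) (e8_unit i)"
  unfolding less_8_cases
  by (elim disjE) (simp_all add: e8_dots_def Let_def e8_form_explicit e8_unit_def)

lemma length_e8_dots [simp]: "length (e8_dots v) = 8"
  by (simp add: e8_dots_def Let_def)

text \<open>A root plus a simple root has squared length 4 + 2 x, where x is their inner product; so
  it is a root exactly for x = -1.\<close>

definition e8_up :: "int list \<Rightarrow> int list list" where
  "e8_up v = map (\<lambda>(i, _). v[i := v ! i + 1]) (filter (\<lambda>(_, x). x = - 1) (zip [0..<8] (e8_dots v)))"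

text \<open>Level \<open>h\<close> lists the coordinates of the positive roots of height \<open>h + 1\<close>: every root that is not
  simple stays a positive root when a suitable simple root is subtracted.\<close>

fun e8_level :: "nat \<Rightarrow> int list list" where
  "e8_level 0 = map (\<lambda>i. map (e8_unit i) [0..<8]) [0..<8]"
| "e8_level (Suc h) = remdups (concat (map e8_up (e8_level h)))"

lemma in_e8_up_iff:
  "w \<in> set (e8_up v) \<longleftrightarrow> (\<exists>i<8. e8_form (nth v) (e8_unit i) = - 1 \<and> w = v[i := v ! i + 1])"
proof -
  have "w \<in> set (e8_up v) \<longleftrightarrow> (\<exists>i<8. e8_dots v ! i = - 1 \<and> w = v[i := v ! i + 1])"
    unfolding e8_up_def by (force simp: set_zip)
  then show ?thesis by (auto simp: nth_e8_dots)
qed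

lemma e8_form_cong:
  assumes "\<And>i. i < 8 \<Longrightarrow> c i = c' i" "\<And>i. i < 8 \<Longrightarrow> d i = d' i"
  shows "e8_form c d = e8_form c' d'"
  unfolding e8_form_def using assms by (intro sum.cong) auto

lemma e8_level_sound:
  "v \<in> set (e8_level h) \<Longrightarrow> length v = 8 \<and> e8_form (nth v) (nth v) = 2"
proof (induction h arbitrary: v)
  case 0
  then obtain i where i: "i < 8" "v = map (e8_unit i) [0..<8]" by auto
  then have "e8_form (nth v) (nth v) = e8_form (e8_unit i) (e8_unit i)"
    by (intro e8_form_cong) auto
  with i show ?case by (simp add: e8_form_unit_unit)
next
  case (Suc h)
  then obtain w i where w: "w \<in> set (e8_level h)" "i < 8" "e8_form (nth w) (e8_unit i) = - 1"
      "v = w[i := w ! i + 1]"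
    by (auto simp: in_e8_up_iff)
  with Suc.IH have IH: "length w = 8" "e8_form (nth w) (nth w) = 2" by auto
  have "e8_form (nth v) (nth v) =
      e8_form (\<lambda>j. w ! j + e8_unit i j) (\<lambda>j. w ! j + e8_unit i j)"
    by (intro e8_form_cong) (use w IH in \<open>auto simp: e8_unit_def nth_list_update\<close>)
  also have "\<dots> = 2" using w IH by (simp add: e8_form_add_add e8_form_unit_unit)
  finally show ?case using w IH by simp
qed

lemma e8_form_units: "e8_form c c = (\<Sum>i<8. c i * e8_form c (e8_unit i))"
  unfolding sum_less_8 by (simp add: e8_form_explicit e8_unit_def algebra_simps)

lemma e8_level_complete:
  assumes "e8_form c c = 2" "\<And>i. i < 8 \<Longrightarrow> c i \<ge> 0" "(\<Sum>i<8. c i) = int h + 1"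
  shows "map c [0..<8] \<in> set (e8_level h)"
  using assms
proof (induction h arbitrary: c)
  case 0
  then obtain i where i: "i < 8" "c i \<noteq> 0"
    by (metis (no_types, lifting) add_0 lessThan_iff of_nat_0 sum.not_neutral_contains_not_neutral zero_neq_one)
  have "(\<Sum>j<8. c j) = c i + (\<Sum>j\<in>{..<8} - {i}. c j)"
    using i by (intro sum.remove) auto
  moreover have "(\<Sum>j\<in>{..<8} - {i}. c j) \<ge> 0" using 0 by (intro sum_nonneg) auto
  moreover have "c i \<ge> 1" using 0(2)[OF i(1)] i(2) by simp
  ultimately have "c i = 1" and z: "(\<Sum>j\<in>{..<8} - {i}. c j) = 0" using 0 by auto
  moreover have "\<forall>j\<in>{..<8} - {i}. c j = 0"
    using z 0 by (subst (asm) sum_nonneg_eq_0_iff) auto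
  ultimately have "map c [0..<8] = map (e8_unit i) [0..<8]"
    by (auto simp: e8_unit_def)
  then show ?case using i by force
next
  case (Suc h)
  \<comment> \<open>By \<open>e8_form_units\<close> the squared length is the sum of these eight
    products. A simple root with a positive product can be subtracted to lower the height.\<close>
  have "\<exists>i<8. c i * e8_form c (e8_unit i) > 0"
  proof (rule ccontr)
    assume "\<not> ?thesis"
    then have "(\<Sum>i<8. c i * e8_form c (e8_unit i)) \<le> 0" by (intro sum_nonpos) auto
    then show False using Suc.prems e8_form_units[of c] by simp
  qed
  then obtain i where i: "i < 8" "c i > 0" "e8_form c (e8_unit i) > 0"
    using Suc.prems(2) by (metis less_le_not_le linorder_not_le mult_nonneg_nonpos zero_less_mult_iff)
  define d where "d = (\<lambda>j. c j - e8_unit i j)"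
  have form_d: "e8_form d d = 4 - 2 * e8_form c (e8_unit i)"
    unfolding d_def e8_form_diff_diff using i Suc.prems by (simp add: e8_form_unit_unit)
  have "(\<Sum>j<8. e8_unit i j) = 1" using i by (simp add: e8_unit_def)
  then have sum_d: "(\<Sum>j<8. d j) = int h + 1"
    using Suc.prems by (simp add: d_def sum_subtractf)
  have "e8_form d d \<noteq> 0"
  proof
    assume "e8_form d d = 0"
    then have "(\<Sum>j<8. d j) = 0" using e8_form_eq_0 by (intro sum.neutral) auto
    with sum_d show False by simp
  qed
  \<comment> \<open>The form of \<open>d\<close> is nonnegative and not 0, which leaves 1 as the
    only positive value of the pairing.\<close>
  then have one: "e8_form c (e8_unit i) = 1"
    using form_d e8_form_nonneg[of d] i by linarith
  have mem: "map d [0..<8] \<in> set (e8_level h)"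
    by (rule Suc.IH) (use form_d one sum_d Suc.prems i in \<open>auto simp: d_def e8_unit_def\<close>)
  have "e8_form (nth (map d [0..<8])) (e8_unit i) = e8_form d (e8_unit i)"
    by (intro e8_form_cong) auto
  also have "\<dots> = e8_form c (e8_unit i) - e8_form (e8_unit i) (e8_unit i)"
    unfolding d_def e8_form_explicit by algebra
  also have "\<dots> = - 1" using one i by (simp add: e8_form_unit_unit)
  finally have "(map d [0..<8])[i := map d [0..<8] ! i + 1] \<in> set (e8_up (map d [0..<8]))"
    using i unfolding in_e8_up_iff by blast
  moreover have "(map d [0..<8])[i := map d [0..<8] ! i + 1] = map c [0..<8]"
    using i by (auto intro!: nth_equalityI simp: d_def e8_unit_def nth_list_update)
  ultimately show ?case using mem by auto
qed

text \<open>The current level is passed along, so that each level is computed once; evaluating the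
  levels separately would repeat all lower ones.\<close>

fun e8_upto :: "nat \<Rightarrow> int list list \<Rightarrow> int list list" where
  "e8_upto 0 L = []"
| "e8_upto (Suc n) L = L @ e8_upto n (remdups (concat (map e8_up L)))"

text \<open>The highest root of E8 has height 29, so the positive roots fill the levels 0 to
  28.\<close>

definition e8_pos :: "int list list" where
  "e8_pos = e8_upto 29 (e8_level 0)"

lemma set_e8_upto: "set (e8_upto n (e8_level h)) = (\<Union>i<n. set (e8_level (h + i)))"
proof (induction n arbitrary: h)
  case (Suc n)
  have "e8_upto (Suc n) (e8_level h) = e8_level h @ e8_upto n (e8_level (Suc h))" by simp
  then have "set (e8_upto (Suc n) (e8_level h)) =
      set (e8_level (h + 0)) \<union> (\<Union>i<n. set (e8_level (h + Suc i)))"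
    by (simp only: set_append Suc add_0_right add_Suc add_Suc_right)
  also have "\<dots> = (\<Union>i<Suc n. set (e8_level (h + i)))"
    unfolding lessThan_Suc_eq_insert_0 by auto
  finally show ?case .
qed simp

lemma set_e8_pos: "set e8_pos = (\<Union>i<29. set (e8_level i))"
  unfolding e8_pos_def set_e8_upto by simp

lemma e8_level_29: "e8_level 29 = []"
  by code_simp

section \<open>Root systems of parabolic subdiagrams\<close>

lemma e8_level_ge_29: "e8_level (29 + n) = []"
  by (induction n) (simp_all only: add_0_right e8_level_29 add_Suc_right e8_level.simps(2) list.map
      concat.simps remdups.simps)

lemma e8_pos_complete:
  assumes "e8_form c c = 2" "\<And>i. i < 8 \<Longrightarrow> c i \<ge> 0"
  shows "map c [0..<8] \<in> set e8_pos"
proof -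
  have "(\<Sum>i<8. c i) \<noteq> 0"
  proof
    assume "(\<Sum>i<8. c i) = 0"
    then have "\<forall>i\<in>{..<8}. c i = 0" using assms by (subst (asm) sum_nonneg_eq_0_iff) auto
    then have "e8_form c c = 0" by (simp add: e8_form_def)
    with assms show False by simp
  qed
  moreover have "(\<Sum>i<8. c i) \<ge> 0" using assms by (intro sum_nonneg) auto
  ultimately obtain h where h: "(\<Sum>i<8. c i) = int h + 1"
    by (metis add.commute linorder_not_less nonneg_int_cases not0_implies_Suc of_nat_0 of_nat_Suc)
  then have mem: "map c [0..<8] \<in> set (e8_level h)"
    using assms by (intro e8_level_complete) auto
  then have "h < 29"
    using e8_level_ge_29[of "h - 29"] by (cases "h < 29") auto
  with mem show ?thesis by (auto simp: set_e8_pos)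
qed

lemma e8_pos_sound: "v \<in> set e8_pos \<Longrightarrow> length v = 8 \<and> e8_form (nth v) (nth v) = 2"
  unfolding set_e8_pos using e8_level_sound by fastforce

text \<open>The roots in the span of the first \<open>n\<close> simple roots. For
  \<open>n \<le> 8\<close> the values from index 8 on, which \<open>e8_form\<close> does not see,
  are fixed as well.\<close>

definition e8_coeffs :: "nat \<Rightarrow> (nat \<Rightarrow> int) set" where
  "e8_coeffs n = {c. e8_form c c = 2 \<and> (\<forall>i\<ge>n. c i = 0)}"

definition e8_roots :: "nat \<Rightarrow> fseq set" where
  "e8_roots n = e8_lat ` e8_coeffs n"

lemma e8_form_uminus: "e8_form (\<lambda>i. - c i) (\<lambda>i. - c i) = e8_form c c"
  by (simp add: e8_form_def)

lemma e8_coeffs_cases: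
  assumes "c \<in> e8_coeffs n"
  shows "map c [0..<8] \<in> set e8_pos \<or> map (\<lambda>i. - c i) [0..<8] \<in> set e8_pos"
  using assms e8_root_sign[of c] e8_pos_complete[of c] e8_pos_complete[of "\<lambda>i. - c i"]
  by (auto simp: e8_coeffs_def e8_form_uminus)

lemma finite_e8_roots: "finite (e8_roots n)"
proof -
  define g where "g = (\<lambda>v::int list. e8_lat (nth v))"
  have "e8_roots n \<subseteq> g ` set e8_pos \<union> uminus ` g ` set e8_pos"
  proof
    fix x assume "x \<in> e8_roots n"
    then obtain c where c: "c \<in> e8_coeffs n" "x = e8_lat c" by (auto simp: e8_roots_def)
    have 1: "x = g (map c [0..<8])"
      unfolding c g_def e8_lat_def e8_comb_def by (intro sum.cong) auto
    have 2: "x = - g (map (\<lambda>i. - c i) [0..<8])"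
      unfolding c g_def e8_lat_def e8_comb_def sum_negf[symmetric] by (intro sum.cong) auto
    from e8_coeffs_cases[OF c(1)] 1 2 show "x \<in> g ` set e8_pos \<union> uminus ` g ` set e8_pos"
      by blast
  qed
  then show ?thesis by (rule finite_subset) simp
qed

text \<open>Projecting along all simple roots but those numbered \<open>p\<close> and
  \<open>r\<close> retains just these two coefficients. The list \<open>P\<close> holds one root of
  each opposite pair, hence the two signs.\<close>

definition root_pairs :: "int list list \<Rightarrow> nat \<Rightarrow> nat \<Rightarrow> nat \<Rightarrow> (int \<times> int) list" where
  "root_pairs P n p r = (0, 0) # concat (map (\<lambda>(x, y). [(x, y), (- x, - y)])
     (remdups (map (\<lambda>v. (v ! p, v ! r)) (filter (\<lambda>v. list_all (\<lambda>i. v ! i = 0) [n..<8]) P))))"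

abbreviation e8_pairs :: "nat \<Rightarrow> nat \<Rightarrow> nat \<Rightarrow> (int \<times> int) list" where
  "e8_pairs \<equiv> root_pairs e8_pos"

lemma set_e8_pairs:
  assumes "p < 8" "r < 8" "n \<le> 8"
  shows "set (e8_pairs n p r) = insert (0, 0) ((\<lambda>c. (c p, c r)) ` e8_coeffs n)"
proof (intro equalityI subsetI)
  fix z assume "z \<in> set (e8_pairs n p r)"
  then consider "z = (0, 0)" | v where "v \<in> set e8_pos" "\<forall>i\<in>{n..<8}. v ! i = 0"
      "z = (v ! p, v ! r) \<or> z = (- (v ! p), - (v ! r))"
    by (auto simp: root_pairs_def list_all_iff)
  then show "z \<in> insert (0, 0) ((\<lambda>c. (c p, c r)) ` e8_coeffs n)"
  proof cases
    case 2
    \<comment> \<open>Entries beyond the end of a list are unspecified, whereas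
      \<open>e8_coeffs\<close> demands zeros there.\<close>
    define c where "c = (\<lambda>i. if i < 8 then v ! i else 0)"
    have "e8_form c c = e8_form (nth v) (nth v)" by (intro e8_form_cong) (auto simp: c_def)
    then have "c \<in> e8_coeffs n"
      using e8_pos_sound[OF 2(1)] 2(2) by (auto simp: e8_coeffs_def c_def)
    moreover from this have "(\<lambda>i. - c i) \<in> e8_coeffs n"
      by (auto simp: e8_coeffs_def e8_form_uminus)
    moreover have "z = (c p, c r) \<or> z = (- c p, - c r)" using 2(3) assms by (auto simp: c_def)
    ultimately show ?thesis by force
  qed auto
next
  fix z assume "z \<in> insert (0, 0) ((\<lambda>c. (c p, c r)) ` e8_coeffs n)"
  then consider "z = (0, 0)" | c where "c \<in> e8_coeffs n" "z = (c p, c r)" by auto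
  then show "z \<in> set (e8_pairs n p r)"
  proof cases
    case 2
    from e8_coeffs_cases[OF 2(1)] show ?thesis
    proof
      assume "map c [0..<8] \<in> set e8_pos"
      then show ?thesis using 2 assms
        by (auto simp: root_pairs_def e8_coeffs_def list_all_iff intro!: bexI[of _ "map c [0..<8]"])
    next
      assume "map (\<lambda>i. - c i) [0..<8] \<in> set e8_pos"
      then show ?thesis using 2 assms
        by (auto simp: root_pairs_def e8_coeffs_def list_all_iff
            intro!: bexI[of _ "map (\<lambda>i. - c i) [0..<8]"])
    qed
  qed (simp add: root_pairs_def)
qed

section \<open>Root system axioms, base and irreducibility\<close>

lemma e8_roots_norm: "x \<in> e8_roots n \<Longrightarrow> x \<bullet> x = 2"
  by (auto simp: e8_roots_def e8_coeffs_def inner_e8_lat)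

lemma e8_roots_inner_Ints: "x \<in> e8_roots n \<Longrightarrow> y \<in> e8_roots n \<Longrightarrow> x \<bullet> y \<in> \<int>"
  by (auto simp: e8_roots_def inner_e8_lat)

text \<open>All vectors of squared length 2 in the sublattice are roots, so closure under negation
  and reflection reduces to computing a norm.\<close>

lemma e8_roots_lin:
  assumes "x \<in> e8_roots n" "y \<in> e8_roots n"
    and "norm (of_int a *\<^sub>R x + of_int b *\<^sub>R y) ^ 2 = 2"
  shows "of_int a *\<^sub>R x + of_int b *\<^sub>R y \<in> e8_roots n"
proof -
  from assms obtain c d where cd: "c \<in> e8_coeffs n" "d \<in> e8_coeffs n" "x = e8_lat c" "y = e8_lat d"
    by (auto simp: e8_roots_def)
  have eq: "of_int a *\<^sub>R x + of_int b *\<^sub>R y = e8_lat (\<lambda>i. a * c i + b * d i)"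
    unfolding cd e8_lat_scale e8_lat_add ..
  have "of_int (e8_form (\<lambda>i. a * c i + b * d i) (\<lambda>i. a * c i + b * d i)) = (2::real)"
    using assms(3) unfolding eq power2_norm_eq_inner inner_e8_lat .
  then have "e8_form (\<lambda>i. a * c i + b * d i) (\<lambda>i. a * c i + b * d i) = 2" by linarith
  then show ?thesis unfolding eq e8_roots_def using cd by (auto simp: e8_coeffs_def)
qed

lemma e8_roots_uminus: "x \<in> e8_roots n \<Longrightarrow> - x \<in> e8_roots n"
  using e8_roots_lin[of x n x "-1" 0] e8_roots_norm[of x n]
  by (simp add: power2_norm_eq_inner)

lemma e8_roots_reflect:
  assumes "x \<in> e8_roots n" "y \<in> e8_roots n"
  shows "x - (x \<bullet> y) *\<^sub>R y \<in> e8_roots n"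
proof -
  from e8_roots_inner_Ints[OF assms] obtain k where k: "x \<bullet> y = of_int k" by (auto elim: Ints_cases)
  show ?thesis
    using e8_roots_lin[OF assms, of 1 "- k"] e8_roots_norm[OF assms(1)] e8_roots_norm[OF assms(2)]
    unfolding power2_norm_eq_inner
    by (simp add: inner_add_left inner_add_right inner_diff_left inner_diff_right k
        inner_commute[of y x] algebra_simps)
qed

lemma e8_simple_in_roots: "i < n \<Longrightarrow> n \<le> 8 \<Longrightarrow> e8_simple i \<in> e8_roots n"
  unfolding e8_roots_def
  by (rule image_eqI[of _ _ "e8_unit i"])
     (auto simp: e8_lat_unit e8_coeffs_def e8_form_unit_unit e8_unit_def)

lemma e8_lat_sum:
  assumes "n \<le> 8" "\<forall>i\<ge>n. c i = 0"
  shows "e8_lat c = (\<Sum>i<n. of_int (c i) *\<^sub>R e8_simple i)"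
  unfolding e8_lat_def e8_comb_def
  using assms by (intro sum.mono_neutral_right) auto

lemma e8_simple_indep:
  assumes "n \<le> 8" "(\<Sum>i<n. u i *\<^sub>R e8_simple i) = 0" "i < n"
  shows "u i = 0"
proof -
  have "e8_comb (\<lambda>i. if i < n then u i else 0) = (\<Sum>i<n. u i *\<^sub>R e8_simple i)"
    unfolding e8_comb_def using assms by (intro sum.mono_neutral_cong_right) auto
  then show ?thesis using e8_comb_eq_0[of "\<lambda>i. if i < n then u i else 0" i] assms by auto
qed

lemma inj_on_e8_simple: "inj_on e8_simple {..<8}"
proof (rule inj_onI, rule ccontr)
  fix i j assume ij: "i \<in> {..<8}" "j \<in> {..<8}" "e8_simple i = e8_simple j" "i \<noteq> j"
  have "e8_lat (e8_unit i) = e8_lat (e8_unit j)" using ij by (simp add: e8_lat_unit)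
  from e8_lat_inj[OF this, of i] ij show False by (simp add: e8_unit_def)
qed

lemma span_e8_roots:
  assumes "n \<le> 8"
  shows "span (e8_roots n) = span (e8_simple ` {..<n})"
proof (rule span_eq[THEN iffD2], intro conjI subsetI)
  fix x assume "x \<in> e8_roots n"
  then obtain c where "x = e8_lat c" "\<forall>i\<ge>n. c i = 0" by (auto simp: e8_roots_def e8_coeffs_def)
  then have "x = (\<Sum>i<n. of_int (c i) *\<^sub>R e8_simple i)" using assms e8_lat_sum by blast
  then show "x \<in> span (e8_simple ` {..<n})"
    by (simp, intro span_sum span_scale) (auto intro: span_base)
next
  fix x assume "x \<in> e8_simple ` {..<n}"
  then show "x \<in> span (e8_roots n)" using assms e8_simple_in_roots by (auto intro: span_base)
qed

lemma root_base_e8: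
  assumes "n \<le> 8"
  shows "root_base (e8_simple ` {..<n}) (e8_roots n) (span (e8_roots n))"
  unfolding root_base_def
proof (intro conjI ballI)
  have inj: "inj_on e8_simple {..<n}"
    by (rule inj_on_subset[OF inj_on_e8_simple]) (use assms in auto)
  show "e8_simple ` {..<n} \<subseteq> e8_roots n" using assms e8_simple_in_roots by auto
  show "independent (e8_simple ` {..<n})"
    unfolding independent_explicit_finite_subsets
  proof (intro allI impI ballI)
    fix A u v assume A: "A \<subseteq> e8_simple ` {..<n}" "finite A" "(\<Sum>v\<in>A. u v *\<^sub>R v) = 0" "v \<in> A"
    define w where "w = (\<lambda>i. if e8_simple i \<in> A then u (e8_simple i) else 0)"
    have "(\<Sum>i<n. w i *\<^sub>R e8_simple i) =
        (\<Sum>x\<in>e8_simple ` {..<n}. (if x \<in> A then u x else 0) *\<^sub>R x)"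
      by (subst sum.reindex[OF inj]) (simp add: w_def)
    also have "\<dots> = (\<Sum>v\<in>A. u v *\<^sub>R v)"
      using A by (intro sum.mono_neutral_cong_right) auto
    finally have "w i = 0" if "i < n" for i using e8_simple_indep[OF assms, of w i] A that by simp
    with A show "u v = 0" by (fastforce simp: w_def)
  qed
  show "span (e8_simple ` {..<n}) = span (e8_roots n)" using span_e8_roots[OF assms] ..
  fix x assume "x \<in> e8_roots n"
  then obtain c where c: "x = e8_lat c" "\<forall>i\<ge>n. c i = 0" "e8_form c c = 2"
    by (auto simp: e8_roots_def e8_coeffs_def)
  define d where "d = (\<lambda>v. c (the_inv_into {..<n} e8_simple v))"
  have d: "d (e8_simple i) = c i" if "i < n" for i
    using that by (simp add: d_def the_inv_into_f_f[OF inj])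
  show "\<exists>c. x = (\<Sum>\<alpha>\<in>e8_simple ` {..<n}. of_int (c \<alpha>) *\<^sub>R \<alpha>) \<and>
      ((\<forall>\<alpha>\<in>e8_simple ` {..<n}. 0 \<le> c \<alpha>) \<or> (\<forall>\<alpha>\<in>e8_simple ` {..<n}. c \<alpha> \<le> 0))"
  proof (intro exI[of _ d] conjI)
    show "x = (\<Sum>\<alpha>\<in>e8_simple ` {..<n}. of_int (d \<alpha>) *\<^sub>R \<alpha>)"
      unfolding sum.reindex[OF inj] c(1) e8_lat_sum[OF assms c(2)] by (simp add: d)
    show "(\<forall>\<alpha>\<in>e8_simple ` {..<n}. 0 \<le> d \<alpha>) \<or> (\<forall>\<alpha>\<in>e8_simple ` {..<n}. d \<alpha> \<le> 0)"
      using e8_root_sign[OF c(3)] assms by (auto simp: d)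
  qed
qed

text \<open>The Dynkin diagram is connected: every simple root but the first is not orthogonal to
  its parent, which has a smaller index. So all simple roots lie on the same side of a splitting as
  the first, and a root on the other side would be orthogonal to the whole span.\<close>

lemma irreducible_e8_roots:
  assumes "n \<le> 8" "n > 0"
  shows "irreducible_root_system (e8_roots n) (span (e8_roots n))"
  unfolding irreducible_root_system_def reduced_root_system_def
proof (intro conjI ballI allI notI)
  show "finite (e8_roots n)" by (rule finite_e8_roots)
  show "0 \<in> e8_roots n \<Longrightarrow> False" using e8_roots_norm[of 0 n] by simp
  show "e8_roots n = {} \<Longrightarrow> False" using e8_simple_in_roots[OF assms(2,1)] by simp
next
  fix \<alpha> c assume \<alpha>: "\<alpha> \<in> e8_roots n"
  show "c *\<^sub>R \<alpha> \<in> e8_roots n \<longleftrightarrow> c = 1 \<or> c = - 1"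
  proof
    assume "c *\<^sub>R \<alpha> \<in> e8_roots n"
    from e8_roots_norm[OF this] e8_roots_norm[OF \<alpha>] have "c * c = 1" by simp
    then show "c = 1 \<or> c = - 1" using square_eq_1_iff by blast
  qed (use \<alpha> e8_roots_uminus in auto)
next
  fix \<alpha> \<beta> assume ab: "\<alpha> \<in> e8_roots n" "\<beta> \<in> e8_roots n"
  from ab show "2 * (\<beta> \<bullet> \<alpha>) / (\<alpha> \<bullet> \<alpha>) \<in> \<int>" "\<beta> - (2 * (\<beta> \<bullet> \<alpha>) / (\<alpha> \<bullet> \<alpha>)) *\<^sub>R \<alpha> \<in> e8_roots n"
    using e8_roots_norm e8_roots_inner_Ints e8_roots_reflect by auto
next
  assume "\<exists>A B. A \<noteq> {} \<and> B \<noteq> {} \<and> e8_roots n = A \<union> B \<and> (\<forall>\<alpha>\<in>A. \<forall>\<beta>\<in>B. orthogonal \<alpha> \<beta>)"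
  then obtain A B where AB: "A \<noteq> {}" "B \<noteq> {}" "e8_roots n = A \<union> B" "\<forall>\<alpha>\<in>A. \<forall>\<beta>\<in>B. orthogonal \<alpha> \<beta>"
    by blast
  have e8_base: False if C: "C \<noteq> {}" "C \<subseteq> e8_roots n" "\<forall>i<n. \<forall>\<beta>\<in>C. orthogonal (e8_simple i) \<beta>" for C
  proof -
    from C obtain b where b: "b \<in> C" by blast
    have "b \<in> span (e8_simple ` {..<n})"
      using b C span_e8_roots[OF assms(1)] span_base by blast
    moreover have "orthogonal b x" if "x \<in> e8_simple ` {..<n}" for x
      using that C b by (auto simp: orthogonal_commute)
    ultimately have "orthogonal b b" using orthogonal_to_span by blast
    then show False using e8_roots_norm[of b n] b C by (auto simp: orthogonal_def)
  qed
  have e8_link: "\<not> orthogonal (e8_simple (e8_parent i)) (e8_simple i)"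
    "\<not> orthogonal (e8_simple i) (e8_simple (e8_parent i))" "e8_parent i < i" if "0 < i" "i < n" for i
  proof -
    show *: "e8_parent i < i" using that by (auto simp: e8_parent_def)
    then show "\<not> orthogonal (e8_simple (e8_parent i)) (e8_simple i)"
      "\<not> orthogonal (e8_simple i) (e8_simple (e8_parent i))"
      using that assms by (auto simp: orthogonal_def inner_e8_simple e8_cartan_def)
  qed
  have e8_prop: "e8_simple i \<in> C" if "e8_simple 0 \<in> C" "e8_roots n = C \<union> D"
      "\<forall>\<alpha>\<in>C. \<forall>\<beta>\<in>D. orthogonal \<alpha> \<beta>" "i < n" for C D i
    using that(4)
  proof (induction i rule: less_induct)
    case (less i)
    show ?case
    proof (cases "i = 0")
      case False
      then have "e8_simple (e8_parent i) \<in> C" using less e8_link[of i] by auto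
      then show ?thesis
        using e8_link[of i] False less.prems that(2,3) e8_simple_in_roots[OF less.prems assms(1)] by auto
    qed (use that in simp)
  qed
  have "e8_simple 0 \<in> A \<union> B" using e8_simple_in_roots[OF assms(2,1)] AB by simp
  then show False
  proof
    assume "e8_simple 0 \<in> A"
    from e8_prop[OF this AB(3,4)] show False using e8_base[of B] AB by blast
  next
    assume "e8_simple 0 \<in> B"
    from e8_prop[OF this, of A] show False
      using e8_base[of A] AB by (metis orthogonal_commute sup_commute sup_ge1)
  qed
qed simp

section \<open>Quotients as generalized root systems\<close>

lemma grs_0:
  assumes "grs R V"
  shows "0 \<in> R"
proof -
  obtain x where x: "x \<in> R" using assms by (auto simp: grs_def)
  show ?thesis
  proof (cases "x = 0")
    case False
    then have "x \<bullet> x > 0" by simp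
    with x assms have "x - x \<in> R" unfolding grs_def by blast
    then show ?thesis by simp
  qed (use x in simp)
qed

lemma grs_uminus:
  assumes "grs R V" "x \<in> R"
  shows "- x \<in> R"
proof -
  have "0 \<bullet> x = 0" "0 + x \<in> R" using assms by auto
  with assms grs_0[OF assms(1)] have "0 - x \<in> R" unfolding grs_def by blast
  then show ?thesis by simp
qed

lemma quotient_space_decomp:
  fixes I :: "'a::real_inner set"
  assumes "finite I" "subspace U" "I \<subseteq> U"
  defines "\<pi> \<equiv> orth_proj (quotient_space U I)"
  shows "x \<in> U \<Longrightarrow> \<pi> x \<in> quotient_space U I"
    and "x \<in> U \<Longrightarrow> x - \<pi> x \<in> span I"
    and "y \<in> quotient_space U I \<Longrightarrow> x - y \<in> span I \<Longrightarrow> \<pi> x = y"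
    and "w \<in> span I \<Longrightarrow> y \<in> quotient_space U I \<Longrightarrow> w \<bullet> y = 0"
    and "subspace (quotient_space U I)"
proof -
  show W: "subspace (quotient_space U I)"
    unfolding quotient_space_def using assms
    by (intro subspace_inter subspace_orthogonal_comp) auto
  show orth: "w \<in> span I \<Longrightarrow> y \<in> quotient_space U I \<Longrightarrow> w \<bullet> y = 0" for w y
    by (auto simp: quotient_space_def orthogonal_comp_def orthogonal_def inner_commute)
  show "x \<in> U \<Longrightarrow> \<pi> x \<in> quotient_space U I" "x \<in> U \<Longrightarrow> x - \<pi> x \<in> span I"
    unfolding \<pi>_def using orth_proj_quotient_space assms by blast+
  show "\<pi> x = y" if "y \<in> quotient_space U I" "x - y \<in> span I"
    unfolding \<pi>_def using that orth
    by (intro orth_proj_eqI W) (auto simp: orthogonal_def)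
qed

text \<open>The sum over a fiber of the projection is invariant under the reflections in \<open>I\<close>, hence
  orthogonal to \<open>I\<close>: inner products with a projected root are averages over its fiber.\<close>

lemma grs_quotient:
  fixes \<Psi> U I :: "'a::real_inner set"
  assumes G: "grs \<Psi> U" and I: "finite I" "I \<subseteq> U"
    and refl: "\<And>a x. a \<in> I \<Longrightarrow> x \<in> \<Psi> \<Longrightarrow> x - (2 * (x \<bullet> a) / (a \<bullet> a)) *\<^sub>R a \<in> \<Psi>"
  shows "grs (orth_proj (quotient_space U I) ` \<Psi>) (quotient_space U I)"
proof -
  define W where "W = quotient_space U I"
  define \<pi> where "\<pi> = orth_proj W"
  have U: "U = span \<Psi>" "subspace U" "\<Psi> \<subseteq> U" "finite \<Psi>"
    using G by (auto simp: grs_def intro: span_base)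
  note dec = quotient_space_decomp[OF I(1) U(2) I(2), folded W_def, folded \<pi>_def]
  have add: "\<pi> (x + y) = \<pi> x + \<pi> y" if "x \<in> U" "y \<in> U" for x y
  proof (rule dec(3))
    show "\<pi> x + \<pi> y \<in> W" using that dec by (auto intro: subspace_add)
    have "(x - \<pi> x) + (y - \<pi> y) \<in> span I" using that dec by (auto intro: span_add)
    then show "x + y - (\<pi> x + \<pi> y) \<in> span I" by (simp add: algebra_simps)
  qed
  have scale: "\<pi> (c *\<^sub>R x) = c *\<^sub>R \<pi> x" if "x \<in> U" for x c
  proof (rule dec(3))
    show "c *\<^sub>R \<pi> x \<in> W" using that dec by (auto intro: subspace_scale)
    have "c *\<^sub>R (x - \<pi> x) \<in> span I" using that dec by (auto intro: span_scale)
    then show "c *\<^sub>R x - c *\<^sub>R \<pi> x \<in> span I" by (simp add: algebra_simps)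
  qed
  have diff: "\<pi> (x - y) = \<pi> x - \<pi> y" if "x \<in> U" "y \<in> U" for x y
    using add[of x "- y"] scale[of y "- 1"] that U(2) by (simp add: subspace_neg)
  have avg: "(\<Sum>x\<in>{x \<in> \<Psi>. \<pi> x = z}. x \<bullet> y) = of_nat (card {x \<in> \<Psi>. \<pi> x = z}) * (z \<bullet> \<pi> y)"
    if y: "y \<in> U" for y z
  proof -
    let ?F = "{x \<in> \<Psi>. \<pi> x = z}"
    have ortho: "(\<Sum>x\<in>?F. x) \<bullet> a = 0" if a: "a \<in> I" for a
    proof (cases "a = 0")
      case False
      define s where "s = (\<lambda>x. x - (2 * (x \<bullet> a) / (a \<bullet> a)) *\<^sub>R a)"
      have inv: "s (s x) = x" for x
        using False by (simp add: s_def inner_diff_left)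
      have sF: "s x \<in> ?F" if "x \<in> ?F" for x
      proof -
        have "\<pi> (s x) = \<pi> x"
        proof (rule dec(3))
          have "x \<in> U" using that U by auto
          then show "\<pi> x \<in> W" using dec by blast
          have "(x - \<pi> x) - (2 * (x \<bullet> a) / (a \<bullet> a)) *\<^sub>R a \<in> span I"
            by (rule span_diff[OF dec(2)[OF \<open>x \<in> U\<close>] span_scale[OF span_base[OF a]]])
          then show "s x - \<pi> x \<in> span I" by (simp add: s_def algebra_simps)
        qed
        then show ?thesis using that refl[OF a] by (simp add: s_def)
      qed
      have "(\<Sum>x\<in>?F. x \<bullet> a) = (\<Sum>x\<in>?F. s x \<bullet> a)"
        by (rule sum.reindex_bij_witness[of _ s s]) (use inv sF in auto)
      also have "\<dots> = (\<Sum>x\<in>?F. - (x \<bullet> a))"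
        using False by (intro sum.cong) (auto simp: s_def inner_diff_left)
      finally show ?thesis by (simp add: inner_sum_left sum_negf)
    qed simp
    have "(\<Sum>x\<in>?F. x) \<bullet> (y - \<pi> y) = 0"
      using dec(2)[OF y] orthogonal_to_span[of "y - \<pi> y" I "\<Sum>x\<in>?F. x"] ortho
      by (auto simp: orthogonal_def)
    then have "(\<Sum>x\<in>?F. x \<bullet> y) = (\<Sum>x\<in>?F. x \<bullet> \<pi> y)"
      by (simp add: inner_diff_right flip: inner_sum_left)
    also have "\<dots> = (\<Sum>x\<in>?F. z \<bullet> \<pi> y)"
    proof (rule sum.cong)
      fix x assume x: "x \<in> ?F"
      then have "x \<in> U" using U by auto
      then have "(x - \<pi> x) \<bullet> \<pi> y = 0" using dec y by blast
      with x show "x \<bullet> \<pi> y = z \<bullet> \<pi> y" by (simp add: inner_diff_left)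
    qed simp
    finally show ?thesis by simp
  qed
  have ax: "(x \<bullet> y < 0 \<longrightarrow> x + y \<in> \<Psi>) \<and> (x \<bullet> y > 0 \<longrightarrow> x - y \<in> \<Psi>) \<and>
      (x \<bullet> y = 0 \<longrightarrow> (x + y \<in> \<Psi> \<longleftrightarrow> x - y \<in> \<Psi>))" if "x \<in> \<Psi>" "y \<in> \<Psi>" for x y
    using G that unfolding grs_def by blast
  have neg: "\<exists>v\<in>\<Psi>. \<pi> v = \<pi> x \<and> v \<bullet> y < 0" if "x \<in> \<Psi>" "y \<in> U" "\<pi> x \<bullet> \<pi> y < 0" for x y
  proof (rule ccontr)
    assume "\<not> ?thesis"
    then have "(\<Sum>v\<in>{v \<in> \<Psi>. \<pi> v = \<pi> x}. v \<bullet> y) \<ge> 0" by (intro sum_nonneg) force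
    moreover have "card {v \<in> \<Psi>. \<pi> v = \<pi> x} > 0" using that U by (auto simp: card_gt_0_iff)
    then have "of_nat (card {v \<in> \<Psi>. \<pi> v = \<pi> x}) * (\<pi> x \<bullet> \<pi> y) < 0"
      using that(3) by (intro mult_pos_neg) simp_all
    ultimately show False using avg[OF that(2), of "\<pi> x"] by linarith
  qed
  have neg_add: "\<pi> x + \<pi> y \<in> \<pi> ` \<Psi>" if xy: "x \<in> \<Psi>" "y \<in> \<Psi>" "\<pi> x \<bullet> \<pi> y < 0" for x y
  proof -
    obtain v where v: "v \<in> \<Psi>" "\<pi> v = \<pi> x" "v \<bullet> y < 0"
      using neg[of x y] xy U(3) by blast
    with ax xy have "v + y \<in> \<Psi>" by blast
    moreover have "\<pi> (v + y) = \<pi> x + \<pi> y" using v xy U by (simp add: add subset_iff)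
    ultimately show ?thesis by (metis image_eqI)
  qed
  have pos_diff: "\<pi> x - \<pi> y \<in> \<pi> ` \<Psi>" if xy: "x \<in> \<Psi>" "y \<in> \<Psi>" "\<pi> x \<bullet> \<pi> y > 0" for x y
  proof -
    have "\<pi> (- y) = - \<pi> y" using scale[of y "- 1"] xy U by auto
    with neg_add[of x "- y"] xy grs_uminus[OF G] show ?thesis by simp
  qed
  \<comment> \<open>The root \<open>g\<close> over the sum pairs positively with some
    \<open>b\<close> over \<open>\<pi> y\<close>, so \<open>v = g - b\<close> is a root over
    \<open>\<pi> x\<close> such that \<open>v + b\<close> is in \<open>\<Psi>\<close>. If
    \<open>v\<close> and \<open>b\<close> have a nonnegative product, the axioms give
    \<open>v - b\<close>. Otherwise, as the products with \<open>b\<close> average to 0 over the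
    fiber of \<open>\<pi> x\<close>, some \<open>u\<close> in that fiber pairs positively with
    \<open>b\<close>.\<close>
  have zero: "\<pi> x - \<pi> y \<in> \<pi> ` \<Psi>"
    if xy: "x \<in> \<Psi>" "y \<in> \<Psi>" "\<pi> x \<bullet> \<pi> y = 0" "\<pi> x + \<pi> y \<in> \<pi> ` \<Psi>" for x y
  proof (cases "\<pi> y = 0")
    case True
    with xy show ?thesis by auto
  next
    case False
    from xy(4) obtain g where g: "g \<in> \<Psi>" "\<pi> g = \<pi> x + \<pi> y" by force
    have pos: "\<pi> (- y) = - \<pi> y" "- y \<in> \<Psi>" "- g \<in> \<Psi>" "\<pi> (- g) = - \<pi> g"
      using scale[of y "- 1"] scale[of g "- 1"] xy g U grs_uminus[OF G] by auto
    have "\<pi> y \<bullet> \<pi> (- g) < 0"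
      using xy(3) False by (simp add: pos g inner_diff_right inner_commute[of "\<pi> y" "\<pi> x"])
    then obtain b where b: "b \<in> \<Psi>" "\<pi> b = \<pi> y" "b \<bullet> (- g) < 0"
      using neg[OF xy(2), of "- g"] pos(3) U(3) by blast
    then have "g - b \<in> \<Psi>" using ax[OF g(1) b(1)] by (simp add: inner_commute)
    moreover define v where "v = g - b"
    ultimately have v: "v \<in> \<Psi>" "v + b \<in> \<Psi>" using g by auto
    have piv: "\<pi> v = \<pi> x" using b g U by (simp add: v_def diff subset_iff)
    show ?thesis
    proof (cases "v \<bullet> b > 0 \<or> v \<bullet> b = 0")
      case True
      then have "v - b \<in> \<Psi>" using ax v b by blast
      moreover have "\<pi> (v - b) = \<pi> x - \<pi> y" using piv b v U by (simp add: diff subset_iff)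
      ultimately show ?thesis by (metis image_eqI)
    next
      case False
      have "\<exists>u\<in>\<Psi>. \<pi> u = \<pi> x \<and> u \<bullet> b > 0"
      proof (rule ccontr)
        assume *: "\<not> ?thesis"
        have "(\<Sum>u\<in>{u \<in> \<Psi>. \<pi> u = \<pi> x}. u \<bullet> b) < (\<Sum>u\<in>{u \<in> \<Psi>. \<pi> u = \<pi> x}. 0)"
        proof (rule sum_strict_mono_ex1)
          show "\<forall>u\<in>{u \<in> \<Psi>. \<pi> u = \<pi> x}. u \<bullet> b \<le> 0" using * by force
          show "\<exists>u\<in>{u \<in> \<Psi>. \<pi> u = \<pi> x}. u \<bullet> b < 0" using False v piv by force
        qed (use U in simp)
        then show False using avg[of b "\<pi> x"] b U xy(3) by (simp add: subset_iff)
      qed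
      then obtain u where u: "u \<in> \<Psi>" "\<pi> u = \<pi> x" "u \<bullet> b > 0" by blast
      then have "u - b \<in> \<Psi>" using ax b by blast
      moreover have "\<pi> (u - b) = \<pi> x - \<pi> y" using u b U by (simp add: diff subset_iff)
      ultimately show ?thesis by (metis image_eqI)
    qed
  qed
  have zero': "\<pi> x + \<pi> y \<in> \<pi> ` \<Psi>"
    if xy: "x \<in> \<Psi>" "y \<in> \<Psi>" "\<pi> x \<bullet> \<pi> y = 0" "\<pi> x - \<pi> y \<in> \<pi> ` \<Psi>" for x y
  proof -
    have "\<pi> (- y) = - \<pi> y" using scale[of y "- 1"] xy U by auto
    with zero[of x "- y"] xy grs_uminus[OF G] show ?thesis by simp
  qed
  have span: "W = span (\<pi> ` \<Psi>)"
  proof (intro equalityI subsetI)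
    fix w assume w: "w \<in> W"
    have "x \<in> U \<and> \<pi> x \<in> span (\<pi> ` \<Psi>)" if "x \<in> span \<Psi>" for x
      using that
    proof (induction rule: span_induct_alt)
      case base
      have "\<pi> 0 = 0" using scale[of 0 0] U(2) by (simp add: subspace_0)
      then show ?case using U(2) by (simp add: subspace_0 span_zero)
    next
      case (step c x y)
      then have "x \<in> U" using U by blast
      with step U(2) have "c *\<^sub>R x \<in> U" "y \<in> U" by (auto simp: subspace_scale)
      moreover have "\<pi> x \<in> span (\<pi> ` \<Psi>)" using step by (auto intro: span_base)
      ultimately show ?case
        using step U(2) \<open>x \<in> U\<close> by (simp add: add scale subspace_add span_add span_scale)
    qed
    moreover have "w \<in> span \<Psi>" using w U(1) by (auto simp: W_def quotient_space_def)
    moreover have "\<pi> w = w" using w by (intro dec(3)) (auto simp: span_zero)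
    ultimately show "w \<in> span (\<pi> ` \<Psi>)" by metis
  next
    fix w assume "w \<in> span (\<pi> ` \<Psi>)"
    then show "w \<in> W"
      using span_minimal[of "\<pi> ` \<Psi>" W] dec U by blast
  qed
  have "grs (\<pi> ` \<Psi>) W"
    unfolding grs_def
  proof (intro conjI ballI)
    show "\<pi> ` \<Psi> \<noteq> {}" using grs_0[OF G] by blast
    show "finite (\<pi> ` \<Psi>)" using U by simp
    show "W = span (\<pi> ` \<Psi>)" by (rule span)
    fix a b assume "a \<in> \<pi> ` \<Psi>" "b \<in> \<pi> ` \<Psi>"
    then obtain x y where "x \<in> \<Psi>" "y \<in> \<Psi>" "a = \<pi> x" "b = \<pi> y" by blast
    then show "a \<bullet> b < 0 \<longrightarrow> a + b \<in> \<pi> ` \<Psi>" "a \<bullet> b > 0 \<longrightarrow> a - b \<in> \<pi> ` \<Psi>"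
      "a \<bullet> b = 0 \<longrightarrow> (a + b \<in> \<pi> ` \<Psi> \<longleftrightarrow> a - b \<in> \<pi> ` \<Psi>)"
      using neg_add[of x y] pos_diff[of x y] zero[of x y] zero'[of x y] by blast+
  qed
  then show ?thesis by (simp add: \<pi>_def W_def)
qed

text \<open>Inner products of roots are integers. A negative one is -1, where the sum has squared
  length 2, or at most -2, where the sum is 0. Orthogonal roots have sum and difference of squared
  length 4, so neither is a root.\<close>

lemma grs_e8_roots: "grs (insert 0 (e8_roots n)) (span (e8_roots n))"
proof -
  have pair: "(x \<bullet> y < 0 \<longrightarrow> x + y \<in> insert 0 (e8_roots n)) \<and>
      (x \<bullet> y = 0 \<longrightarrow> x + y \<notin> insert 0 (e8_roots n))" if xy: "x \<in> e8_roots n" "y \<in> e8_roots n" for x y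
  proof -
    obtain k where k: "x \<bullet> y = of_int k" using e8_roots_inner_Ints[OF xy] by (auto elim: Ints_cases)
    have n: "(x + y) \<bullet> (x + y) = 4 + 2 * (x \<bullet> y)"
      using e8_roots_norm[OF xy(1)] e8_roots_norm[OF xy(2)]
      by (simp add: inner_add_left inner_add_right inner_commute[of y x])
    have "x + y \<in> insert 0 (e8_roots n)" if "x \<bullet> y < 0"
    proof (cases "k = - 1")
      case True
      then show ?thesis
        using e8_roots_lin[OF xy, of 1 1] n k by (simp add: power2_norm_eq_inner)
    next
      case False
      then have "k \<le> - 2" using that k by linarith
      then have "(x + y) \<bullet> (x + y) \<le> 0" using n k by simp
      then have "x + y = 0" by (metis inner_ge_zero inner_eq_zero_iff order_antisym)
      then show ?thesis by simp
    qed
    moreover have "x + y \<notin> insert 0 (e8_roots n)" if "x \<bullet> y = 0"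
      using n that e8_roots_norm[of "x + y" n] by auto
    ultimately show ?thesis by blast
  qed
  have "(x \<bullet> y < 0 \<longrightarrow> x + y \<in> insert 0 (e8_roots n)) \<and>
      (x \<bullet> y > 0 \<longrightarrow> x - y \<in> insert 0 (e8_roots n)) \<and>
      (x \<bullet> y = 0 \<longrightarrow> (x + y \<in> insert 0 (e8_roots n) \<longleftrightarrow> x - y \<in> insert 0 (e8_roots n)))"
    if "x \<in> insert 0 (e8_roots n)" "y \<in> insert 0 (e8_roots n)" for x y
  proof (cases "x = 0 \<or> y = 0")
    case True
    with that e8_roots_uminus[of y n] e8_roots_uminus[of "- y" n] show ?thesis by auto
  next
    case False
    with that pair[of x y] pair[of x "- y"] e8_roots_uminus[of y n] show ?thesis by auto
  qed
  then show ?thesis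
    unfolding grs_def using finite_e8_roots by (auto simp: span_insert_0)
qed

text \<open>The projections \<open>w1\<close>, \<open>w2\<close> of the two remaining simple roots
  form a basis of the quotient space, in which a projected root keeps its coefficients at
  \<open>p\<close> and \<open>r\<close> as coordinates.\<close>

lemma e8_quotient:
  assumes n: "n \<le> 8" and p: "p < n" "r < n" "p \<noteq> r"
  obtains Q W :: "fseq set" and w1 w2 where "root_system_quotient Q W" "grs Q W" "W = span {w1, w2}"
    "\<And>a b. a *\<^sub>R w1 + b *\<^sub>R w2 = 0 \<Longrightarrow> a = 0 \<and> b = 0"
    "Q = (\<lambda>(x, y). of_int x *\<^sub>R w1 + of_int y *\<^sub>R w2) ` set (e8_pairs n p r)"
proof -
  define I where "I = e8_simple ` ({..<n} - {p, r})"
  define U where "U = span (e8_roots n)"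
  define W where "W = quotient_space U I"
  define \<pi> where "\<pi> = orth_proj W"
  have I: "finite I" "I \<subseteq> U" "subspace U" "I \<subseteq> e8_simple ` {..<n}" "I \<subseteq> e8_roots n"
    using e8_simple_in_roots n by (auto simp: I_def U_def intro: span_base)
  note dec = quotient_space_decomp[OF I(1,3,2), folded W_def, folded \<pi>_def]
  have simple_U: "e8_simple i \<in> U" if "i < n" for i
    using that e8_simple_in_roots n by (auto simp: U_def intro: span_base)
  define w1 w2 where "w1 = \<pi> (e8_simple p)" and "w2 = \<pi> (e8_simple r)"
  have w: "w1 \<in> W" "w2 \<in> W" "e8_simple p - w1 \<in> span I" "e8_simple r - w2 \<in> span I"
    using dec simple_U p by (auto simp: w1_def w2_def)
  have proj: "\<pi> (e8_lat c) = of_int (c p) *\<^sub>R w1 + of_int (c r) *\<^sub>R w2" if "\<forall>i\<ge>n. c i = 0" for c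
  proof (rule dec(3))
    show "of_int (c p) *\<^sub>R w1 + of_int (c r) *\<^sub>R w2 \<in> W"
      using w dec(5) by (simp add: subspace_add subspace_scale)
    have "e8_lat c = (\<Sum>i\<in>{..<n}. of_int (c i) *\<^sub>R e8_simple i)"
      using e8_lat_sum[OF n that] .
    also have "{..<n} = insert p (insert r ({..<n} - {p, r}))" using p by auto
    also have "(\<Sum>i\<in>insert p (insert r ({..<n} - {p, r})). of_int (c i) *\<^sub>R e8_simple i) =
        of_int (c p) *\<^sub>R e8_simple p + (of_int (c r) *\<^sub>R e8_simple r
        + (\<Sum>i\<in>{..<n} - {p, r}. of_int (c i) *\<^sub>R e8_simple i))"
      using p by (subst sum.insert; simp)+
    finally have "e8_lat c - (of_int (c p) *\<^sub>R w1 + of_int (c r) *\<^sub>R w2) =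
        of_int (c p) *\<^sub>R (e8_simple p - w1) + of_int (c r) *\<^sub>R (e8_simple r - w2)
        + (\<Sum>i\<in>{..<n} - {p, r}. of_int (c i) *\<^sub>R e8_simple i)"
      by (simp add: algebra_simps)
    also have "\<dots> \<in> span I"
      by (intro span_add span_scale span_sum w) (auto simp: I_def intro: span_base)
    finally show "e8_lat c - (of_int (c p) *\<^sub>R w1 + of_int (c r) *\<^sub>R w2) \<in> span I" .
  qed
  have \<pi>0: "\<pi> 0 = 0" using dec(3)[of 0 0] dec(5) by (simp add: subspace_0 span_zero)
  have Q: "quotient_roots (e8_roots n) U I =
      (\<lambda>(x, y). of_int x *\<^sub>R w1 + of_int y *\<^sub>R w2) ` set (e8_pairs n p r)"
  proof -
    have "set (e8_pairs n p r) = insert (0, 0) ((\<lambda>c. (c p, c r)) ` e8_coeffs n)"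
      using p n by (intro set_e8_pairs) auto
    moreover have "\<pi> ` e8_roots n =
        (\<lambda>c. of_int (c p) *\<^sub>R w1 + of_int (c r) *\<^sub>R w2) ` e8_coeffs n"
      unfolding e8_roots_def image_image by (intro image_cong proj) (auto simp: e8_coeffs_def)
    ultimately show ?thesis
      unfolding quotient_roots_def W_def[symmetric] \<pi>_def[symmetric] by (simp add: \<pi>0 image_image)
  qed
  have G: "grs (quotient_roots (e8_roots n) U I) W"
    unfolding quotient_roots_def W_def
  proof (rule grs_quotient)
    show "grs (insert 0 (e8_roots n)) U" unfolding U_def by (rule grs_e8_roots)
    fix a x assume "a \<in> I" "x \<in> insert 0 (e8_roots n)"
    then show "x - (2 * (x \<bullet> a) / (a \<bullet> a)) *\<^sub>R a \<in> insert 0 (e8_roots n)"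
      using I(5) e8_roots_reflect[of x n a] e8_roots_norm[of a n] by auto
  qed (use I in auto)
  show ?thesis
  proof (rule that)
    show "root_system_quotient (quotient_roots (e8_roots n) U I) W"
      unfolding root_system_quotient_def W_def U_def
      using irreducible_e8_roots[OF n] root_base_e8[OF n] I(4) p(1) by blast
    show "W = span {w1, w2}"
    proof
      show "span {w1, w2} \<subseteq> W" using w dec(5) by (intro span_minimal) auto
      have "W = span (quotient_roots (e8_roots n) U I)" using G by (simp add: grs_def)
      also have "\<dots> \<subseteq> span {w1, w2}"
        unfolding Q by (intro span_minimal subspace_span)
          (auto intro!: span_add span_scale[OF span_base])
      finally show "W \<subseteq> span {w1, w2}" .
    qed
    \<comment> \<open>A vanishing combination of the projections puts the same combination of the
      simple roots into \<open>span I\<close>, against their independence.\<close>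
    fix a b assume ab: "a *\<^sub>R w1 + b *\<^sub>R w2 = 0"
    have "a *\<^sub>R (e8_simple p - w1) + b *\<^sub>R (e8_simple r - w2) \<in> span I"
      by (intro span_add span_scale w)
    also have "a *\<^sub>R (e8_simple p - w1) + b *\<^sub>R (e8_simple r - w2) =
        a *\<^sub>R e8_simple p + b *\<^sub>R e8_simple r - (a *\<^sub>R w1 + b *\<^sub>R w2)"
      by (simp add: algebra_simps)
    finally have "a *\<^sub>R e8_simple p + b *\<^sub>R e8_simple r \<in> span I" using ab by simp
    then obtain u where u: "a *\<^sub>R e8_simple p + b *\<^sub>R e8_simple r = (\<Sum>v\<in>I. u v *\<^sub>R v)"
      using span_finite[OF I(1)] by auto
    have inj: "inj_on e8_simple ({..<n} - {p, r})"
      by (rule inj_on_subset[OF inj_on_e8_simple]) (use n in auto)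
    define c where "c = (\<lambda>i. if i = p then a else if i = r then b else - u (e8_simple i))"
    have "(\<Sum>i\<in>{..<n}. c i *\<^sub>R e8_simple i) =
        (\<Sum>i\<in>insert p (insert r ({..<n} - {p, r})). c i *\<^sub>R e8_simple i)"
      using p by (intro sum.cong) auto
    also have "\<dots> = c p *\<^sub>R e8_simple p + (c r *\<^sub>R e8_simple r
        + (\<Sum>i\<in>{..<n} - {p, r}. c i *\<^sub>R e8_simple i))"
      using p by (subst sum.insert; simp)+
    also have "(\<Sum>i\<in>{..<n} - {p, r}. c i *\<^sub>R e8_simple i) =
        (\<Sum>i\<in>{..<n} - {p, r}. - (u (e8_simple i) *\<^sub>R e8_simple i))"
      by (intro sum.cong) (auto simp: c_def)
    also have "\<dots> = - (\<Sum>v\<in>I. u v *\<^sub>R v)"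
      unfolding I_def by (subst sum.reindex[OF inj]) (simp add: sum_negf)
    finally have "(\<Sum>i<n. c i *\<^sub>R e8_simple i) = 0"
      using p by (simp add: c_def u[symmetric] algebra_simps)
    then show "a = 0 \<and> b = 0"
      using e8_simple_indep[OF n, of c p] e8_simple_indep[OF n, of c r] p by (auto simp: c_def)
  qed (rule G, rule Q)
qed

section \<open>The table of rank 2 systems\<close>

text \<open>A system is given by the length \<open>m\<close> of row 0, in steps of the primitive root, and the endpoints of the
  rows \<open>1, 2, \<dots>\<close>; points are pairs (coordinate along the row, row).\<close>

definition rows_list :: "int \<Rightarrow> (int \<times> int) list \<Rightarrow> (int \<times> int) list" where
  "rows_list m rs = map (\<lambda>i. (i, 0)) [- m..m] @
     concat (map (\<lambda>(j, lo, hi). concat (map (\<lambda>i. [(i, j), (- i, - j)]) [lo..hi]))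
       (zip [1..int (length rs)] rs))"

definition plane_map :: "int \<Rightarrow> int \<Rightarrow> int \<Rightarrow> int \<Rightarrow> int \<times> int \<Rightarrow> int \<times> int" where
  "plane_map a b c d z = (a * fst z + b * snd z, c * fst z + d * snd z)"

text \<open>An entry \<open>(m, rs, n, p, r, a, b, c, d)\<close> says that the integral matrix \<open>a, b; c, d\<close> maps the row pattern
  \<open>m, rs\<close> onto the quotient of \<open>e8_roots n\<close> by all simple roots but those numbered \<open>p\<close> and \<open>r\<close>.\<close>

definition rank2_table ::
  "(int \<times> (int \<times> int) list \<times> nat \<times> nat \<times> nat \<times> int \<times> int \<times> int \<times> int) list" where
  "rank2_table = [
    (1, [(- 1, 0)], 2, 0, 1, 0, - 1, 1, 0),
    (1, [(- 1, 0), (- 1, 0)], 5, 0, 2, 1, 0, 2, 1),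
    (1, [(- 1, 0), (- 1, - 1)], 5, 0, 1, 1, 0, 2, 1),
    (1, [(- 1, 0), (- 1, 0), (- 1, - 1)], 6, 0, 2, - 1, 0, - 3, - 1),
    (1, [(- 1, 0), (- 1, - 1), (- 2, - 1)], 8, 6, 7, 0, 1, 1, 1),
    (1, [(- 1, 0), (- 1, 0), (- 2, - 1)], 8, 0, 3, - 2, - 1, - 3, - 1),
    (1, [(- 1, 0), (- 1, 0), (- 1, 0), (- 1, - 1)], 7, 1, 4, 2, 1, 1, 1),
    (1, [(- 1, 0), (- 1, 0), (- 1, - 1), (- 2, - 1)], 8, 0, 6, 2, 1, 1, 1),
    (1, [(- 1, 0), (- 1, - 1), (- 2, - 1), (- 2, - 2)], 8, 0, 3, - 1, - 1, - 3, - 2),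
    (1, [(- 1, 0), (- 1, 0), (- 1, 0), (- 2, - 1)], 8, 3, 1, 3, 1, 4, 1),
    (1, [(- 1, 0), (- 1, 0), (- 1, 0), (- 1, - 1), (- 2, - 1)], 8, 3, 2, 2, 1, 5, 2),
    (1, [(- 1, 0), (- 1, 0), (- 2, - 1), (- 2, - 1), (- 2, - 2)], 8, 0, 4, - 2, - 1, - 3, - 2),
    (1, [(- 1, 0), (- 1, 0), (- 1, 0), (- 1, 0), (- 1, - 1), (- 2, - 1)], 8, 1, 4, 2, 1, 1, 1),
    (1, [(- 1, 0), (- 1, 0), (- 1, - 1), (- 2, - 1), (- 2, - 1), (- 2, - 2)], 8, 0, 2, 1, 0, 5, 1),
    (1, [(- 1, 0), (- 1, - 1), (- 2, - 1), (- 2, - 2), (- 3, - 2), (- 3, - 3)], 8, 3, 2, - 1, 0, 0, 1),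
    (2, [(- 2, 1)], 6, 0, 2, 0, 1, 1, 2),
    (2, [(- 1, 1)], 5, 0, 2, 0, - 1, 1, - 1),
    (2, [(- 1, 1), (- 1, 1)], 8, 0, 6, 0, - 1, 1, - 1),
    (2, [(- 1, 1), (0, 0)], 8, 0, 7, - 1, - 1, - 1, 0),
    (2, [(- 1, 1), (- 1, 1), (0, 0)], 8, 3, 1, 1, - 1, 2, - 1),
    (2, [(- 1, 1), (- 1, 1), (- 1, 1), (0, 0)], 8, 1, 4, 1, - 1, 2, - 1),
    (2, [(- 2, 1), (- 2, 1), (- 1, - 1)], 8, 0, 2, 1, 0, 2, - 1),
    (2, [(- 2, 1), (- 1, - 1)], 8, 0, 3, - 1, 0, - 1, 1),
    (2, [(- 2, 1), (- 2, 0)], 8, 0, 5, 0, 1, 1, 2),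
    (2, [(- 2, 1), (- 2, 0), (- 3, 0), (- 2, - 2)], 8, 2, 5, - 1, - 2, 0, - 1),
    (3, [(- 3, 2), (- 1, - 1)], 8, 3, 2, 1, 0, 2, 1),
    (3, [(- 2, 2)], 7, 1, 4, - 1, 0, - 1, 1),
    (3, [(- 2, 2), (0, 0)], 8, 3, 1, - 1, 1, - 1, 2),
    (3, [(- 2, 2), (- 2, 2), (0, 0)], 8, 2, 5, 2, - 1, 1, - 1),
    (4, [(- 3, 3), (0, 0)], 8, 1, 4, - 1, 1, - 1, 2)
  ]"

definition quotient_table :: "int list list \<Rightarrow> bool" where
  "quotient_table P \<longleftrightarrow> list_all (\<lambda>(m, rs, n, p, r, a, b, c, d).
     n \<le> 8 \<and> p < n \<and> r < n \<and> p \<noteq> r \<and> a * d - b * c \<noteq> 0 \<and>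
     set (map (plane_map a b c d) (rows_list m rs)) = set (root_pairs P n p r)) rank2_table"

text \<open>The list of roots is an argument so that the simplifier evaluates it only once.\<close>

lemma quotient_table_e8: "quotient_table e8_pos"
  by code_simp

section \<open>Rows along the longest root\<close>

text \<open>The pair \<open>(i, j)\<close> stands for the root \<open>i \<alpha> + j \<beta>\<close>, where \<open>\<alpha>\<close> is scaled to length 1 and \<open>\<beta>\<close> lies in the
  first row, at position \<open>s\<close> and squared distance \<open>t\<close> from the line of \<open>\<alpha>\<close>.\<close>

locale row_system =
  fixes S :: "(int \<times> int) set" and m :: int and s t :: real
  assumes finite_S: "finite S"
    and uminus: "(i, j) \<in> S \<Longrightarrow> (- i, - j) \<in> S"
    and ax_neg: "(i, j) \<in> S \<Longrightarrow> (i', j') \<in> S \<Longrightarrow>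
      (of_int i + of_int j * s) * (of_int i' + of_int j' * s) + of_int j * of_int j' * t < 0 \<Longrightarrow>
      (i + i', j + j') \<in> S"
    and ax_pos: "(i, j) \<in> S \<Longrightarrow> (i', j') \<in> S \<Longrightarrow>
      (of_int i + of_int j * s) * (of_int i' + of_int j' * s) + of_int j * of_int j' * t > 0 \<Longrightarrow>
      (i - i', j - j') \<in> S"
    and ax_zero: "(i, j) \<in> S \<Longrightarrow> (i', j') \<in> S \<Longrightarrow>
      (of_int i + of_int j * s) * (of_int i' + of_int j' * s) + of_int j * of_int j' * t = 0 \<Longrightarrow>
      (i + i', j + j') \<in> S \<longleftrightarrow> (i - i', j - j') \<in> S"
    and row0: "(i, 0) \<in> S \<longleftrightarrow> \<bar>i\<bar> \<le> m"
    and bound: "(i, j) \<in> S \<Longrightarrow> j \<noteq> 0 \<Longrightarrow> \<bar>of_int i + of_int j * s\<bar> < of_int m"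
    and one: "(0, 1) \<in> S"
    and m_ge_1: "m \<ge> 1"
    and s_nonneg: "0 \<le> s" and s_le: "s \<le> 1/2" and t_pos: "t > 0"
    and nontrivial: "\<exists>i j. (i, j) \<in> S \<and> j \<noteq> 0 \<and> of_int i + of_int j * s \<noteq> 0"
begin

abbreviation xpos :: "int \<Rightarrow> int \<Rightarrow> real" where
  "xpos i j \<equiv> of_int i + of_int j * s"

text \<open>One root off the perpendicular is enough here: by \<open>row_full\<close> it brings
  along all admissible positions of its row.\<close>

definition full :: "int \<Rightarrow> bool" where
  "full j \<longleftrightarrow> (\<exists>i. (i, j) \<in> S \<and> xpos i j \<noteq> 0)"

definition top :: int where
  "top = Max (snd ` S)"

section \<open>Shape of a single row\<close>

lemma shift_right: "(i, j) \<in> S \<Longrightarrow> xpos i j < 0 \<Longrightarrow> 0 \<le> l \<Longrightarrow> l \<le> m \<Longrightarrow> (i + l, j) \<in> S"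
  using ax_neg[of i j l 0] row0[of l] by (cases "l = 0") (auto simp: mult_neg_pos)

lemma shift_left: "(i, j) \<in> S \<Longrightarrow> xpos i j > 0 \<Longrightarrow> 0 \<le> l \<Longrightarrow> l \<le> m \<Longrightarrow> (i - l, j) \<in> S"
  using ax_pos[of i j l 0] row0[of l] by (cases "l = 0") auto

text \<open>Multiples of \<alpha> up to \<open>m\<close> are roots, so a root at a negative position
  can jump up to \<open>m\<close> steps to the right, and one at a positive position as far to the
  left. Jumps reach the positions \<open>n0\<close> and \<open>n1\<close> next to 0 on either side,
  and from these the whole open interval.\<close>

lemma row_full:
  assumes "(i, j) \<in> S" "j \<noteq> 0" "xpos i j \<noteq> 0" "\<bar>xpos i' j\<bar> < of_int m"
  shows "(i', j) \<in> S"
proof -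
  define n0 where "n0 = \<lceil>- (of_int j * s)\<rceil> - 1"
  define n1 where "n1 = \<lfloor>- (of_int j * s)\<rfloor> + 1"
  have x0: "- 1 \<le> xpos n0 j" "xpos n0 j < 0" unfolding n0_def by linarith+
  have x1: "0 < xpos n1 j" "xpos n1 j \<le> 1" unfolding n1_def by linarith+
  have b: "\<bar>xpos i j\<bar> < of_int m" using bound assms by blast
  have gap: "n1 - m \<le> n0 \<and> n0 \<le> n1"
  proof -
    have "n1 - n0 \<le> 2" using x0 x1 by linarith
    moreover have "n0 \<le> n1" using x0 x1 by linarith
    \<comment> \<open>For \<open>m = 1\<close> one jump cannot cover a distance of 2. But then the
      two positions would be -1 and 1, and the given root could only sit at 0.\<close>
    moreover have "n1 - n0 \<le> 1" if "m = 1"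
    proof (rule ccontr)
      assume "\<not> ?thesis"
      then have "xpos n0 j = - 1" using x0 x1 by linarith
      then have "of_int (i - n0) = xpos i j + 1" by simp
      then have "of_int (i - n0) > (0::real)" "of_int (i - n0) < (2::real)" using b that by linarith+
      then have "i - n0 = 1" by linarith
      with \<open>of_int (i - n0) = xpos i j + 1\<close> assms(3) show False by simp
    qed
    ultimately show ?thesis using m_ge_1 by (cases "m = 1") auto
  qed
  have "(n0, j) \<in> S \<or> (n1, j) \<in> S"
  proof (cases "xpos i j < 0")
    case True
    have "of_int (n0 - i) < (of_int m :: real)" "of_int (n0 - i) > (-1::real)"
      using x0 b True by linarith+
    then have "(i + (n0 - i), j) \<in> S" using assms True by (intro shift_right) linarith+
    then show ?thesis by simp
  next
    case False
    have "of_int (i - n1) < (of_int m :: real)" "of_int (i - n1) > (-1::real)"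
      using x1 b False assms(3) by linarith+
    then have "(i - (i - n1), j) \<in> S" using assms False by (intro shift_left) linarith+
    then show ?thesis by simp
  qed
  moreover have "(n1, j) \<in> S" if "(n0, j) \<in> S"
    using shift_right[OF that x0(2), of "n1 - n0"] gap by simp
  moreover have "(n0, j) \<in> S" if "(n1, j) \<in> S"
    using shift_left[OF that x1(1), of "n1 - n0"] gap by simp
  ultimately have mem: "(n0, j) \<in> S" "(n1, j) \<in> S" by blast+
  show ?thesis
  proof (cases "i' \<le> n0")
    case True
    have "n1 - i' \<le> m" using x1 assms(4) by linarith
    then show ?thesis using shift_left[OF mem(2) x1(1), of "n1 - i'"] True gap by simp
  next
    case False
    have "i' - n0 \<le> m" using x0 assms(4) by linarith
    then show ?thesis using shift_right[OF mem(1) x0(2), of "i' - n0"] False by simp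
  qed
qed

lemma full_iff: "full j \<Longrightarrow> j \<noteq> 0 \<Longrightarrow> (i, j) \<in> S \<longleftrightarrow> \<bar>xpos i j\<bar> < of_int m"
  unfolding full_def using row_full bound by blast

lemma not_full: "\<not> full j \<Longrightarrow> (i, j) \<in> S \<Longrightarrow> xpos i j = 0"
  unfolding full_def by blast

text \<open>Row 1 contains (0, 1) at position \<open>s \<ge> 0\<close> and, unless
  \<open>s = 0\<close>, also (-1, 1) at position \<open>s - 1 < 0\<close>. One of them lies on the
  side of the given root, so their inner product is positive and the difference is a root.\<close>

lemma descend:
  assumes "(i, j) \<in> S" "j > 0"
  shows "\<exists>i'. (i', j - 1) \<in> S"
proof (cases "xpos i j \<ge> 0")
  case True
  then have "xpos i j * xpos 0 1 + of_int j * of_int 1 * t > 0"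
    using assms s_nonneg t_pos by (intro add_nonneg_pos) auto
  from ax_pos[OF assms(1) one this] show ?thesis by blast
next
  case neg: False
  show ?thesis
  proof (cases "s = 0")
    case True
    then have "xpos i j * xpos 0 1 + of_int j * of_int 1 * t > 0" using assms t_pos by simp
    from ax_pos[OF assms(1) one this] show ?thesis by blast
  next
    case False
    then have "(- 1, 1) \<in> S" using shift_left[OF one, of 1] m_ge_1 s_nonneg by simp
    moreover have "xpos i j * xpos (- 1) 1 + of_int j * of_int 1 * t > 0"
      using assms neg s_le t_pos by (intro add_nonneg_pos mult_nonpos_nonpos) auto
    ultimately show ?thesis using ax_pos[OF assms(1)] by blast
  qed
qed

text \<open>For \<open>s = 0\<close> subtracting (0, 1) preserves the position, so a root off both
  axes descends to row 1.\<close>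

lemma full_1: "full 1"
proof (cases "s = 0")
  case False
  then show ?thesis unfolding full_def using one by (intro exI[of _ 0]) simp
next
  case True
  have down: "(i, 1) \<in> S" if "(i, j) \<in> S" "j \<ge> 1" for i j
    using that(2,1)
  proof (induction j rule: int_ge_induct)
    case (step j)
    have "xpos i (j + 1) * xpos 0 1 + of_int (j + 1) * of_int 1 * t > 0"
      using True step t_pos by simp
    from ax_pos[OF step.prems one this] step.IH show ?case by simp
  qed
  from nontrivial obtain i j where ij: "(i, j) \<in> S" "j \<noteq> 0" "i \<noteq> 0" using True by auto
  have "\<exists>i. (i, 1) \<in> S \<and> i \<noteq> 0"
  proof (cases "j > 0")
    case False
    then show ?thesis using down[OF uminus[OF ij(1)]] ij by fastforce
  qed (use ij down in fastforce)
  then show ?thesis unfolding full_def using True by auto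
qed

lemma top_ge: "(i, j) \<in> S \<Longrightarrow> j \<le> top"
  unfolding top_def using finite_S by (intro Max_ge) force+

lemma top_ge_1: "top \<ge> 1"
  using top_ge[OF one] .

lemma row_nonempty:
  assumes "0 \<le> j" "j \<le> top"
  shows "\<exists>i. (i, j) \<in> S"
  using assms(2,1)
proof (induction j rule: int_le_induct)
  case base
  have "top \<in> snd ` S" unfolding top_def using finite_S one by (intro Max_in) auto
  then show ?case by force
next
  case (step j)
  then show ?case using descend by fastforce
qed

section \<open>The system recovered from the endpoints of its rows\<close>

definition row :: "int \<Rightarrow> int \<Rightarrow> int \<Rightarrow> bool" where
  "row j lo hi \<longleftrightarrow> (\<forall>i. (i, j) \<in> S \<longleftrightarrow> lo \<le> i \<and> i \<le> hi)"

primrec rows :: "int \<Rightarrow> (int \<times> int) list \<Rightarrow> bool" where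
  "rows j [] \<longleftrightarrow> True"
| "rows j (r # rs) \<longleftrightarrow> row j (fst r) (snd r) \<and> rows (j + 1) rs"

lemma rows_nth: "rows j rs \<Longrightarrow> n < length rs \<Longrightarrow> row (j + int n) (fst (rs ! n)) (snd (rs ! n))"
proof (induction rs arbitrary: j n)
  case (Cons r rs)
  then show ?case using Cons.IH[of "j + 1" "n - 1"] by (cases n) (auto simp: algebra_simps)
qed simp

lemma S_eq_rows_list:
  assumes "rows 1 rs" "top = int (length rs)"
  shows "S = set (rows_list m rs)"
proof -
  have R: "(i, j) \<in> S \<longleftrightarrow> (\<exists>lo hi. (j, lo, hi) \<in> set (zip [1..int (length rs)] rs) \<and> lo \<le> i \<and> i \<le> hi)"
    if "j > 0" for i j
  proof (cases "j \<le> top")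
    case True
    define n where "n = nat (j - 1)"
    have n: "j = 1 + int n" "n < length rs" using True that assms(2) by (auto simp: n_def)
    have "(j, lo, hi) \<in> set (zip [1..int (length rs)] rs) \<longleftrightarrow> (lo, hi) = rs ! n" for lo hi
      using n by (auto simp: set_zip nth_upto intro!: exI[of _ n])
    then show ?thesis
      using rows_nth[OF assms(1) n(2)] unfolding n(1)[symmetric] row_def
      by (metis prod.collapse prod.inject)
  next
    case False
    then show ?thesis using top_ge[of i j] assms(2) by (auto dest!: set_zip_leftD)
  qed
  define Z where "Z = set (zip [1..int (length rs)] rs)"
  have Z: "j > 0" if "(j, r) \<in> Z" for j r using that by (auto simp: Z_def dest!: set_zip_leftD)
  have L: "(i, j) \<in> set (rows_list m rs) \<longleftrightarrow> j = 0 \<and> \<bar>i\<bar> \<le> m \<or>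
      (\<exists>lo hi. (j, lo, hi) \<in> Z \<and> lo \<le> i \<and> i \<le> hi) \<or>
      (\<exists>lo hi. (- j, lo, hi) \<in> Z \<and> lo \<le> - i \<and> - i \<le> hi)" (is "_ \<longleftrightarrow> ?R") for i j
  proof
    assume "(i, j) \<in> set (rows_list m rs)"
    then consider "j = 0" "- m \<le> i" "i \<le> m"
      | j' lo hi i' where "(j', lo, hi) \<in> Z" "lo \<le> i'" "i' \<le> hi" "(i, j) = (i', j') \<or> (i, j) = (- i', - j')"
      unfolding rows_list_def Z_def by auto
    then show ?R
    proof cases
      case 2
      then show ?thesis by (metis minus_minus prod.inject)
    qed auto
  next
    assume ?R
    then consider "j = 0" "- m \<le> i" "i \<le> m"
      | lo hi where "(j, lo, hi) \<in> Z" "lo \<le> i" "i \<le> hi"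
      | lo hi where "(- j, lo, hi) \<in> Z" "lo \<le> - i" "- i \<le> hi" by auto
    then show "(i, j) \<in> set (rows_list m rs)"
    proof cases
      case 2
      then show ?thesis
        unfolding rows_list_def Z_def by (auto intro!: bexI[of _ "(j, lo, hi)"] bexI[of _ i])
    next
      case 3
      then show ?thesis
        unfolding rows_list_def Z_def by (auto intro!: bexI[of _ "(- j, lo, hi)"] bexI[of _ "- i"])
    qed (auto simp: rows_list_def)
  qed
  have "(i, j) \<in> S \<longleftrightarrow> (i, j) \<in> set (rows_list m rs)" for i j
  proof -
    consider "j = 0" | "j > 0" | "j < 0" by linarith
    then show ?thesis
    proof cases
      case 1
      then show ?thesis using Z by (auto simp: row0 L)
    next
      case 2
      then have "(- j, r) \<notin> Z" for r using Z[of "- j" r] by auto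
      then show ?thesis using 2 unfolding L R[OF 2] Z_def[symmetric] by simp
    next
      case 3
      have "(i, j) \<in> S \<longleftrightarrow> (- i, - j) \<in> S" using uminus[of i j] uminus[of "- i" "- j"] by auto
      moreover have "(j, r) \<notin> Z" for r using 3 Z[of j r] by auto
      ultimately show ?thesis using 3 R[of "- j" "- i"] unfolding L Z_def[symmetric] by simp
    qed
  qed
  then show ?thesis by auto
qed

lemma row_fullI:
  assumes "full j" "j \<noteq> 0" "xpos lo j > - of_int m" "xpos lo j \<le> 1 - of_int m"
    "xpos hi j < of_int m" "xpos hi j \<ge> of_int m - 1"
  shows "row j lo hi"
  unfolding row_def full_iff[OF assms(1,2)]
proof (intro allI iffI conjI)
  fix i assume "\<bar>xpos i j\<bar> < of_int m"
  then show "lo \<le> i" "i \<le> hi" using assms(3-) by linarith+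
next
  fix i assume "lo \<le> i \<and> i \<le> hi"
  then have "of_int lo \<le> (of_int i :: real)" "of_int i \<le> (of_int hi :: real)" by auto
  then show "\<bar>xpos i j\<bar> < of_int m" using assms(3-) by linarith
qed

lemma row_pointI:
  assumes "\<not> full j" "0 \<le> j" "j \<le> top" "xpos i j = 0"
  shows "row j i i"
proof -
  from row_nonempty[OF assms(2,3)] obtain i0 where i0: "(i0, j) \<in> S" by blast
  have eq: "i' = i" if "(i', j) \<in> S" for i'
  proof -
    have "real_of_int i' = real_of_int i" using not_full[OF assms(1) that] assms(4) by linarith
    then show ?thesis by simp
  qed
  from i0 eq[OF i0] have mem: "(i, j) \<in> S" by simp
  show ?thesis
    unfolding row_def
  proof (intro allI iffI)
    fix i' assume "(i', j) \<in> S"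
    from eq[OF this] show "i \<le> i' \<and> i' \<le> i" by simp
  next
    fix i' assume "i \<le> i' \<and> i' \<le> i"
    then have "i' = i" by simp
    with mem show "(i', j) \<in> S" by simp
  qed
qed

text \<open>The sum would lie beyond the last row; the difference would lie in a row other than 0 at
  a position of at least \<open>m\<close>. So neither sign of the inner product is possible.\<close>

lemma opposite:
  assumes "(a, p) \<in> S" "(b, q) \<in> S" "p + q > top" "p \<noteq> q" "xpos a p - xpos b q \<ge> of_int m"
  shows "xpos a p * xpos b q + of_int p * of_int q * t = 0"
proof (rule ccontr)
  assume "\<not> ?thesis"
  then consider "xpos a p * xpos b q + of_int p * of_int q * t < 0"
    | "xpos a p * xpos b q + of_int p * of_int q * t > 0" by linarith
  then show False
  proof cases
    case 1
    from top_ge[OF ax_neg[OF assms(1,2) 1]] assms(3) show False by simp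
  next
    case 2
    have "\<bar>xpos (a - b) (p - q)\<bar> < of_int m"
      using ax_pos[OF assms(1,2) 2] assms(4) by (intro bound) auto
    then show False using assms(5) by (simp add: algebra_simps)
  qed
qed

text \<open>Here the difference lies in row 0, which extends to \<open>m\<close> itself; hence the
  strict inequality.\<close>

lemma opposite_same:
  assumes "(a, p) \<in> S" "(b, p) \<in> S" "(a + b, 2 * p) \<notin> S" "a - b > m"
  shows "xpos a p * xpos b p + of_int p * of_int p * t = 0"
proof (rule ccontr)
  assume "\<not> ?thesis"
  then consider "xpos a p * xpos b p + of_int p * of_int p * t < 0"
    | "xpos a p * xpos b p + of_int p * of_int p * t > 0" by linarith
  then show False
  proof cases
    case 1
    from ax_neg[OF assms(1,2) 1] assms(3) show False by (metis mult_2)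
  next
    case 2
    from ax_pos[OF assms(1,2) 2] row0[of "a - b"] assms(4) m_ge_1 show False by simp
  qed
qed

text \<open>A row of the second kind needs the position 0, which is present only if j s is an
  integer.\<close>

lemma full_if_non_integral:
  assumes "0 < j" "j \<le> top" "of_int j * s \<notin> \<int>"
  shows "full j"
proof -
  from row_nonempty[of j] assms obtain i where i: "(i, j) \<in> S" by auto
  have "xpos i j \<noteq> 0"
  proof
    assume "xpos i j = 0"
    then have "of_int j * s = of_int (- i)" by simp
    with assms(3) show False by (metis Ints_of_int)
  qed
  with i show ?thesis by (auto simp: full_def)
qed

end

lemma not_IntsI: "of_int c < x \<Longrightarrow> x < of_int c + 1 \<Longrightarrow> x \<notin> \<int>" for x :: real
  by (auto elim!: Ints_cases)

section \<open>Primitive longest root\<close>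

definition rank2_rows :: "(int \<times> (int \<times> int) list) set" where
  "rank2_rows = (\<lambda>(m, rs, _). (m, rs)) ` set rank2_table"

context row_system
begin

definition classified :: bool where
  "classified \<longleftrightarrow> (\<exists>rs. (m, rs) \<in> rank2_rows \<and> S = set (rows_list m rs))"

lemma classifiedI:
  assumes "rows 1 rs" "top = int (length rs)" "(m, rs) \<in> rank2_rows"
  shows classified
  using S_eq_rows_list[OF assms(1,2)] assms(3) unfolding classified_def by blast

text \<open>For \<open>m = 1\<close> the admissible interval (-1, 1) holds two positions of a row if
  j s is not an integer and only 0 otherwise, so \<open>s\<close> and \<open>top\<close> determine
  the system. Both cases form one rule, which then serves every row of a concrete list.\<close>

lemma row_1I:
  assumes "m = 1" "1 \<le> j" "j \<le> top"
    and "hi = lo + 1 \<and> - of_int hi < of_int j * s \<and> of_int j * s < 1 - of_int hi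
      \<or> hi = lo \<and> of_int j * s = - of_int hi"
  shows "row j lo hi"
  using assms(4)
proof
  assume *: "hi = lo + 1 \<and> - of_int hi < of_int j * s \<and> of_int j * s < 1 - of_int hi"
  have "of_int j * s \<notin> \<int>" using * by (intro not_IntsI[of "- hi"]) auto
  then have "full j" using assms by (intro full_if_non_integral) auto
  with * assms show ?thesis by (intro row_fullI) auto
next
  assume *: "hi = lo \<and> of_int j * s = - of_int hi"
  have "\<not> full j"
  proof
    assume "full j"
    then obtain i where i: "(i, j) \<in> S" "xpos i j \<noteq> 0" by (auto simp: full_def)
    then have "\<bar>of_int (i - hi)\<bar> < (1::real)" using bound[OF i(1)] assms * by simp
    then have "i = hi" by linarith
    with i * show False by simp
  qed
  with * assms row_pointI[of j hi] show ?thesis by simp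
qed

lemma s_pos_1:
  assumes "m = 1"
  shows "s > 0"
proof (rule ccontr)
  assume "\<not> s > 0"
  then have "s = 0" using s_nonneg by simp
  from full_1 obtain i where "(i, 1) \<in> S" "xpos i 1 \<noteq> 0" by (auto simp: full_def)
  with bound[of i 1] assms \<open>s = 0\<close> show False by simp
qed

text \<open>If P and Q are the fractional parts of p s and q s, then row \<open>p\<close> has a root
  at P and row \<open>q\<close> one at Q - 1. For P \<ge> Q they are at least 1 apart, and
  \<open>opposite\<close> applies.\<close>

lemma pair_1:
  fixes c d :: int
  assumes "m = 1" "0 < p" "p \<le> top" "0 < q" "q \<le> top" "p \<noteq> q" "p + q > top"
    and "of_int c < of_int p * s" "of_int p * s < of_int c + 1"
    and "of_int d < of_int q * s" "of_int q * s < of_int d + 1"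
    and "of_int p * s - of_int c \<ge> of_int q * s - of_int d"
  shows "(of_int p * s - of_int c) * (1 - (of_int q * s - of_int d)) = of_int p * of_int q * t"
proof -
  have "full p" "full q"
    using assms not_IntsI[of c "of_int p * s"] not_IntsI[of d "of_int q * s"]
    by (auto intro!: full_if_non_integral)
  then have "(- c, p) \<in> S" "(- d - 1, q) \<in> S"
    using assms by (auto simp: full_iff)
  then have "xpos (- c) p * xpos (- d - 1) q + of_int p * of_int q * t = 0"
    using assms by (intro opposite) auto
  then show ?thesis by (simp add: algebra_simps)
qed

text \<open>Of the three equations of \<open>pair_1\<close>, quotients of two eliminate \<open>t\<close> and a common factor, and then \<open>s\<close>
  drops out as well.\<close>

lemma triple_1:
  fixes c d e :: int
  assumes m: "m = 1" and r: "0 < r" "r < p" "r < q" "p \<le> top" "q \<le> top" "p \<noteq> q"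
    "r + p > top" "r + q > top"
    and e: "of_int e < of_int r * s" "of_int r * s < of_int e + 1"
    and c: "of_int c < of_int p * s" "of_int p * s < of_int c + 1"
    and d: "of_int d < of_int q * s" "of_int q * s < of_int d + 1"
  shows "c * r = e * p \<and> (e + 1) * q = (d + 1) * r \<or> d * r = e * q \<and> (e + 1) * p = (c + 1) * r"
proof -
  have main: "c * r = e * p \<and> (e + 1) * q = (d + 1) * r"
    if r: "r < p" "r < q" "p \<le> top" "q \<le> top" "p \<noteq> q" "r + p > top" "r + q > top"
      and c: "of_int c < of_int p * s" "of_int p * s < of_int c + 1"
      and d: "of_int d < of_int q * s" "of_int q * s < of_int d + 1"
      and ord: "of_int p * s - of_int c \<ge> of_int q * s - of_int d"
    for p q c d
  proof -
    define P Q E where "P = of_int p * s - of_int c" and "Q = of_int q * s - of_int d"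
      and "E = of_int r * s - of_int e"
    have I: "0 < P" "P < 1" "0 < Q" "Q < 1" "0 < E" "E < 1" "Q \<le> P"
      using c d e ord by (auto simp: P_def Q_def E_def)
    have pos: "0 < real_of_int r" "real_of_int r < of_int p" "real_of_int r < of_int q"
      using \<open>0 < r\<close> r by auto
    have PQ: "P * (1 - Q) = of_int p * of_int q * t"
      unfolding P_def Q_def using m \<open>0 < r\<close> r c d ord by (intro pair_1) auto
    have PE: "P * (1 - E) = of_int p * of_int r * t" if "E \<le> P"
      unfolding P_def E_def using m \<open>0 < r\<close> r c e that by (intro pair_1) (auto simp: P_def E_def)
    have EP: "E * (1 - P) = of_int r * of_int p * t" if "P \<le> E"
      unfolding P_def E_def using m \<open>0 < r\<close> r c e that by (intro pair_1) (auto simp: P_def E_def)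
    have QE: "Q * (1 - E) = of_int q * of_int r * t" if "E \<le> Q"
      unfolding Q_def E_def using m \<open>0 < r\<close> r d e that by (intro pair_1) (auto simp: Q_def E_def)
    have EQ: "E * (1 - Q) = of_int r * of_int q * t" if "Q \<le> E"
      unfolding Q_def E_def using m \<open>0 < r\<close> r d e that by (intro pair_1) (auto simp: Q_def E_def)
    have EP': "E * of_int p = P * of_int r" if "Q \<le> E"
    proof -
      have "(E * of_int p) * (1 - Q) = (P * of_int r) * (1 - Q)"
        using EQ[OF that] PQ by algebra
      with I show ?thesis by simp
    qed
    have EQ': "(1 - E) * of_int q = (1 - Q) * of_int r" if "E \<le> P"
    proof -
      have "((1 - E) * of_int q) * P = ((1 - Q) * of_int r) * P"
        using PE[OF that] PQ by algebra
      with I show ?thesis by simp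
    qed
    \<comment> \<open>\<open>EP'\<close> and \<open>EQ'\<close> force E between Q and P, because r
      is smaller than p and q; hence both identities hold at once.\<close>
    have "E \<le> P"
    proof (rule ccontr)
      assume "\<not> E \<le> P"
      then have *: "P < E" "Q \<le> E" using I by auto
      have "P * of_int r < E * of_int p" using * I pos by (intro mult_strict_mono) auto
      with EP' * show False by simp
    qed
    moreover have "Q \<le> E"
    proof (rule ccontr)
      assume "\<not> Q \<le> E"
      then have *: "1 - Q < 1 - E" by auto
      have "(1 - Q) * of_int r < (1 - E) * of_int q" using * I pos by (intro mult_strict_mono) auto
      with EQ'[OF \<open>E \<le> P\<close>] show False by simp
    qed
    ultimately have "E * of_int p = P * of_int r" "(1 - E) * of_int q = (1 - Q) * of_int r"
      using EP' EQ' by auto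
    then have "real_of_int (c * r) = of_int (e * p)" "real_of_int ((e + 1) * q) = of_int ((d + 1) * r)"
      by (auto simp: P_def Q_def E_def algebra_simps)
    then show ?thesis by (metis of_int_eq_iff)
  qed
  show ?thesis
  proof (cases "of_int p * s - of_int c \<ge> of_int q * s - of_int d")
    case True
    with main[of p q c d] r c d show ?thesis by blast
  next
    case False
    with main[of q p d c] r c d show ?thesis by (auto simp: add.commute)
  qed
qed

section \<open>At most four rows, \<open>m = 1\<close>\<close>

lemma small_1:
  assumes "m = 1" "top = 1 \<or> top = 2"
  shows classified
proof -
  have s: "s > 0" using s_pos_1 assms by simp
  consider "top = 1" | "top = 2" "s = 1/2" | "top = 2" "s < 1/2" using assms s_le by linarith
  then show ?thesis
  proof cases
    case 1
    then show ?thesis using s s_le assms(1)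
      by (intro classifiedI[of "[(- 1, 0)]"])
         (auto intro!: row_1I simp: rank2_rows_def rank2_table_def)
  next
    case 2
    then show ?thesis using assms(1)
      by (intro classifiedI[of "[(- 1, 0), (- 1, - 1)]"])
         (auto intro!: row_1I simp: rank2_rows_def rank2_table_def)
  next
    case 3
    then show ?thesis using s assms(1)
      by (intro classifiedI[of "[(- 1, 0), (- 1, 0)]"])
         (auto intro!: row_1I simp: rank2_rows_def rank2_table_def)
  qed
qed

text \<open>The pattern changes only where \<open>s\<close> meets a fraction with denominator at
  most \<open>top\<close>. Here and in \<open>top_4\<close>, two pair equations exclude each
  interval that is missing from the final case distinction.\<close>

lemma top_3:
  assumes m: "m = 1" and k: "top = 3"
  shows classified
proof -
  have s: "s > 0" using s_pos_1 m by simp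
  have "\<not> s < 1/3"
  proof
    assume *: "s < 1/3"
    have "(3 * s) * (1 - 2 * s) = 6 * t" "(3 * s) * (1 - s) = 3 * t"
      using pair_1[of 3 2 0 0] pair_1[of 3 1 0 0] m k s * by auto
    then have "3 * s * (1 - 2 * s) = 3 * s * (2 - 2 * s)" by algebra
    with s show False by simp
  qed
  then consider "s = 1/3" | "s = 1/2" | "1/3 < s" "s < 1/2" using s_le by linarith
  then show ?thesis
  proof cases
    case 1
    with m k show ?thesis
      by (intro classifiedI[of "[(- 1, 0), (- 1, 0), (- 1, - 1)]"])
         (auto intro!: row_1I simp: rank2_rows_def rank2_table_def)
  next
    case 2
    with m k show ?thesis
      by (intro classifiedI[of "[(- 1, 0), (- 1, - 1), (- 2, - 1)]"])
         (auto intro!: row_1I simp: rank2_rows_def rank2_table_def)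
  next
    case 3
    with m k show ?thesis
      by (intro classifiedI[of "[(- 1, 0), (- 1, 0), (- 2, - 1)]"])
         (auto intro!: row_1I simp: rank2_rows_def rank2_table_def)
  qed
qed

lemma top_4:
  assumes m: "m = 1" and k: "top = 4"
  shows classified
proof -
  have s: "s > 0" using s_pos_1 m by simp
  have "\<not> s < 1/4"
  proof
    assume *: "s < 1/4"
    have "(4 * s) * (1 - 3 * s) = 12 * t" "(4 * s) * (1 - 2 * s) = 8 * t"
      using pair_1[of 4 3 0 0] pair_1[of 4 2 0 0] m k s * by auto
    then have "s * (2 - 6 * s) = s * (3 - 6 * s)" by algebra
    with s show False by simp
  qed
  moreover have "\<not> (1/3 < s \<and> s < 1/2)"
  proof
    assume *: "1/3 < s \<and> s < 1/2"
    have "(4 * s - 1) * (2 - 3 * s) = 12 * t" "(2 * s) * (2 - 3 * s) = 6 * t"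
      using pair_1[of 4 3 1 1] pair_1[of 2 3 0 1] m k s * by (auto simp: algebra_simps)
    then have "(4 * s - 1) * (2 - 3 * s) = (4 * s) * (2 - 3 * s)" by algebra
    with * show False by simp
  qed
  ultimately consider "s = 1/4" | "s = 1/3" | "s = 1/2" | "1/4 < s" "s < 1/3" using s_le by linarith
  then show ?thesis
  proof cases
    case 1
    with m k show ?thesis
      by (intro classifiedI[of "[(- 1, 0), (- 1, 0), (- 1, 0), (- 1, - 1)]"])
         (auto intro!: row_1I simp: rank2_rows_def rank2_table_def)
  next
    case 2
    with m k show ?thesis
      by (intro classifiedI[of "[(- 1, 0), (- 1, 0), (- 1, - 1), (- 2, - 1)]"])
         (auto intro!: row_1I simp: rank2_rows_def rank2_table_def)
  next
    case 3
    with m k show ?thesis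
      by (intro classifiedI[of "[(- 1, 0), (- 1, - 1), (- 2, - 1), (- 2, - 2)]"])
         (auto intro!: row_1I simp: rank2_rows_def rank2_table_def)
  next
    case 4
    with m k show ?thesis
      by (intro classifiedI[of "[(- 1, 0), (- 1, 0), (- 1, 0), (- 2, - 1)]"])
         (auto intro!: row_1I simp: rank2_rows_def rank2_table_def)
  qed
qed

lemma final_5_6:
  assumes "m = 1" "top = 5 \<and> (s = 1/4 \<or> s = 2/5) \<or> top = 6 \<and> (s = 1/5 \<or> s = 1/3 \<or> s = 1/2)"
  shows classified
proof -
  from assms(2) consider "top = 5" "s = 1/4" | "top = 5" "s = 2/5" | "top = 6" "s = 1/5"
    | "top = 6" "s = 1/3" | "top = 6" "s = 1/2" by blast
  then show ?thesis
  proof cases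
    case 1
    with assms(1) show ?thesis
      by (intro classifiedI[of "[(- 1, 0), (- 1, 0), (- 1, 0), (- 1, - 1), (- 2, - 1)]"])
         (auto intro!: row_1I simp: rank2_rows_def rank2_table_def)
  next
    case 2
    with assms(1) show ?thesis
      by (intro classifiedI[of "[(- 1, 0), (- 1, 0), (- 2, - 1), (- 2, - 1), (- 2, - 2)]"])
         (auto intro!: row_1I simp: rank2_rows_def rank2_table_def)
  next
    case 3
    with assms(1) show ?thesis
      by (intro classifiedI[of "[(- 1, 0), (- 1, 0), (- 1, 0), (- 1, 0), (- 1, - 1), (- 2, - 1)]"])
         (auto intro!: row_1I simp: rank2_rows_def rank2_table_def)
  next
    case 4
    with assms(1) show ?thesis
      by (intro classifiedI[of "[(- 1, 0), (- 1, 0), (- 1, - 1), (- 2, - 1), (- 2, - 1), (- 2, - 2)]"])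
         (auto intro!: row_1I simp: rank2_rows_def rank2_table_def)
  next
    case 5
    with assms(1) show ?thesis
      by (intro classifiedI[of "[(- 1, 0), (- 1, - 1), (- 2, - 1), (- 2, - 2), (- 3, - 2), (- 3, - 3)]"])
         (auto intro!: row_1I simp: rank2_rows_def rank2_table_def)
  qed
qed

end

section \<open>Five rows or more, \<open>m = 1\<close>: the denominator of \<open>s\<close>\<close>

lemma mult_eq_less_imp_0:
  fixes a b c :: int
  assumes "a * b = c" "0 \<le> c" "c < b"
  shows "a = 0" "c = 0"
proof -
  have "\<not> c > 0" using assms zdvd_imp_le[of b c] by (metis dvd_triv_right linorder_not_le)
  with assms show "c = 0" "a = 0" by auto
qed

lemma mult_eq_pos_imp_le:
  fixes a b c :: int
  shows "a * b = c \<Longrightarrow> 0 < c \<Longrightarrow> b \<le> c"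
  using zdvd_imp_le[of b c] by (metis dvd_triv_right)

text \<open>The assumption makes \<open>s\<close> rational, and \<open>q\<close> is its denominator
  in lowest terms: the positive generator of the ideal of all integers whose product with
  \<open>s\<close> is integral.\<close>

lemma integral_multiples_dvd:
  fixes s :: real
  assumes "r > 0" "of_int r * s \<in> \<int>"
  obtains q :: int where "q > 0" "\<And>i. of_int i * s \<in> \<int> \<longleftrightarrow> q dvd i"
proof -
  define P where "P = (\<lambda>n::nat. n > 0 \<and> of_nat n * s \<in> \<int>)"
  have "P (nat r)" using assms by (simp add: P_def)
  then have L: "P (Least P)" and least: "\<And>n. P n \<Longrightarrow> Least P \<le> n"
    by (auto intro: LeastI Least_le)
  define q where "q = int (Least P)"
  have q: "q > 0" "of_int q * s \<in> \<int>" using L by (auto simp: q_def P_def)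
  show thesis
  proof (rule that[OF q(1)])
    fix i :: int
    show "of_int i * s \<in> \<int> \<longleftrightarrow> q dvd i"
    proof
      assume i: "of_int i * s \<in> \<int>"
      have "of_int (i mod q) * s = of_int i * s - of_int (i div q) * (of_int q * s)"
        by (simp add: algebra_simps flip: minus_div_mult_eq_mod)
      also have "\<dots> \<in> \<int>" by (rule Ints_diff[OF i Ints_mult[OF Ints_of_int q(2)]])
      finally have "of_int (i mod q) * s \<in> \<int>" .
      moreover have "0 \<le> i mod q" "i mod q < q" using q by auto
      ultimately have "\<not> i mod q > 0"
      proof (intro notI)
        assume *: "of_int (i mod q) * s \<in> \<int>" "i mod q < q" "i mod q > 0"
        then have "P (nat (i mod q))" by (simp add: P_def)
        from least[OF this] * show False unfolding q_def by linarith
      qed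
      with \<open>0 \<le> i mod q\<close> show "q dvd i" by (simp add: dvd_eq_mod_eq_0)
    next
      assume "q dvd i"
      then obtain k where "i = q * k" by (elim dvdE)
      then have "of_int i * s = of_int k * (of_int q * s)" by simp
      with q show "of_int i * s \<in> \<int>" by (simp only: Ints_mult Ints_of_int)
    qed
  qed
qed

context row_system
begin

definition fl :: "int \<Rightarrow> int" where
  "fl j = \<lfloor>of_int j * s\<rfloor>"

lemma fl_less: "of_int j * s \<notin> \<int> \<Longrightarrow> of_int (fl j) < of_int j * s"
  unfolding fl_def by (metis Ints_of_int floor_correct less_eq_real_def)

lemma fl_le: "of_int (fl j) \<le> of_int j * s"
  unfolding fl_def by simp

lemma less_fl: "of_int j * s < of_int (fl j) + 1"
  unfolding fl_def by linarith

lemma fl_nonneg: "j \<ge> 0 \<Longrightarrow> fl j \<ge> 0"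
  unfolding fl_def using s_nonneg by simp

lemma fl_half: "j \<ge> 0 \<Longrightarrow> 2 * fl j \<le> j"
proof -
  assume "j \<ge> 0"
  then have "of_int j * s \<le> of_int j * (1/2)" using s_le by (intro mult_left_mono) auto
  then have "real_of_int (2 * fl j) \<le> of_int j" using fl_le[of j] by simp
  then show ?thesis by (simp only: of_int_le_iff)
qed

lemma triple_fl:
  assumes "m = 1" "0 < r" "r < p" "r < q" "p \<le> top" "q \<le> top" "p \<noteq> q"
    "r + p > top" "r + q > top"
    and "of_int r * s \<notin> \<int>" "of_int p * s \<notin> \<int>" "of_int q * s \<notin> \<int>"
  shows "fl p * r = fl r * p \<and> (fl r + 1) * q = (fl q + 1) * r \<or>
    fl q * r = fl r * q \<and> (fl r + 1) * p = (fl p + 1) * r"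
  using triple_1[OF assms(1-9) fl_less[OF assms(10)] less_fl fl_less[OF assms(11)] less_fl
      fl_less[OF assms(12)] less_fl] .

text \<open>For the rows n - 2, n - 1, n \<open>triple_fl\<close> makes n - 2 divide v or v + 1,
  where v \<le> (n - 2) / 2 because \<open>s \<le> 1/2\<close>. That leaves only v = 0, and then n -
  2 would divide 2.\<close>

lemma no_three_consecutive:
  assumes m: "m = 1" and n: "n \<ge> 5" "n \<le> top" "2 * n - 3 > top"
    and N: "of_int n * s \<notin> \<int>" "of_int (n - 1) * s \<notin> \<int>" "of_int (n - 2) * s \<notin> \<int>"
  shows False
proof -
  define u v w where "u = fl (n - 1)" and "v = fl (n - 2)" and "w = fl n"
  have b: "v \<ge> 0" "2 * v \<le> n - 2" using fl_nonneg[of "n - 2"] fl_half[of "n - 2"] n by (auto simp: v_def)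
  have "u * (n - 2) = v * (n - 1) \<and> (v + 1) * n = (w + 1) * (n - 2) \<or>
      w * (n - 2) = v * n \<and> (v + 1) * (n - 1) = (u + 1) * (n - 2)"
    unfolding u_def v_def w_def using n N m by (intro triple_fl) auto
  then show False
  proof
    assume *: "u * (n - 2) = v * (n - 1) \<and> (v + 1) * n = (w + 1) * (n - 2)"
    then have "(u - v) * (n - 2) = v" by (simp add: algebra_simps)
    from mult_eq_less_imp_0[OF this] b n have "v = 0" by simp
    with * have "w * (n - 2) = 2" by (simp add: algebra_simps)
    then show False using mult_eq_pos_imp_le[of w "n - 2" 2] n by simp
  next
    assume "w * (n - 2) = v * n \<and> (v + 1) * (n - 1) = (u + 1) * (n - 2)"
    then have "(u - v) * (n - 2) = v + 1" by (simp add: algebra_simps)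
    then show False using mult_eq_pos_imp_le[of "u - v" "n - 2" "v + 1"] b n by simp
  qed
qed

text \<open>The next two lemmas cover the denominators of \<open>s\<close> that exceed 3 and divide \<open>top - 1\<close> or \<open>top - 2\<close>.\<close>

lemma period_top_minus_1:
  assumes m: "m = 1" and k: "top \<ge> 6"
    and N: "of_int top * s \<notin> \<int>" "of_int (top - 2) * s \<notin> \<int>" "of_int (top - 3) * s \<notin> \<int>"
  shows "top = 6 \<and> fl 4 = 0"
proof -
  define k where "k = top"
  define u v w where "u = fl (k - 2)" and "v = fl (k - 3)" and "w = fl k"
  have k6: "k \<ge> 6" using k by (simp add: k_def)
  have b: "v \<ge> 0" "2 * v \<le> k - 3" using fl_nonneg[of "k - 3"] fl_half[of "k - 3"] k6 by (auto simp: v_def)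
  have "u * (k - 3) = v * (k - 2) \<and> (v + 1) * k = (w + 1) * (k - 3) \<or>
      w * (k - 3) = v * k \<and> (v + 1) * (k - 2) = (u + 1) * (k - 3)"
    unfolding u_def v_def w_def k_def using k N m by (intro triple_fl) auto
  then show ?thesis
  proof
    assume *: "u * (k - 3) = v * (k - 2) \<and> (v + 1) * k = (w + 1) * (k - 3)"
    then have "(u - v) * (k - 3) = v" by (simp add: algebra_simps)
    from mult_eq_less_imp_0[OF this] b k6 have "u - v = 0" "v = 0" by simp_all
    with * have "w * (k - 3) = 3" by (simp add: algebra_simps)
    then have "k = 6" using mult_eq_pos_imp_le[of w "k - 3" 3] k6 by simp
    with \<open>u - v = 0\<close> \<open>v = 0\<close> show ?thesis by (simp add: k_def u_def)
  next
    assume "w * (k - 3) = v * k \<and> (v + 1) * (k - 2) = (u + 1) * (k - 3)"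
    then have "(u - v) * (k - 3) = v + 1" by (simp add: algebra_simps)
    then show ?thesis using mult_eq_pos_imp_le[of "u - v" "k - 3" "v + 1"] b k6 by simp
  qed
qed

lemma period_top_minus_2:
  assumes m: "m = 1" and k: "top \<ge> 6" and s: "s < 1/2" "of_int (top - 2) * s \<ge> 1"
    and N: "of_int top * s \<notin> \<int>" "of_int (top - 1) * s \<notin> \<int>" "of_int (top - 3) * s \<notin> \<int>"
  shows "top = 9 \<and> fl 9 = 3 \<and> fl 8 = 3"
proof -
  define k where "k = top"
  define u v w where "u = fl (k - 1)" and "v = fl (k - 3)" and "w = fl k"
  have k6: "k \<ge> 6" using k by (simp add: k_def)
  have b: "v \<ge> 0" "2 * v \<le> k - 3" using fl_nonneg[of "k - 3"] fl_half[of "k - 3"] k6 by (auto simp: v_def)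
  have "s > 0" using s_pos_1 m by simp
  have "of_int (k - 1) * s \<ge> 1" "of_int k * s \<ge> 1"
    using s(2) \<open>s > 0\<close> by (auto simp: k_def algebra_simps)
  then have uw: "u > 0" "w > 0" using less_fl[of "k - 1"] less_fl[of k] by (auto simp: u_def w_def)
  have "u * (k - 3) = v * (k - 1) \<and> (v + 1) * k = (w + 1) * (k - 3) \<or>
      w * (k - 3) = v * k \<and> (v + 1) * (k - 1) = (u + 1) * (k - 3)"
    unfolding u_def v_def w_def k_def using k N m by (intro triple_fl) auto
  then show ?thesis
  proof
    assume *: "u * (k - 3) = v * (k - 1) \<and> (v + 1) * k = (w + 1) * (k - 3)"
    then have uv: "(u - v) * (k - 3) = 2 * v" by (simp add: algebra_simps)
    have "v \<noteq> 0" using uv uw k6 by auto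
    then have "2 * v = k - 3" using mult_eq_pos_imp_le[OF uv] b by simp
    \<comment> \<open>An integral part of (k - 3) s as large as (k - 3) / 2 would mean s \<ge>
      1/2.\<close>
    then have "of_int (k - 3) = 2 * real_of_int v" by (metis of_int_mult of_int_numeral)
    then have "of_int (k - 3) * (1 / 2) \<le> of_int (k - 3) * s" using fl_le[of "k - 3"] by (simp add: v_def)
    moreover have "of_int (k - 3) * s < of_int (k - 3) * (1 / 2)"
      using s k6 by (intro mult_strict_left_mono) auto
    ultimately show ?thesis by linarith
  next
    assume *: "w * (k - 3) = v * k \<and> (v + 1) * (k - 1) = (u + 1) * (k - 3)"
    then have wv: "(w - v) * (k - 3) = 3 * v" by (simp add: algebra_simps)
    have "v \<noteq> 0" using wv uw k6 by auto
    then have "k - 3 \<le> 3 * v" using mult_eq_pos_imp_le[OF wv] b by simp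
    \<comment> \<open>Since 3 v < 2 (k - 3), the positive multiple 3 v of k - 3 can only be k - 3
      itself.\<close>
    moreover have "(w - v - 1) * (k - 3) = 3 * v - (k - 3)" using wv by (simp add: algebra_simps)
    note mult_eq_less_imp_0(1)[OF this]
    ultimately have "w - v - 1 = 0" using b k6 by simp
    then have "w - v = 1" by simp
    with wv have kv: "k = 3 * v + 3" by simp
    then have "(v + 1) * (3 * v + 2) = (u + 1) * (3 * v)" using * by (simp add: algebra_simps)
    then have "2 = v * (3 * (u + 1) - 3 * v - 5)" by (simp add: algebra_simps)
    then have "v dvd 2" by (metis dvd_triv_left)
    then have "v \<le> 2" by (simp add: zdvd_imp_le)
    then have "v = 1 \<or> v = 2" using kv k6 by linarith
    moreover have "v \<noteq> 1"
    proof
      assume "v = 1"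
      with \<open>(v + 1) * (3 * v + 2) = (u + 1) * (3 * v)\<close> have "10 = (u + 1) * 3" by simp
      then show False by presburger
    qed
    ultimately have "v = 2" by blast
    with \<open>(v + 1) * (3 * v + 2) = (u + 1) * (3 * v)\<close> have "v = 2 \<and> u = 3" by simp
    with kv \<open>w - v = 1\<close> show ?thesis by (simp add: k_def[symmetric] u_def w_def)
  qed
qed

text \<open>One of the last three rows has an integral multiple of \<open>s\<close>, so the
  denominator \<open>q\<close> of \<open>s\<close> divides \<open>top\<close>,
  \<open>top - 1\<close> or \<open>top - 2\<close>. For \<open>q \<le> 3\<close> the fractional
  parts take so few values that the pair equations settle \<open>top\<close>; for larger
  \<open>q\<close> the rows around the integral one are non-integral, and the triple conditions
  leave few candidates.\<close>

lemma top_ge_5: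
  assumes m: "m = 1" and k: "top \<ge> 5"
  shows classified
proof -
  have s: "s > 0" using s_pos_1 m by simp
  have "\<exists>r>0. of_int r * s \<in> \<int> \<and> (r = top \<or> r = top - 1 \<or> r = top - 2)"
  proof (rule ccontr)
    assume *: "\<not> ?thesis"
    then have "of_int top * s \<notin> \<int>" "of_int (top - 1) * s \<notin> \<int>" "of_int (top - 2) * s \<notin> \<int>"
      using k by (auto dest: spec[of _ top] spec[of _ "top - 1"] spec[of _ "top - 2"])
    with no_three_consecutive[OF m, of top] k show False by simp
  qed
  then obtain r where r: "r > 0" "of_int r * s \<in> \<int>" "r = top \<or> r = top - 1 \<or> r = top - 2" by blast
  from integral_multiples_dvd[OF r(1,2)] obtain q where q: "q > 0"
    and dvd: "\<And>i. of_int i * s \<in> \<int> \<longleftrightarrow> q dvd i" by blast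
  obtain c where c: "of_int q * s = of_int c" using dvd[of q] by (auto elim: Ints_cases)
  have "real_of_int c > 0" using c q s by (metis mult_pos_pos of_int_0_less_iff)
  then have c0: "c > 0" by simp
  have "of_int q * s \<le> of_int q * (1/2)" using s_le q by (intro mult_left_mono) auto
  then have cq: "2 * c \<le> q" using c by linarith
  have qr: "q dvd r" using dvd r by blast
  show ?thesis
  proof (cases "q = 2 \<or> q = 3")
    case True
    then have "c = 1" using c0 cq by linarith
    show ?thesis
    proof (cases "q = 2")
      case q2: True
      then have s2: "s = 1/2" using c \<open>c = 1\<close> by simp
      have eq: "1/4 = of_int i * of_int j * t"
        if "odd i" "odd j" "0 < i" "0 < j" "i \<le> top" "j \<le> top" "i + j > top" "i \<noteq> j" for i j
      proof -
        define a b where "a = i div 2" and "b = j div 2"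
        have ab: "i = 2 * a + 1" "j = 2 * b + 1" using that(1,2) unfolding a_def b_def by presburger+
        have "(of_int i * s - of_int a) * (1 - (of_int j * s - of_int b)) = of_int i * of_int j * t"
          using that m by (intro pair_1) (auto simp: ab s2 field_simps)
        then show ?thesis by (simp add: ab s2 field_simps)
      qed
      \<comment> \<open>The fractional parts in odd rows are all 1/2, so i j t = 1/4 whenever
        \<open>eq\<close> applies; hence no odd row has two such partners.\<close>
      have no: "False" if "odd n" "n \<le> top" "2 * n - 4 > top" "n \<ge> 5" for n
      proof -
        have "of_int n * of_int (n - 2) * t = of_int n * of_int (n - 4) * t"
          using eq[of n "n - 2"] eq[of n "n - 4"] that by simp
        then show False using that t_pos by simp
      qed
      have "even top" using no[of top] k by auto
      moreover have "\<not> top \<ge> 8" using no[of "top - 1"] \<open>even top\<close> by auto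
      ultimately have "top = 6" using k by presburger
      then show ?thesis using final_5_6 m s2 by blast
    next
      case False
      then have s3: "s = 1/3" using c \<open>c = 1\<close> True by simp
      have e1: "2/9 = of_int i * of_int j * t"
        if "i mod 3 = 1 \<and> j mod 3 = 1 \<or> i mod 3 = 2 \<and> j mod 3 = 2" "0 < i" "0 < j" "i \<le> top" "j \<le> top" "i + j > top" "i \<noteq> j" for i j
      proof -
        define a b where "a = i div 3" and "b = j div 3"
        have ab: "i = 3 * a + 1 \<and> j = 3 * b + 1 \<or> i = 3 * a + 2 \<and> j = 3 * b + 2"
          using that(1) unfolding a_def b_def by presburger
        have "(of_int i * s - of_int a) * (1 - (of_int j * s - of_int b)) = of_int i * of_int j * t"
          using that m ab by (intro pair_1) (auto simp: s3 field_simps)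
        then show ?thesis using ab by (auto simp: s3 field_simps)
      qed
      have e2: "4/9 = of_int i * of_int j * t"
        if "i mod 3 = 2" "j mod 3 = 1" "0 < i" "0 < j" "i \<le> top" "j \<le> top" "i + j > top" for i j
      proof -
        have "i \<noteq> j" using that by auto
        define a b where "a = i div 3" and "b = j div 3"
        have ab: "i = 3 * a + 2" "j = 3 * b + 1"
          using that(1,2) unfolding a_def b_def by presburger+
        have "(of_int i * s - of_int a) * (1 - (of_int j * s - of_int b)) = of_int i * of_int j * t"
          using that m ab by (intro pair_1 \<open>i \<noteq> j\<close>) (auto simp: s3 field_simps)
        then show ?thesis using ab by (auto simp: s3 field_simps)
      qed
      have double: "j = 2 * l" if "4/9 = of_int i * of_int j * t" "2/9 = of_int i * of_int l * t" "i > 0"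
        for i j l
      proof -
        have "of_int i * of_int j * t = 2 * (of_int i * of_int l * t)" using that by linarith
        then have "(of_int i * t) * of_int j = (of_int i * t) * of_int (2 * l)"
          by (simp add: algebra_simps)
        then have "real_of_int j = of_int (2 * l)" using that t_pos by simp
        then show ?thesis by (simp only: of_int_eq_iff)
      qed
      \<comment> \<open>In each class some row has partners with the values 4/9 and 2/9. By
        \<open>double\<close> one partner is then twice the other, which bounds
        \<open>top\<close>.\<close>
      have "top mod 3 = 0 \<or> top mod 3 = 1 \<or> top mod 3 = 2" by presburger
      then have "top = 6 \<or> top \<le> 5"
      proof (elim disjE)
        assume h: "top mod 3 = 0"
        have "top - 2 = 2 * (top - 4)" if "top \<ge> 7"
        proof (rule double[of "top - 1"])
          show "4/9 = of_int (top - 1) * of_int (top - 2) * t"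
            by (rule e2) (use h that in presburger)+
          show "2/9 = of_int (top - 1) * of_int (top - 4) * t"
            by (rule e1) (use h that in presburger)+
        qed (use that in simp)
        then have "\<not> top \<ge> 7" by auto
        then show ?thesis by linarith
      next
        assume h: "top mod 3 = 1"
        have "top - 2 = 2 * (top - 3)" if "top \<ge> 5"
        proof (rule double[of top])
          have "4/9 = of_int (top - 2) * of_int top * t"
            by (rule e2) (use h that in presburger)+
          then show "4/9 = of_int top * of_int (top - 2) * t" by (simp only: mult.commute)
          show "2/9 = of_int top * of_int (top - 3) * t"
            by (rule e1) (use h that in presburger)+
        qed (use that in simp)
        then show ?thesis by (cases "top \<ge> 5") simp_all
      next
        assume h: "top mod 3 = 2"
        have "top - 1 = 2 * (top - 3)" if "top \<ge> 5"
        proof (rule double[of top])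
          show "4/9 = of_int top * of_int (top - 1) * t"
            by (rule e2) (use h that in presburger)+
          show "2/9 = of_int top * of_int (top - 3) * t"
            by (rule e1) (use h that in presburger)+
        qed (use that in simp)
        then show ?thesis by (cases "top \<ge> 5") simp_all
      qed
      moreover have "top \<noteq> 5"
      proof
        assume "top = 5"
        then have "4/9 = of_int 5 * of_int 4 * t" "4/9 = of_int 2 * of_int 4 * t"
          using e2[of 5 4] e2[of 2 4] by simp_all
        then show False by simp
      qed
      ultimately show ?thesis using final_5_6[OF m] s3 k by auto
    qed
  next
    case False
    then have q4: "q \<ge> 4" using cq c0 by linarith
    have N: "of_int j * s \<notin> \<int>" if "\<bar>j - r\<bar> < q" "j \<noteq> r" for j
    proof -
      have "\<not> q dvd (j - r)" using that zdvd_imp_le[of q "\<bar>j - r\<bar>"] by auto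
      then show ?thesis using dvd qr dvd_diff by blast
    qed
    have rs: "of_int r * s \<ge> 1"
    proof -
      have "q \<le> r" using qr r by (simp add: zdvd_imp_le)
      then have "of_int q * s \<le> of_int r * s" using s by (intro mult_right_mono) auto
      then show ?thesis using c c0 by linarith
    qed
    consider "r = top" | "r = top - 1" | "r = top - 2" using r by blast
    then show ?thesis
    proof cases
      case 1
      have "\<not> top \<ge> 6"
        using no_three_consecutive[OF m, of "top - 1"] N[of "top - 1"] N[of "top - 2"] N[of "top - 3"] q4 1
        by auto
      then have k5: "top = 5" using k by linarith
      then have "q = 5" using qr 1 q4 zdvd_imp_le[of q 5] by (cases "q = 4") auto
      then have "c = 1 \<or> c = 2" using c0 cq by linarith
      moreover have "c \<noteq> 1"
      proof
        assume "c = 1"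
        then have s5: "s = 1/5" using c \<open>q = 5\<close> by simp
        have "12/25 = 8 * t" "8/25 = 12 * t"
          using pair_1[of 4 2 0 0] pair_1[of 4 3 0 0] m k5 s5 by auto
        then show False by simp
      qed
      ultimately have "s = 2/5" using c \<open>q = 5\<close> by auto
      then show ?thesis using final_5_6[OF m] k5 by simp
    next
      case 2
      show ?thesis
      proof (cases "top = 5")
        case True
        then have "q = 4" using qr 2 q4 zdvd_imp_le[of q 4] by auto
        then have "c = 1 \<or> c = 2" using c0 cq by linarith
        moreover have "c \<noteq> 2"
        proof
          assume "c = 2"
          then have "of_int 2 * s = of_int 1" using c \<open>q = 4\<close> by simp
          then have "of_int 2 * s \<in> \<int>" by (metis Ints_of_int)
          then show False using dvd[of 2] \<open>q = 4\<close> by simp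
        qed
        ultimately have "s = 1/4" using c \<open>q = 4\<close> by auto
        then show ?thesis using final_5_6[OF m] True by simp
      next
        case False
        then have 6: "top = 6 \<and> fl 4 = 0"
          using k 2 N[of top] N[of "top - 2"] N[of "top - 3"] q4 m by (intro period_top_minus_1) auto
        then have "q dvd 5" using qr 2 by simp
        then have "q = 5" using q4 zdvd_imp_le[of q 5] by (cases "q = 4") auto
        have "4 * s < 1" using less_fl[of 4] 6 by simp
        then have "real_of_int c < 2" using c \<open>q = 5\<close> by simp
        then have "c = 1" using c0 by simp
        then have "s = 1/5" using c \<open>q = 5\<close> by simp
        then show ?thesis using final_5_6[OF m] 6 by simp
      qed
    next
      case 3
      have "s \<noteq> 1/2"
      proof
        assume "s = 1/2"
        then have "of_int 2 * s = of_int 1" by simp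
        then have "of_int 2 * s \<in> \<int>" by (metis Ints_of_int)
        then have "q dvd 2" using dvd by blast
        with q4 zdvd_imp_le[of q 2] show False by simp
      qed
      moreover have "top \<ge> 6" using qr 3 r q4 zdvd_imp_le[of q r] by auto
      ultimately have 9: "top = 9" "fl 9 = 3" "fl 8 = 3"
        using k 3 N[of top] N[of "top - 1"] N[of "top - 3"] q4 m rs s_le
          period_top_minus_2 by (auto simp: less_le)
      then have "q dvd 7" using qr 3 by simp
      then have "q = 7"
        using q4 zdvd_imp_le[of q 7] by (cases "q = 4"; cases "q = 5"; cases "q = 6") auto
      have "8 * s \<ge> 3" "9 * s < 4" using fl_le[of 8] less_fl[of 9] 9 by auto
      then have "real_of_int c > 2" "real_of_int c < 4" using c \<open>q = 7\<close> by auto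
      then have "c = 3" by linarith
      then have s7: "s = 3/7" using c \<open>q = 7\<close> by simp
      \<comment> \<open>The value 3/7 passes the divisibility conditions; it is ruled out because
        two pair equations give different values of \<open>t\<close>.\<close>
      have "36/49 = 45 * t" "24/49 = 72 * t"
        using pair_1[of 9 5 3 2] pair_1[of 9 8 3 3] m 9(1) s7 by auto
      then show ?thesis by simp
    qed
  qed
qed

lemma classified_1: "m = 1 \<Longrightarrow> classified"
  using small_1 top_3 top_4 top_ge_5 top_ge_1 by (cases "top \<ge> 5") force+

end

section \<open>Longest root a proper multiple\<close>

context row_system
begin

section \<open>Opposite ends of full rows\<close>

lemma full_extremal:
  assumes "full j" "j \<noteq> 0"
  obtains a b where "(a, j) \<in> S" "of_int m - 1 \<le> xpos a j" "xpos a j < of_int m"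
    "(b, j) \<in> S" "- of_int m < xpos b j" "xpos b j \<le> 1 - of_int m"
proof -
  define a where "a = \<lceil>of_int m - of_int j * s\<rceil> - 1"
  define b where "b = \<lfloor>- of_int m - of_int j * s\<rfloor> + 1"
  have a: "of_int m - 1 \<le> xpos a j" "xpos a j < of_int m" unfolding a_def by linarith+
  have b: "- of_int m < xpos b j" "xpos b j \<le> 1 - of_int m" unfolding b_def by linarith+
  have "real_of_int m \<ge> 1" using m_ge_1 by simp
  then have "(a, j) \<in> S" "(b, j) \<in> S"
    unfolding full_iff[OF assms] using a b by (simp_all add: abs_less_iff)
  with a b that show thesis by blast
qed

lemma full_pair_3:
  assumes "m \<ge> 3" "full p" "full q" "0 < p" "0 < q" "p \<noteq> q"
  shows "p + q \<le> top"
proof (rule ccontr)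
  assume gt: "\<not> p + q \<le> top"
  obtain a where a: "(a, p) \<in> S" "of_int m - 1 \<le> xpos a p"
    using full_extremal[OF assms(2)] assms by (metis less_irrefl)
  obtain b where b: "(b, q) \<in> S" "- of_int m < xpos b q" "xpos b q \<le> 1 - of_int m"
    using full_extremal[OF assms(3)] assms by (metis less_irrefl)
  have m3: "real_of_int m \<ge> 3" using assms by simp
  have "(b + 1, q) \<in> S" using assms b m3 by (simp add: full_iff abs_less_iff)
  then have "xpos a p * xpos (b + 1) q + of_int p * of_int q * t = 0"
    using a b m3 gt assms by (intro opposite) auto
  moreover have "xpos a p * xpos b q + of_int p * of_int q * t = 0"
    using a b m3 gt assms by (intro opposite) auto
  ultimately have "xpos a p = 0" by (simp add: algebra_simps)
  with a m3 show False by simp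
qed

lemma non_integral_row_2:
  assumes "m = 2" "0 < p" "p \<le> top" "of_int p * s \<notin> \<int>"
  obtains c u where "0 < u" "u < 1" "of_int p * s = of_int c + u"
    "\<And>i. (i - c, p) \<in> S \<longleftrightarrow> - 2 \<le> i \<and> i \<le> 1"
proof -
  define u where "u = of_int p * s - of_int (fl p)"
  have u: "0 < u" "u < 1" "of_int p * s = of_int (fl p) + u"
    using fl_less[OF assms(4)] less_fl[of p] by (auto simp: u_def)
  have f: "full p" using assms by (intro full_if_non_integral) auto
  have "(i - fl p, p) \<in> S \<longleftrightarrow> - 2 \<le> i \<and> i \<le> 1" for i
  proof -
    have "(i - fl p, p) \<in> S \<longleftrightarrow> \<bar>of_int i + u\<bar> < 2"
      using full_iff[OF f, of "i - fl p"] assms u(3) by simp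
    also have "\<dots> \<longleftrightarrow> - 2 \<le> i \<and> i \<le> 1" using u by linarith
    finally show ?thesis .
  qed
  with u that show thesis by blast
qed

text \<open>For \<open>m = 2\<close> the positions are u - 2, ..., u + 1 in row \<open>p\<close> and
  w - 2, ..., w + 1 in row \<open>q\<close>. If u \<ge> w, both u and u + 1 are opposite to w - 2,
  which is not 0; the other case is symmetric.\<close>

lemma non_integral_pair_2:
  assumes m: "m = 2" and pq: "0 < p" "0 < q" "p \<noteq> q" "p \<le> top" "q \<le> top"
    and N: "of_int p * s \<notin> \<int>" "of_int q * s \<notin> \<int>"
  shows "p + q \<le> top"
proof (rule ccontr)
  assume gt: "\<not> p + q \<le> top"
  obtain c u where u: "0 < u" "u < 1" "of_int p * s = of_int c + u"
    "\<And>i. (i - c, p) \<in> S \<longleftrightarrow> - 2 \<le> i \<and> i \<le> 1"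
    using non_integral_row_2[OF m pq(1,4) N(1)] by blast
  obtain d w where w: "0 < w" "w < 1" "of_int q * s = of_int d + w"
    "\<And>i. (i - d, q) \<in> S \<longleftrightarrow> - 2 \<le> i \<and> i \<le> 1"
    using non_integral_row_2[OF m pq(2,5) N(2)] by blast
  have opp: "(of_int i + u) * (of_int j + w) + of_int p * of_int q * t = 0"
    if "- 2 \<le> i" "i \<le> 1" "- 2 \<le> j" "j \<le> 1" "of_int i + u - (of_int j + w) \<ge> 2" for i j
    using opposite[of "i - c" p "j - d" q] that u w m pq gt by simp
  have opp': "(of_int i + u) * (of_int j + w) + of_int p * of_int q * t = 0"
    if "- 2 \<le> i" "i \<le> 1" "- 2 \<le> j" "j \<le> 1" "of_int j + w - (of_int i + u) \<ge> 2" for i j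
    using opposite[of "j - d" q "i - c" p] that u w m pq gt by (simp add: mult.commute)
  show False
  proof (cases "u \<ge> w")
    case True
    then have "(1 + u) * (w - 2) + of_int p * of_int q * t = 0"
      "u * (w - 2) + of_int p * of_int q * t = 0"
      using opp[of 1 "- 2"] opp[of 0 "- 2"] u(1,2) w(1,2) by simp_all
    then have "w - 2 = 0" by algebra
    then show False using w by simp
  next
    case False
    then have "(u - 2) * (1 + w) + of_int p * of_int q * t = 0"
      "(u - 2) * w + of_int p * of_int q * t = 0"
      using opp'[of "- 2" 1] opp'[of "- 2" 0] u(1,2) w(1,2) by simp_all
    then have "u - 2 = 0" by algebra
    then show False using u by simp
  qed
qed

text \<open>The ends of the row are at least 2 m - 2 apart. If the last root were opposite to the
  first two, the two equations would put it at 0. So 2 m - 3 \<le> m, hence m = 3, and the ends are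
  exactly 2 and -2.\<close>

lemma full_upper_half_3:
  assumes m: "m \<ge> 3" and p: "full p" "0 < p" "2 * p > top"
  shows "m = 3 \<and> of_int p * s \<in> \<int>"
proof -
  obtain a b where a: "(a, p) \<in> S" "of_int m - 1 \<le> xpos a p" "xpos a p < of_int m"
    and b: "(b, p) \<in> S" "- of_int m < xpos b p" "xpos b p \<le> 1 - of_int m"
    using full_extremal[OF p(1)] p by (metis less_irrefl)
  have m3: "real_of_int m \<ge> 3" using m by simp
  have b1: "(b + 1, p) \<in> S" using p b m3 by (simp add: full_iff abs_less_iff)
  have notin: "(i, 2 * p) \<notin> S" for i using top_ge[of i "2 * p"] p by auto
  have ab: "2 * m - 2 \<le> a - b" using a b by linarith
  then have "xpos a p * xpos b p + of_int p * of_int p * t = 0"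
    using m a b notin by (intro opposite_same) auto
  moreover have "xpos a p * xpos (b + 1) p + of_int p * of_int p * t = 0" if "a - (b + 1) > m"
    using m a b1 notin that by (intro opposite_same) auto
  ultimately have "xpos a p = 0" if "a - (b + 1) > m" using that by (simp add: algebra_simps)
  then have "a - (b + 1) \<le> m" using a m3 by force
  then have m_eq: "m = 3" "a - b = 4" using ab m by auto
  then have "real_of_int a - real_of_int b = 4" by (metis of_int_diff of_int_numeral)
  then have "xpos a p = 2" using a b m_eq by simp
  then have "of_int p * s = of_int (2 - a)" by simp
  then show ?thesis using m_eq by (metis Ints_of_int)
qed

text \<open>The ends 1 + u and u - 2 of the row are 3 > \<open>m\<close> apart, and their
  orthogonality fixes \<open>t\<close>.\<close>

lemma non_integral_upper_half_2:
  assumes m: "m = 2" and p: "0 < p" "p \<le> top" "2 * p > top"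
    and c: "of_int p * s = of_int c + u" "0 < u" "u < 1"
  shows "(1 + u) * (2 - u) = of_int p * of_int p * t"
proof -
  have "full p" using p c by (intro full_if_non_integral not_IntsI[of c]) auto
  then have "(1 - c, p) \<in> S" "(- 2 - c, p) \<in> S" using p c m by (auto simp: full_iff abs_less_iff)
  then have "xpos (1 - c) p * xpos (- 2 - c) p + of_int p * of_int p * t = 0"
    using m p top_ge[of _ "2 * p"] by (intro opposite_same) force+
  moreover have "xpos (1 - c) p = 1 + u" "xpos (- 2 - c) p = u - 2" using c(1) by simp_all
  ultimately have "(1 + u) * (u - 2) + of_int p * of_int p * t = 0" by (simp only:)
  then show ?thesis by (simp add: algebra_simps)
qed

text \<open>Positions are integers now, and every row below the last is full, since (1, 1) and (0, j
  + 1) have positive inner product. For \<open>m = 2\<close> distinct full rows with p + q > top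
  satisfy p q t = 1, so each has at most one such partner; for \<open>m \<ge> 3\<close> there is
  none by \<open>full_pair_3\<close>. Both bound \<open>top\<close>.\<close>

lemma integral_position_multiple:
  assumes m: "m \<ge> 2" and s: "s = 0"
  shows classified
proof -
  have zero: "(0, j) \<in> S" if j: "0 < j" "j \<le> top" for j
  proof -
    from row_nonempty[of j] j obtain i where i: "(i, j) \<in> S" by auto
    show ?thesis
    proof (cases "i = 0")
      case False
      with i s have "full j" unfolding full_def by auto
      then show ?thesis using j m s by (simp add: full_iff)
    qed (use i in simp)
  qed
  have 11: "(1, 1) \<in> S" using full_iff[OF full_1, of 1] m s by simp
  have F: "full j" if j: "0 < j" "j < top" for j
  proof -
    have "xpos 1 1 * xpos 0 (j + 1) + of_int 1 * of_int (j + 1) * t > 0"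
      using s j t_pos by simp
    from ax_pos[OF 11 zero this] j have "(1, - j) \<in> S" by simp
    from uminus[OF this] show ?thesis unfolding full_def using s by auto
  qed
  have fullrow: "row j (1 - m) (m - 1)" if "0 < j" "full j" for j
    by (rule row_fullI[OF that(2)]) (use that s m in auto)
  have pt: "row j 0 0" if "0 < j" "j \<le> top" "\<not> full j" for j
    using row_pointI[of j 0] that s by simp
  show ?thesis
  proof (cases "m = 2")
    case True
    have pair: "of_int p * of_int q * t = 1"
      if "full p" "full q" "0 < p" "0 < q" "p \<noteq> q" "p + q > top" for p q
    proof -
      have "(1, p) \<in> S" "(- 1, q) \<in> S" using that s True by (auto simp: full_iff)
      from opposite[OF this] that s True show ?thesis by simp
    qed
    have two: False if "full p" "full q" "full r" "0 < p" "0 < q" "0 < r" "p \<noteq> q" "p \<noteq> r" "q \<noteq> r"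
      "p + q > top" "p + r > top" for p q r
    proof -
      have "real_of_int p * of_int q * t = of_int p * of_int r * t"
        using pair[of p q] pair[of p r] that by simp
      with that t_pos show False by simp
    qed
    have "top \<le> 4"
      using two[of "top - 1" "top - 2" "top - 3"] F[of "top - 1"] F[of "top - 2"] F[of "top - 3"]
      by (cases "top \<le> 4") simp_all
    then have "top = 1 \<or> top = 2 \<or> top = 3 \<or> top = 4" using top_ge_1 by linarith
    moreover have "\<not> (top = 3 \<and> full 3)" using two[of 3 2 1] F[of 1] F[of 2] by auto
    moreover have "\<not> (top = 4 \<and> full 4)" using two[of 4 3 2] F[of 2] F[of 3] by auto
    ultimately consider "top = 1" | "top = 2" "full 2" | "top = 2" "\<not> full 2"
      | "top = 3" "\<not> full 3" | "top = 4" "\<not> full 4"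
      by blast
    then show ?thesis
    proof cases
      case 1
      then show ?thesis using fullrow[of 1] full_1 True
        by (intro classifiedI[of "[(- 1, 1)]"]) (auto simp: rank2_rows_def rank2_table_def)
    next
      case 2
      then show ?thesis using fullrow[of 1] fullrow[of 2] full_1 True
        by (intro classifiedI[of "[(- 1, 1), (- 1, 1)]"]) (auto simp: rank2_rows_def rank2_table_def)
    next
      case 3
      then show ?thesis using fullrow[of 1] pt[of 2] full_1 True
        by (intro classifiedI[of "[(- 1, 1), (0, 0)]"]) (auto simp: rank2_rows_def rank2_table_def)
    next
      case 4
      then show ?thesis using fullrow[of 1] fullrow[of 2] pt[of 3] full_1 F[of 2] True
        by (intro classifiedI[of "[(- 1, 1), (- 1, 1), (0, 0)]"])
           (auto simp: rank2_rows_def rank2_table_def)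
    next
      case 5
      then show ?thesis
        using fullrow[of 1] fullrow[of 2] fullrow[of 3] pt[of 4] full_1 F[of 2] F[of 3] True
        by (intro classifiedI[of "[(- 1, 1), (- 1, 1), (- 1, 1), (0, 0)]"])
           (auto simp: rank2_rows_def rank2_table_def)
    qed
  next
    case False
    then have m3: "m \<ge> 3" using m by simp
    have pt_top: "row top 0 0" if "top \<ge> 2"
      using that pt[of top] full_pair_3[OF m3, of top "top - 1"] F[of "top - 1"] by force
    have "\<not> top \<ge> 4"
      using full_pair_3[OF m3, of "top - 1" "top - 2"] F[of "top - 1"] F[of "top - 2"] by force
    then consider "top = 1" | "top = 2" | "top = 3" using top_ge_1 by linarith
    then show ?thesis
    proof cases
      case 1
      then have "m = 3" using full_upper_half_3[OF m3 full_1] by simp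
      with 1 show ?thesis using fullrow[of 1] full_1
        by (intro classifiedI[of "[(- 2, 2)]"]) (auto simp: rank2_rows_def rank2_table_def)
    next
      case 2
      \<comment> \<open>Row 2 is the single point 0, so roots of row 1 that are more than
        \<open>m\<close> apart and whose positions do not cancel have neither sum nor difference in
        the system.\<close>
      have opp: "of_int (m - 1) * of_int l = t" if "2 \<le> l" "l \<le> 3" "l < m - 1" for l
      proof -
        have "row 2 0 0" using pt_top 2 by simp
        then have "(m - 1 - l, 2) \<notin> S" using that by (auto simp: row_def)
        moreover have "(m - 1, 1) \<in> S" "(- l, 1) \<in> S"
          using that m3 s full_1 by (auto simp: full_iff)
        ultimately have "xpos (m - 1) 1 * xpos (- l) 1 + of_int 1 * of_int 1 * t = 0"
          using that by (intro opposite_same) auto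
        then show ?thesis using s by simp
      qed
      have "\<not> m \<ge> 5"
      proof
        assume "m \<ge> 5"
        then have "real_of_int (m - 1) * of_int 2 = of_int (m - 1) * of_int 3"
          using opp[of 2] opp[of 3] by simp
        with \<open>m \<ge> 5\<close> show False by simp
      qed
      then consider "m = 3" | "m = 4" using m3 by linarith
      then show ?thesis
      proof cases
        case 1
        with 2 show ?thesis using fullrow[of 1] full_1 pt_top
          by (intro classifiedI[of "[(- 2, 2), (0, 0)]"]) (auto simp: rank2_rows_def rank2_table_def)
      next
        case m4: 2
        with 2 show ?thesis using fullrow[of 1] full_1 pt_top
          by (intro classifiedI[of "[(- 3, 3), (0, 0)]"]) (auto simp: rank2_rows_def rank2_table_def)
      qed
    next
      case 3
      then have "m = 3" using full_upper_half_3[OF m3 F[of 2]] by simp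
      with 3 show ?thesis using fullrow[of 1] fullrow[of 2] full_1 F[of 2] pt_top
        by (intro classifiedI[of "[(- 2, 2), (- 2, 2), (0, 0)]"])
           (auto simp: rank2_rows_def rank2_table_def)
    qed
  qed
qed

section \<open>Positive offset \<open>s\<close>, \<open>m \<ge> 2\<close>\<close>

lemma half_top_2:
  assumes m: "m \<ge> 2" and s: "s = 1/2" and k: "top = 2"
  shows classified
proof -
  have r1: "row 1 (- m) (m - 1)" by (rule row_fullI[OF full_1]) (use s m in auto)
  have r2: "row 2 (- 1) (- 1)" if "\<not> full 2" using row_pointI[of 2 "- 1"] that s k by simp
  have r2': "row 2 (- m) (m - 2)" if "full 2" by (rule row_fullI[OF that]) (use s m in auto)
  show ?thesis
  proof (cases "m = 2")
    case True
    show ?thesis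
    proof (cases "full 2")
      case f: True
      with True k r1 r2' show ?thesis
        by (intro classifiedI[of "[(- 2, 1), (- 2, 0)]"]) (auto simp: rank2_rows_def rank2_table_def)
    next
      case False
      with True k r1 r2 show ?thesis
        by (intro classifiedI[of "[(- 2, 1), (- 1, - 1)]"]) (auto simp: rank2_rows_def rank2_table_def)
    qed
  next
    case False
    then have m3: "m \<ge> 3" using m by simp
    then have nf: "\<not> full 2" using full_pair_3[OF m3 full_1, of 2] k by auto
    \<comment> \<open>Row 2 being a single point, the last root of row 1 is orthogonal to the one at
      1/2 - l; two values of \<open>l\<close> contradict each other.\<close>
    have opp: "(of_int m - 1/2) * (of_int l - 1/2) = t" if "2 \<le> l" "l \<le> 3" "l < m" for l
    proof -
      have "(m - 1 - l, 2) \<notin> S" using r2[OF nf] that by (auto simp: row_def)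
      moreover have "(m - 1, 1) \<in> S" "(- l, 1) \<in> S"
        using that m3 r1 by (auto simp: row_def)
      ultimately have "xpos (m - 1) 1 * xpos (- l) 1 + of_int 1 * of_int 1 * t = 0"
        using that by (intro opposite_same) auto
      then show ?thesis using s by (simp add: algebra_simps)
    qed
    have "\<not> m \<ge> 4"
    proof
      assume "m \<ge> 4"
      then have "(real_of_int m - 1/2) * (2 - 1/2) = (of_int m - 1/2) * (3 - 1/2)"
        using opp[of 2] opp[of 3] by simp
      with \<open>m \<ge> 4\<close> show False by simp
    qed
    then have "m = 3" using m3 by simp
    with k r1 r2[OF nf] show ?thesis
      by (intro classifiedI[of "[(- 3, 2), (- 1, - 1)]"]) (auto simp: rank2_rows_def rank2_table_def)
  qed
qed

lemma third_top_3:
  assumes m: "m \<ge> 2" and s: "s = 1/3" and k: "top = 3"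
  shows classified
proof -
  have n2: "of_int 2 * s \<notin> \<int>" by (rule not_IntsI[of 0]) (simp_all add: s)
  have f2: "full 2" using n2 k by (intro full_if_non_integral) auto
  have m2: "m = 2"
  proof (rule ccontr)
    assume "m \<noteq> 2"
    with m full_upper_half_3[of 2] f2 k n2 show False by simp
  qed
  have t: "t = 5/9" using non_integral_upper_half_2[OF m2, of 2 0 "2/3"] k s by simp
  have r1: "row 1 (- 2) 1" by (rule row_fullI[OF full_1]) (use s m2 in auto)
  have r2: "row 2 (- 2) 1" by (rule row_fullI[OF f2]) (use s m2 in auto)
  \<comment> \<open>A full last row would contain the sum of the orthogonal roots (-2, 1) and (0,
    2). Their difference would then be a root at position -7/3, beyond the bound 2.\<close>
  have "\<not> full 3"
  proof
    assume "full 3"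
    then have "(- 2, 3) \<in> S" by (simp add: full_iff s m2)
    moreover have "(- 2, 1) \<in> S" "(0, 2) \<in> S" using r1 r2 by (auto simp: row_def)
    moreover have "xpos (- 2) 1 * xpos 0 2 + of_int 1 * of_int 2 * t = 0" by (simp add: s t)
    ultimately have "(- 2, - 1) \<in> S" using ax_zero[of "- 2" 1 0 2] by simp
    from bound[OF this] show False by (simp add: s m2)
  qed
  then have "row 3 (- 1) (- 1)" using row_pointI[of 3 "- 1"] s k by simp
  with r1 r2 m2 k show ?thesis
    by (intro classifiedI[of "[(- 2, 1), (- 2, 1), (- 1, - 1)]"])
       (auto simp: rank2_rows_def rank2_table_def)
qed

lemma half_top_4:
  assumes m: "m \<ge> 2" and s: "s = 1/2" and k: "top = 4"
  shows classified
proof -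
  have n3: "of_int 3 * s \<notin> \<int>" by (rule not_IntsI[of 1]) (simp_all add: s)
  have f3: "full 3" using n3 k by (intro full_if_non_integral) auto
  have m2: "m = 2"
  proof (rule ccontr)
    assume "m \<noteq> 2"
    with m full_upper_half_3[of 3] f3 k n3 show False by simp
  qed
  have t: "t = 1/4" using non_integral_upper_half_2[OF m2, of 3 1 "1/2"] k s by simp
  have r1: "row 1 (- 2) 1" by (rule row_fullI[OF full_1]) (use s m2 in auto)
  have r3: "row 3 (- 3) 0" by (rule row_fullI[OF f3]) (use s m2 in auto)
  have mem: "(1, 1) \<in> S" "(- 1, 1) \<in> S" "(- 2, 3) \<in> S" "(- 1, 3) \<in> S"
    using r1 r3 by (auto simp: row_def)
  \<comment> \<open>The same with (1, 1) and (-2, 3), whose difference sits exactly at the excluded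
    position 2.\<close>
  have "\<not> full 4"
  proof
    assume "full 4"
    then have "(- 1, 4) \<in> S" by (simp add: full_iff s m2)
    moreover have "xpos 1 1 * xpos (- 2) 3 + of_int 1 * of_int 3 * t = 0" by (simp add: s t)
    ultimately have "(3, - 2) \<in> S" using ax_zero[OF mem(1,3)] by simp
    from bound[OF this] show False by (simp add: s m2)
  qed
  then have r4: "row 4 (- 2) (- 2)" using row_pointI[of 4 "- 2"] s k by simp
  have "xpos (- 1) 3 * xpos (- 1) 1 + of_int 3 * of_int 1 * t > 0" by (simp add: s t)
  from ax_pos[OF mem(4,2) this] have "(0, 2) \<in> S" by simp
  then have f2: "full 2" unfolding full_def using s by force
  have r2: "row 2 (- 2) 0" by (rule row_fullI[OF f2]) (use s m2 in auto)
  from r1 r2 r3 r4 m2 k show ?thesis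
    by (intro classifiedI[of "[(- 2, 1), (- 2, 0), (- 3, 0), (- 2, - 2)]"])
       (auto simp: rank2_rows_def rank2_table_def)
qed

text \<open>Distinct non-integral rows satisfy p + q \<le> top, while of two consecutive rows at
  least one is non-integral because \<open>s\<close> is no integer. From four rows on, integral and
  non-integral rows must therefore alternate near the top, which makes 2 s an integer.\<close>

lemma non_integral_position_multiple:
  assumes m: "m \<ge> 2" and s: "s > 0"
  shows classified
proof -
  define N where "N = (\<lambda>j. of_int j * s \<notin> \<int>)"
  have pair: "p + q \<le> top" if "N p" "N q" "0 < p" "0 < q" "p \<noteq> q" "p \<le> top" "q \<le> top" for p q
  proof (cases "m = 2")
    case True
    with that non_integral_pair_2 show ?thesis by (auto simp: N_def)
  next
    case False
    with that m full_pair_3[of p q] full_if_non_integral show ?thesis by (auto simp: N_def)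
  qed
  have N1: "N 1" unfolding N_def by (rule not_IntsI[of 0]) (use s s_le in auto)
  have half: "s = 1/2" if "\<not> N j" "\<not> N (j - 2)" for j
  proof -
    have "of_int j * s - of_int (j - 2) * s \<in> \<int>" using that by (auto simp: N_def)
    then have "2 * s \<in> \<int>" by (simp add: algebra_simps)
    then obtain z where z: "2 * s = of_int z" by (auto elim: Ints_cases)
    then have "z = 1" using s s_le by linarith
    with z show ?thesis by simp
  qed
  have consec: "N j \<or> N (j - 1)" for j
  proof (rule ccontr)
    assume "\<not> ?thesis"
    then have "of_int j * s - of_int (j - 1) * s \<in> \<int>" by (auto simp: N_def)
    then have "s \<in> \<int>" by (simp add: algebra_simps)
    then show False using N1 by (simp add: N_def)
  qed
  consider "top = 1" | "top = 2" | "top = 3" | "top \<ge> 4" using top_ge_1 by linarith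
  then show ?thesis
  proof cases
    case 1
    have m2: "m = 2"
    proof (rule ccontr)
      assume "m \<noteq> 2"
      with m full_upper_half_3[of 1] full_1 1 N1 show False by (simp add: N_def)
    qed
    have "row 1 (- 2) 1" by (rule row_fullI[OF full_1]) (use m2 s s_le in auto)
    then show ?thesis using 1 m2
      by (intro classifiedI[of "[(- 2, 1)]"]) (auto simp: rank2_rows_def rank2_table_def)
  next
    case 2
    then have "\<not> N 2" using pair[of 1 2] N1 by auto
    moreover have "\<not> N 0" by (simp add: N_def)
    ultimately have "s = 1/2" using half[of 2] by simp
    then show ?thesis using half_top_2 m 2 by blast
  next
    case 3
    then have "\<not> N 3" using pair[of 1 3] N1 by auto
    then have "3 * s \<in> \<int>" by (simp add: N_def)
    then obtain c where c: "3 * s = of_int c" by (auto elim: Ints_cases)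
    then have "c = 1" using s s_le by linarith
    then show ?thesis using third_top_3 m 3 c by simp
  next
    case 4
    have "N top \<noteq> N (top - 1)" "N (top - 1) \<noteq> N (top - 2)"
      using pair[of top "top - 1"] pair[of "top - 1" "top - 2"] consec[of top] consec[of "top - 1"] 4 by auto
    moreover have "\<not> (N top \<and> N (top - 2))" using pair[of top "top - 2"] 4 by auto
    ultimately have "s = 1/2" "\<not> N top" using half[of top] by auto
    have odd: "N j" if "odd j" for j
    proof -
      have "j = 2 * (j div 2) + 1" using that by simp
      then have "real_of_int j = 2 * of_int (j div 2) + 1" by (metis of_int_1 of_int_add of_int_mult of_int_numeral)
      then have "of_int j * s = of_int (j div 2) + 1/2" using \<open>s = 1/2\<close> by (simp add: field_simps)
      then show ?thesis unfolding N_def by (intro not_IntsI[of "j div 2"]) auto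
    qed
    then have "even top" using \<open>\<not> N top\<close> by blast
    then have "\<not> top \<ge> 6"
      using pair[of "top - 1" "top - 3"] odd[of "top - 1"] odd[of "top - 3"] by auto
    then have "top = 4" using 4 \<open>even top\<close> by presburger
    then show ?thesis using half_top_4 m \<open>s = 1/2\<close> by blast
  qed
qed

lemma classified: classified
proof (cases "m = 1")
  case False
  then have "m \<ge> 2" using m_ge_1 by simp
  then show ?thesis
    using integral_position_multiple non_integral_position_multiple s_nonneg by (cases "s = 0") auto
qed (rule classified_1)

end

section \<open>From generalized root systems to row systems\<close>

text \<open>No orthogonality of \<open>D1\<close> and \<open>D2\<close> is assumed: sum and
  difference of nonzero roots from the two lie outside both, so the axioms force the roots to be
  orthogonal. This describes reducibility without the inner product.\<close>

lemma not_grs_irreducibleI: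
  assumes G: "grs R V" and D: "subspace D1" "subspace D2" "D1 \<inter> D2 \<subseteq> {0}"
    and R: "R \<subseteq> D1 \<union> D2" "\<not> R \<subseteq> D1" "\<not> R \<subseteq> D2"
  shows "\<not> grs_irreducible R V"
proof -
  have ax: "(x \<bullet> y < 0 \<longrightarrow> x + y \<in> R) \<and> (x \<bullet> y > 0 \<longrightarrow> x - y \<in> R) \<and>
      (x \<bullet> y = 0 \<longrightarrow> (x + y \<in> R \<longleftrightarrow> x - y \<in> R))" if "x \<in> R" "y \<in> R" for x y
    using G that unfolding grs_def by blast
  have out: "x + y \<notin> R" "x - y \<notin> R" if xy: "x \<in> D1" "x \<noteq> 0" "y \<in> D2" "y \<noteq> 0" for x y
  proof -
    have x2: "x \<notin> D2" and y1: "y \<notin> D1" using xy D(3) by auto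
    have "x + y \<notin> D1" using subspace_diff[OF D(1), of "x + y" x] xy y1 by auto
    moreover have "x + y \<notin> D2" using subspace_diff[OF D(2), of "x + y" y] xy x2 by auto
    moreover have "x - y \<notin> D1" using subspace_diff[OF D(1), of x "x - y"] xy y1 by auto
    moreover have "x - y \<notin> D2" using subspace_add[OF D(2), of "x - y" y] xy x2 by auto
    ultimately show "x + y \<notin> R" "x - y \<notin> R" using R(1) by auto
  qed
  have orth: "x \<bullet> y = 0" if xy: "x \<in> R \<inter> D1" "y \<in> R \<inter> D2" for x y
  proof (cases "x = 0 \<or> y = 0")
    case False
    then show ?thesis using out[of x y] ax[of x y] xy by (metis IntE linorder_neqE_linordered_idom)
  qed auto
  have sub: "grs (R \<inter> D) (span (R \<inter> D))" if "subspace D" for D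
  proof -
    have "0 \<in> R \<inter> D" using grs_0[OF G] that by (simp add: subspace_0)
    moreover have "x + y \<in> D" "x - y \<in> D" if "x \<in> D" "y \<in> D" for x y
      using that \<open>subspace D\<close> by (auto intro: subspace_add subspace_diff)
    moreover have "finite (R \<inter> D)" using G by (simp add: grs_def)
    ultimately show ?thesis unfolding grs_def using ax by (auto; blast)
  qed
  have nontriv: "\<not> grs_trivial (R \<inter> D) (span (R \<inter> D))" if "x \<in> R" "x \<in> D" "x \<noteq> 0" for x D
    using that by (auto simp: grs_trivial_def)
  have "grs_sum R V (R \<inter> D1) (span (R \<inter> D1)) (R \<inter> D2) (span (R \<inter> D2))"
    unfolding grs_sum_def
  proof (intro conjI ballI)
    fix x y assume x: "x \<in> span (R \<inter> D1)" and y: "y \<in> span (R \<inter> D2)"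
    have "orthogonal z y" if "z \<in> R \<inter> D1" for z
      using y by (rule orthogonal_to_span) (use that orth in \<open>auto simp: orthogonal_def\<close>)
    then have "orthogonal y x"
      by (intro orthogonal_to_span[OF x]) (auto simp: orthogonal_commute)
    then show "orthogonal x y" by (simp add: orthogonal_commute)
  next
    have "R = R \<inter> D1 \<union> R \<inter> D2" using R(1) by auto
    then have "V = span (R \<inter> D1 \<union> R \<inter> D2)" using G by (simp add: grs_def)
    then show "V = {x + y |x y. x \<in> span (R \<inter> D1) \<and> y \<in> span (R \<inter> D2)}"
      by (simp add: span_Un)
    show "R = R \<inter> D1 \<union> R \<inter> D2" using R(1) by auto
  qed
  moreover obtain x where "x \<in> R" "x \<in> D1" "x \<noteq> 0"
    using R(1,3) subspace_0[OF D(2)] by blast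
  moreover obtain y where "y \<in> R" "y \<in> D2" "y \<noteq> 0"
    using R(1,2) subspace_0[OF D(1)] by blast
  ultimately show ?thesis
    using sub[OF D(1)] sub[OF D(2)] nontriv unfolding grs_irreducible_def by blast
qed

text \<open>A decomposition of \<open>Q\<close> pulls back to two subspaces of \<open>V\<close> that
  meet only in 0. As \<open>f\<close> may distort angles they may fail to be orthogonal, but
  \<open>not_grs_irreducibleI\<close> still applies.\<close>

lemma grs_irreducible_transfer:
  assumes R: "grs_irreducible R V" and Q: "grs Q W"
    and f: "linear f" "bij_betw f V W" "bij_betw f R Q"
  shows "grs_irreducible Q W"
proof (rule ccontr)
  assume "\<not> ?thesis"
  then obtain Q1 W1 Q2 W2 where Q12: "grs Q1 W1" "\<not> grs_trivial Q1 W1" "grs Q2 W2"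
      "\<not> grs_trivial Q2 W2" "grs_sum Q W Q1 W1 Q2 W2"
    using Q unfolding grs_irreducible_def by blast
  have GR: "grs R V" using R by (simp add: grs_irreducible_def)
  then have V: "subspace V" "R \<subseteq> V" by (auto simp: grs_def intro: span_base)
  have W12: "subspace W1" "subspace W2" "Q1 \<subseteq> W1" "Q2 \<subseteq> W2"
    using Q12 by (auto simp: grs_def intro: span_base)
  have disj: "z = 0" if "z \<in> W1" "z \<in> W2" for z
  proof -
    have "orthogonal z z" using Q12(5) that unfolding grs_sum_def by blast
    then show ?thesis by (simp add: orthogonal_def)
  qed
  have nz: "\<exists>z\<in>Q'. z \<noteq> 0" if "grs Q' W'" "\<not> grs_trivial Q' W'" for Q' W' :: "'b set"
  proof (rule ccontr)
    assume "\<not> ?thesis"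
    then have "Q' = {0}" using that(1) by (auto simp: grs_def)
    with that show False by (auto simp: grs_def grs_trivial_def)
  qed
  define D1 where "D1 = V \<inter> f -` W1"
  define D2 where "D2 = V \<inter> f -` W2"
  have sub: "subspace D1" "subspace D2"
    unfolding D1_def D2_def using V(1) W12(1,2) f(1)
    by (auto simp: subspace_def linear_0 linear_add linear_scale)
  have QR: "Q = f ` R" using f(3) by (simp add: bij_betw_def)
  have QU: "Q = Q1 \<union> Q2" using Q12(5) by (simp add: grs_sum_def)
  have "\<not> grs_irreducible R V"
  proof (rule not_grs_irreducibleI[OF GR sub])
    show "D1 \<inter> D2 \<subseteq> {0}"
    proof
      fix x assume x: "x \<in> D1 \<inter> D2"
      then have "f x = f 0" using disj linear_0[OF f(1)] by (auto simp: D1_def D2_def)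
      then show "x \<in> {0}"
        using x f(2) V(1) by (auto simp: D1_def bij_betw_def subspace_0 dest: inj_onD)
    qed
    show "R \<subseteq> D1 \<union> D2"
    proof
      fix x assume "x \<in> R"
      then have "f x \<in> Q1 \<union> Q2" "x \<in> V" using QR QU V(2) by auto
      then show "x \<in> D1 \<union> D2" using W12(3,4) by (auto simp: D1_def D2_def)
    qed
    show "\<not> R \<subseteq> D1"
    proof
      assume "R \<subseteq> D1"
      then have "Q \<subseteq> W1" using QR by (auto simp: D1_def)
      with nz[OF Q12(3,4)] disj W12 QU show False by blast
    qed
    show "\<not> R \<subseteq> D2"
    proof
      assume "R \<subseteq> D2"
      then have "Q \<subseteq> W2" using QR by (auto simp: D2_def)
      with nz[OF Q12(1,2)] disj W12 QU show False by blast
    qed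
  qed
  with R show False by simp
qed

text \<open>\<open>C\<close> stands for the factors \<open>c\<close> such that c \<alpha> is a root.
  Steps of 1 cannot jump over 0 on the way down, because nonzero elements have absolute value at
  least 1; so they end at 0 and all elements are integers.\<close>

lemma rank_1_multiples:
  fixes C :: "real set"
  assumes fin: "finite C" and one: "1 \<in> C" and neg: "\<And>c. c \<in> C \<Longrightarrow> - c \<in> C"
    and down: "\<And>c. c \<in> C \<Longrightarrow> c > 0 \<Longrightarrow> c - 1 \<in> C"
    and min: "\<And>c. c \<in> C \<Longrightarrow> c \<noteq> 0 \<Longrightarrow> \<bar>c\<bar> \<ge> 1"
  obtains m :: int where "m \<ge> 1" "\<And>c. c \<in> C \<longleftrightarrow> (\<exists>i. c = of_int i \<and> \<bar>i\<bar> \<le> m)"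
proof -
  have zero: "0 \<in> C" using down[OF one] by simp
  have int: "c \<in> C \<Longrightarrow> 0 \<le> c \<Longrightarrow> c < of_nat n \<Longrightarrow> \<exists>i::int. c = of_int i" for c and n :: nat
  proof (induction n arbitrary: c)
    case (Suc n)
    show ?case
    proof (cases "c = 0")
      case False
      then have "c - 1 \<in> C" "c - 1 \<ge> 0" using down[of c] min[of c] Suc.prems by auto
      with Suc.IH[of "c - 1"] Suc.prems obtain i :: int where "c - 1 = of_int i" by auto
      then have "c = of_int (i + 1)" by simp
      then show ?thesis by blast
    qed (auto intro: exI[of _ 0])
  qed simp
  have int': "\<exists>i::int. c = of_int i" if "c \<in> C" for c
  proof -
    obtain n where n: "\<bar>c\<bar> < of_nat n" using reals_Archimedean2 by blast
    show ?thesis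
    proof (cases "c \<ge> 0")
      case False
      with int[OF neg[OF that], of n] n obtain i :: int where "- c = of_int i" by auto
      then have "c = of_int (- i)" by simp
      then show ?thesis by blast
    qed (use int[OF that, of n] n in auto)
  qed
  define M where "M = Max C"
  have M: "M \<in> C" "\<And>c. c \<in> C \<Longrightarrow> c \<le> M" unfolding M_def using fin zero by (auto intro: Max_in)
  from int'[OF M(1)] obtain m :: int where m: "M = of_int m" by blast
  have m1: "m \<ge> 1" using M(2)[OF one] m by simp
  have pos: "of_int i \<in> C" if "0 \<le> i" "i \<le> m" for i :: int
    using that(2,1)
  proof (induction i rule: int_le_induct)
    case base
    then show ?case using M m by simp
  next
    case (step i)
    then show ?case using down[of "of_int i"] by simp
  qed
  show thesis
  proof (rule that[OF m1])
    fix c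
    show "c \<in> C \<longleftrightarrow> (\<exists>i. c = of_int i \<and> \<bar>i\<bar> \<le> m)"
    proof
      assume c: "c \<in> C"
      from int'[OF c] obtain i :: int where i: "c = of_int i" by blast
      have "\<bar>i\<bar> \<le> m" using M(2)[OF c] M(2)[OF neg[OF c]] i m by simp
      with i show "\<exists>i. c = of_int i \<and> \<bar>i\<bar> \<le> m" by blast
    next
      assume "\<exists>i. c = of_int i \<and> \<bar>i\<bar> \<le> m"
      then obtain i :: int where i: "c = of_int i" "\<bar>i\<bar> \<le> m" by blast
      show "c \<in> C"
      proof (cases "i \<ge> 0")
        case False
        then show ?thesis using neg[OF pos[of "- i"]] i by simp
      qed (use i pos in auto)
    qed
  qed
qed

section \<open>Coordinates of a rank 2 system\<close>

lemma rank_2_frame: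
  fixes V :: "'a::real_inner set"
  assumes V: "subspace V" "dim V = 2" and \<alpha>: "\<alpha> \<in> V" "\<alpha> \<noteq> 0"
  obtains e where "e \<in> V" "e \<noteq> 0" "\<alpha> \<bullet> e = 0" "V = span {\<alpha>, e}"
proof -
  obtain B where B: "B \<subseteq> V" "independent B" "V \<subseteq> span B" "card B = 2"
    using basis_exists[of V] V(2) by metis
  have finB: "finite B" using B(4) by (metis card.infinite zero_neq_numeral)
  have "\<not> V \<subseteq> span {\<alpha>}"
  proof
    assume "V \<subseteq> span {\<alpha>}"
    then have "card B \<le> card {\<alpha>}" using independent_span_bound[of "{\<alpha>}" B] B by auto
    with B show False by simp
  qed
  then obtain w where w: "w \<in> V" "w \<notin> span {\<alpha>}" by blast
  define e where "e = w - (w \<bullet> \<alpha> / (\<alpha> \<bullet> \<alpha>)) *\<^sub>R \<alpha>"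
  have e: "e \<in> V" using w \<alpha> V by (simp add: e_def subspace_diff subspace_scale)
  have e0: "e \<noteq> 0"
  proof
    assume "e = 0"
    then have "w = (w \<bullet> \<alpha> / (\<alpha> \<bullet> \<alpha>)) *\<^sub>R \<alpha>" by (simp add: e_def)
    with w show False by (metis span_base span_scale singletonI)
  qed
  have ae: "\<alpha> \<bullet> e = 0" using \<alpha> by (simp add: e_def inner_diff_right inner_commute)
  have "\<alpha> \<noteq> e" using ae \<alpha> by auto
  have "e \<notin> span {\<alpha>}"
  proof
    assume "e \<in> span {\<alpha>}"
    then obtain k where "e = k *\<^sub>R \<alpha>" by (auto simp: span_singleton)
    then have "k * (\<alpha> \<bullet> \<alpha>) = 0" using ae by simp
    with \<alpha> \<open>e = k *\<^sub>R \<alpha>\<close> e0 show False by simp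
  qed
  then have ind: "independent {e, \<alpha>}" using \<alpha> by (simp add: independent_insert)
  have "V \<subseteq> span {e, \<alpha>}"
  proof
    fix v assume v: "v \<in> V"
    show "v \<in> span {e, \<alpha>}"
    proof (rule ccontr)
      assume n: "v \<notin> span {e, \<alpha>}"
      then have "independent {v, e, \<alpha>}" by (rule independent_insertI[OF _ ind])
      moreover have "{v, e, \<alpha>} \<subseteq> span B" using v e \<alpha> B by auto
      ultimately have "card {v, e, \<alpha>} \<le> card B" using independent_span_bound[OF finB] by blast
      moreover have "v \<noteq> e" "v \<noteq> \<alpha>" using n by (auto intro: span_base)
      ultimately show False using B \<open>\<alpha> \<noteq> e\<close> by simp
    qed
  qed
  moreover have "span {e, \<alpha>} \<subseteq> V" using e \<alpha> V by (intro span_minimal) auto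
  ultimately show thesis using that[OF e e0 ae] by (simp add: insert_commute)
qed

lemma longest_root_multiples:
  assumes G: "grs R V" and nt: "\<not> R \<subseteq> {0}"
  obtains \<alpha> and m :: int where "\<alpha> \<in> R" "\<alpha> \<noteq> 0" "m \<ge> 1"
    "\<And>c. c *\<^sub>R \<alpha> \<in> R \<longleftrightarrow> (\<exists>i. c = of_int i \<and> \<bar>i\<bar> \<le> m)"
    "\<And>x. x \<in> R \<Longrightarrow> x \<bullet> x \<le> (of_int m)\<^sup>2 * (\<alpha> \<bullet> \<alpha>)"
proof -
  have fin: "finite R" and R0: "R \<noteq> {}" using G by (auto simp: grs_def)
  obtain \<theta> where \<theta>: "\<theta> \<in> R" "\<And>x. x \<in> R \<Longrightarrow> x \<bullet> x \<le> \<theta> \<bullet> \<theta>"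
    using obtains_MAX[OF fin R0, of "\<lambda>x. x \<bullet> x"] fin by (metis (no_types, lifting) Max_ge finite_imageI image_eqI)
  have \<theta>0: "\<theta> \<noteq> 0"
  proof
    assume "\<theta> = 0"
    then have "x = 0" if "x \<in> R" for x using \<theta>(2)[OF that] by (metis inner_eq_zero_iff inner_ge_zero inner_zero_left order_antisym)
    with nt show False by auto
  qed
  define L where "L = {c. c \<noteq> 0 \<and> c *\<^sub>R \<theta> \<in> R}"
  have finL: "finite L"
  proof (rule finite_imageD)
    show "finite ((\<lambda>c. c *\<^sub>R \<theta>) ` L)" by (rule finite_subset[OF _ fin]) (auto simp: L_def)
    show "inj_on (\<lambda>c. c *\<^sub>R \<theta>) L" using \<theta>0 by (auto intro: inj_onI)
  qed
  have "1 \<in> L" using \<theta> by (simp add: L_def)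
  define l where "l = Min (abs ` L)"
  have "l \<in> abs ` L" unfolding l_def using finL \<open>1 \<in> L\<close> by (intro Min_in) auto
  then obtain l' where l': "l' \<in> L" "l = \<bar>l'\<bar>" by blast
  have lmin: "l \<le> \<bar>c\<bar>" if "c \<in> L" for c unfolding l_def using finL that by (intro Min_le) auto
  define \<alpha> where "\<alpha> = l' *\<^sub>R \<theta>"
  have \<alpha>: "\<alpha> \<in> R" "\<alpha> \<noteq> 0" using l' \<theta>0 by (auto simp: \<alpha>_def L_def)
  then have \<alpha>_pos: "\<alpha> \<bullet> \<alpha> > 0" by simp
  define C where "C = {c. c *\<^sub>R \<alpha> \<in> R}"
  obtain m :: int where m: "m \<ge> 1" "\<And>c. c \<in> C \<longleftrightarrow> (\<exists>i. c = of_int i \<and> \<bar>i\<bar> \<le> m)"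
  proof (rule rank_1_multiples[of C])
    show "finite C"
    proof (rule finite_imageD)
      show "finite ((\<lambda>c. c *\<^sub>R \<alpha>) ` C)" by (rule finite_subset[OF _ fin]) (auto simp: C_def)
      show "inj_on (\<lambda>c. c *\<^sub>R \<alpha>) C" using \<alpha> by (auto intro: inj_onI)
    qed
    show "1 \<in> C" using \<alpha> by (simp add: C_def)
    show "- c \<in> C" if "c \<in> C" for c using that grs_uminus[OF G] by (force simp: C_def)
    show "c - 1 \<in> C" if "c \<in> C" "c > 0" for c
    proof -
      have "c *\<^sub>R \<alpha> \<bullet> \<alpha> > 0" using that \<alpha>_pos by simp
      with that \<alpha> G have "c *\<^sub>R \<alpha> - \<alpha> \<in> R" unfolding C_def grs_def by blast
      then show ?thesis by (simp add: C_def scaleR_diff_left)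
    qed
    show "\<bar>c\<bar> \<ge> 1" if "c \<in> C" "c \<noteq> 0" for c
    proof -
      have "c * l' \<in> L" using that l' by (auto simp: C_def L_def \<alpha>_def)
      from lmin[OF this] l' have "1 * \<bar>l'\<bar> \<le> \<bar>c\<bar> * \<bar>l'\<bar>" by (simp add: abs_mult)
      moreover have "\<bar>l'\<bar> > 0" using l' by (simp add: L_def)
      ultimately show ?thesis by (simp only: mult_le_cancel_right_pos)
    qed
  qed blast
  have "1 / l' \<in> C" using l' \<theta> by (simp add: C_def \<alpha>_def L_def)
  then obtain i :: int where i: "1 / l' = of_int i" "\<bar>i\<bar> \<le> m" using m by blast
  have "\<theta> = of_int i *\<^sub>R \<alpha>" using i(1)[symmetric] l' by (simp add: \<alpha>_def L_def)
  then have "\<theta> \<bullet> \<theta> = (of_int i)\<^sup>2 * (\<alpha> \<bullet> \<alpha>)" by (simp add: power2_eq_square)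
  also have "\<dots> \<le> (of_int m)\<^sup>2 * (\<alpha> \<bullet> \<alpha>)"
    using i(2) \<alpha>_pos by (intro mult_right_mono) (auto simp: abs_le_square_iff[symmetric])
  finally show thesis
    using that[OF \<alpha>(1,2) m(1)] m(2) \<theta>(2) unfolding C_def by force
qed

text \<open>The vector \<open>e\<close> is orthogonal to \<alpha>, and the product with it measures
  the level of a root. \<beta> is taken on the lowest positive level, there as close as possible to
  the perpendicular, and the sign of \<alpha> is adjusted to make \<open>s\<close>
  nonnegative.\<close>

lemma rank_2_coordinates:
  fixes R V :: "'a::real_inner set"
  assumes irr: "grs_irreducible R V" and dim: "dim V = 2"
  obtains \<alpha> \<beta> S and m :: int and s t where "row_system S m s t"
    "R = (\<lambda>(i, j). of_int i *\<^sub>R \<alpha> + of_int j *\<^sub>R \<beta>) ` S" "V = span {\<alpha>, \<beta>}"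
    "\<And>a b. a *\<^sub>R \<alpha> + b *\<^sub>R \<beta> = 0 \<Longrightarrow> a = 0 \<and> b = 0"
proof -
  have G: "grs R V" using irr by (simp add: grs_irreducible_def)
  then have V: "subspace V" "V = span R" "R \<subseteq> V" and fin: "finite R"
    by (auto simp: grs_def intro: span_base)
  have "\<not> R \<subseteq> {0}"
  proof
    assume "R \<subseteq> {0}"
    then have "V \<subseteq> span {0}" using V span_mono by blast
    then have "V \<subseteq> {0}" by simp
    moreover obtain B where "B \<subseteq> V" "independent B" "card B = dim V"
      using basis_exists[of V] by metis
    ultimately have "B = {}" using dependent_zero[of B] by auto
    with \<open>card B = dim V\<close> dim show False by simp
  qed
  from longest_root_multiples[OF G this] obtain \<alpha>' and m :: int
    where \<alpha>': "\<alpha>' \<in> R" "\<alpha>' \<noteq> 0" and m: "m \<ge> 1"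
    and line': "\<And>c. c *\<^sub>R \<alpha>' \<in> R \<longleftrightarrow> (\<exists>i. c = of_int i \<and> \<bar>i\<bar> \<le> m)"
    and long': "\<And>x. x \<in> R \<Longrightarrow> x \<bullet> x \<le> (of_int m)\<^sup>2 * (\<alpha>' \<bullet> \<alpha>')" by blast
  obtain e where e: "e \<in> V" "e \<noteq> 0" "\<alpha>' \<bullet> e = 0" "V = span {\<alpha>', e}"
    using rank_2_frame[OF V(1) dim, of \<alpha>'] \<alpha>' V by blast
  define A E where "A = \<alpha>' \<bullet> \<alpha>'" and "E = e \<bullet> e"
  have pos: "A > 0" "E > 0" using \<alpha>' e by (auto simp: A_def E_def)
  have ax: "(x \<bullet> y < 0 \<longrightarrow> x + y \<in> R) \<and> (x \<bullet> y > 0 \<longrightarrow> x - y \<in> R) \<and>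
      (x \<bullet> y = 0 \<longrightarrow> (x + y \<in> R \<longleftrightarrow> x - y \<in> R))" if "x \<in> R" "y \<in> R" for x y
    using G that unfolding grs_def by blast
  have decomp: "x = (x \<bullet> \<alpha>' / A) *\<^sub>R \<alpha>' + (x \<bullet> e / E) *\<^sub>R e" if x: "x \<in> V" for x
  proof -
    obtain a b where ab: "x = a *\<^sub>R \<alpha>' + b *\<^sub>R e"
      using x unfolding e(4) span_insert by (auto simp: span_singleton algebra_simps)
    have "x \<bullet> \<alpha>' = a * A" "x \<bullet> e = b * E"
      using e(3) by (simp_all add: ab A_def E_def inner_add_left inner_commute[of e \<alpha>'])
    with pos ab show ?thesis by simp
  qed
  \<comment> \<open>Otherwise all roots lie on two perpendicular lines and the system
    splits.\<close>
  have generic: "\<exists>x\<in>R. x \<bullet> \<alpha>' \<noteq> 0 \<and> x \<bullet> e \<noteq> 0"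
  proof (rule ccontr)
    assume none: "\<not> ?thesis"
    have "\<not> grs_irreducible R V"
    proof (rule not_grs_irreducibleI[OF G, of "span {\<alpha>'}" "span {e}"])
      show "span {\<alpha>'} \<inter> span {e} \<subseteq> {0}"
      proof
        fix x assume "x \<in> span {\<alpha>'} \<inter> span {e}"
        then obtain a b where "x = a *\<^sub>R \<alpha>'" "x = b *\<^sub>R e"
          unfolding span_singleton by blast
        then have "x \<bullet> x = a * b * (\<alpha>' \<bullet> e)" by (metis inner_scaleR_left inner_scaleR_right mult.assoc)
        with e show "x \<in> {0}" by simp
      qed
      show "R \<subseteq> span {\<alpha>'} \<union> span {e}"
      proof
        fix x assume x: "x \<in> R"
        then consider "x \<bullet> \<alpha>' = 0" | "x \<bullet> e = 0" using none by blast
        then show "x \<in> span {\<alpha>'} \<union> span {e}"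
        proof cases
          case 1
          then have "x = (x \<bullet> e / E) *\<^sub>R e" using decomp[of x] x V by auto
          then show ?thesis by (metis UnI2 span_base span_scale singletonI)
        next
          case 2
          then have "x = (x \<bullet> \<alpha>' / A) *\<^sub>R \<alpha>'" using decomp[of x] x V by auto
          then show ?thesis by (metis UnI1 span_base span_scale singletonI)
        qed
      qed
      show "\<not> R \<subseteq> span {\<alpha>'}"
      proof
        assume "R \<subseteq> span {\<alpha>'}"
        then have "V \<subseteq> span {\<alpha>'}" using V by (simp add: span_minimal)
        then obtain k where "e = k *\<^sub>R \<alpha>'" using e(1) by (auto simp: span_singleton)
        then have "e \<bullet> e = k * (\<alpha>' \<bullet> e)" by (metis inner_scaleR_left)
        with e show False by simp
      qed
      show "\<not> R \<subseteq> span {e}"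
      proof
        assume "R \<subseteq> span {e}"
        then obtain k where "\<alpha>' = k *\<^sub>R e" using \<alpha>' by (auto simp: span_singleton)
        then have "\<alpha>' \<bullet> \<alpha>' = k * (\<alpha>' \<bullet> e)" by (metis inner_scaleR_right)
        with e \<alpha>' show False by simp
      qed
    qed auto
    with irr show False by simp
  qed
  define H where "H = {x \<bullet> e |x. x \<in> R \<and> x \<bullet> e > 0}"
  have finH: "finite H"
    by (rule finite_subset[of _ "(\<lambda>x. x \<bullet> e) ` R"]) (use fin in \<open>auto simp: H_def\<close>)
  have "H \<noteq> {}"
  proof -
    from generic obtain x where x: "x \<in> R" "x \<bullet> e \<noteq> 0" by blast
    have "\<exists>x\<in>R. x \<bullet> e > 0"
    proof (cases "x \<bullet> e > 0")
      case False
      then have "- x \<bullet> e > 0" using x(2) by simp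
      then show ?thesis using grs_uminus[OF G x(1)] by blast
    qed (use x in blast)
    then show ?thesis by (auto simp: H_def)
  qed
  define h where "h = Min H"
  have hH: "h \<in> H" unfolding h_def using finH \<open>H \<noteq> {}\<close> by (rule Min_in)
  have h_le: "h \<le> x \<bullet> e" if "x \<in> R" "x \<bullet> e > 0" for x
    unfolding h_def by (rule Min_le[OF finH]) (use that in \<open>auto simp: H_def\<close>)
  have h: "h > 0" using hH by (auto simp: H_def)
  define B where "B = {x \<in> R. x \<bullet> e = h}"
  have "B \<noteq> {}" "finite B" using hH fin by (auto simp: B_def H_def)
  then obtain \<beta> where "is_arg_min (\<lambda>x. \<bar>x \<bullet> \<alpha>'\<bar>) (\<lambda>x. x \<in> B) \<beta>"
    using ex_is_arg_min_if_finite by blast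
  then have \<beta>: "\<beta> \<in> R" "\<beta> \<bullet> e = h" and \<beta>_min: "\<And>x. x \<in> B \<Longrightarrow> \<bar>\<beta> \<bullet> \<alpha>'\<bar> \<le> \<bar>x \<bullet> \<alpha>'\<bar>"
    by (auto simp: is_arg_min_linorder B_def)
  define \<alpha> where "\<alpha> = (if \<beta> \<bullet> \<alpha>' \<ge> 0 then \<alpha>' else - \<alpha>')"
  have \<alpha>: "\<alpha> \<in> R" "\<alpha> \<noteq> 0" "\<alpha> \<bullet> \<alpha> = A" "\<alpha> \<bullet> e = 0" "\<beta> \<bullet> \<alpha> = \<bar>\<beta> \<bullet> \<alpha>'\<bar>"
    using \<alpha>' e grs_uminus[OF G] by (auto simp: \<alpha>_def A_def)
  have abs_\<alpha>: "\<bar>x \<bullet> \<alpha>\<bar> = \<bar>x \<bullet> \<alpha>'\<bar>" for x by (simp add: \<alpha>_def)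
  have line: "c *\<^sub>R \<alpha> \<in> R \<longleftrightarrow> (\<exists>i. c = of_int i \<and> \<bar>i\<bar> \<le> m)" for c
  proof (cases "\<beta> \<bullet> \<alpha>' \<ge> 0")
    case False
    then have "c *\<^sub>R \<alpha> \<in> R \<longleftrightarrow> (\<exists>i. - c = of_int i \<and> \<bar>i\<bar> \<le> m)"
      using line'[of "- c"] by (simp add: \<alpha>_def)
    also have "\<dots> \<longleftrightarrow> (\<exists>i. c = of_int i \<and> \<bar>i\<bar> \<le> m)"
      by (metis abs_minus_cancel minus_minus of_int_minus)
    finally show ?thesis .
  qed (use line' in \<open>simp add: \<alpha>_def\<close>)
  define s where "s = \<beta> \<bullet> \<alpha> / A"
  \<comment> \<open>The component of \<beta> along \<open>e\<close> has squared length
    \<open>h\<^sup>2 / E\<close>; dividing by \<open>A\<close> makes \<alpha> a unit vector.\<close>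
  define t where "t = h\<^sup>2 / (E * A)"
  have s0: "s \<ge> 0" using \<alpha> pos by (simp add: s_def)
  \<comment> \<open>Otherwise \<beta> - \<alpha> would be a root on the same level, closer to the
    perpendicular.\<close>
  have s2: "s \<le> 1/2"
  proof (rule ccontr)
    assume "\<not> s \<le> 1/2"
    then have b: "\<beta> \<bullet> \<alpha> > A / 2" using pos by (simp add: s_def field_simps)
    then have "\<beta> \<bullet> \<alpha> > 0" using pos by simp
    then have "\<beta> - \<alpha> \<in> B" using ax[OF \<beta>(1) \<alpha>(1)] \<alpha> \<beta> by (simp add: B_def inner_diff_left)
    from \<beta>_min[OF this] have "\<bar>\<beta> \<bullet> \<alpha>\<bar> \<le> \<bar>(\<beta> - \<alpha>) \<bullet> \<alpha>\<bar>" by (simp only: abs_\<alpha>)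
    then have "\<bar>\<beta> \<bullet> \<alpha>\<bar> \<le> \<bar>\<beta> \<bullet> \<alpha> - A\<bar>" using \<alpha> by (simp add: inner_diff_left)
    then show False using b pos by (simp split: abs_split)
  qed
  have sA: "\<beta> \<bullet> \<alpha> = s * A" using pos by (simp add: s_def)
  have decomp': "x = (x \<bullet> \<alpha> / A) *\<^sub>R \<alpha> + (x \<bullet> e / E) *\<^sub>R e" if "x \<in> V" for x
    using decomp[OF that] by (simp add: \<alpha>_def)
  have inner: "x \<bullet> y = (x \<bullet> \<alpha>) * (y \<bullet> \<alpha>) / A + (x \<bullet> e) * (y \<bullet> e) / E" if "x \<in> V" for x y
  proof -
    have "x \<bullet> y = ((x \<bullet> \<alpha> / A) *\<^sub>R \<alpha> + (x \<bullet> e / E) *\<^sub>R e) \<bullet> y" using decomp'[OF that] by simp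
    also have "\<dots> = (x \<bullet> \<alpha> / A) * (\<alpha> \<bullet> y) + (x \<bullet> e / E) * (e \<bullet> y)"
      by (simp add: inner_add_left)
    finally show ?thesis by (simp add: inner_commute[of \<alpha> y] inner_commute[of e y])
  qed
  have \<beta>V: "\<beta> \<in> V" and \<alpha>V: "\<alpha> \<in> V" using \<beta> \<alpha> V by auto
  have combo_in: "a *\<^sub>R \<alpha> + b *\<^sub>R \<beta> \<in> V" for a b
    using \<beta>V \<alpha>V V(1) by (simp add: subspace_add subspace_scale)
  have indep: "a = 0 \<and> b = 0" if ab: "a *\<^sub>R \<alpha> + b *\<^sub>R \<beta> = 0" for a b
  proof -
    have "(a *\<^sub>R \<alpha> + b *\<^sub>R \<beta>) \<bullet> e = b * h" using \<alpha> \<beta> by (simp add: inner_add_left)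
    then have "b = 0" using ab h by simp
    with ab \<alpha> show ?thesis by simp
  qed
  define S where "S = {(i, j). of_int i *\<^sub>R \<alpha> + of_int j *\<^sub>R \<beta> \<in> R}"
  have combo_\<alpha>: "(of_int i *\<^sub>R \<alpha> + of_int j *\<^sub>R \<beta>) \<bullet> \<alpha> = (of_int i + of_int j * s) * A"
    for i j :: int
    by (simp add: inner_add_left \<alpha>(3) sA algebra_simps)
  have combo_e: "(of_int i *\<^sub>R \<alpha> + of_int j *\<^sub>R \<beta>) \<bullet> e = of_int j * h" for i j :: int
    by (simp add: inner_add_left \<alpha>(4) \<beta>(2))
  have ip: "(of_int i *\<^sub>R \<alpha> + of_int j *\<^sub>R \<beta>) \<bullet> (of_int i' *\<^sub>R \<alpha> + of_int j' *\<^sub>R \<beta>) =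
      A * ((of_int i + of_int j * s) * (of_int i' + of_int j' * s) + of_int j * of_int j' * t)"
    for i j i' j' :: int
    unfolding inner[OF combo_in, of _ _ "of_int i' *\<^sub>R \<alpha> + of_int j' *\<^sub>R \<beta>"] combo_\<alpha> combo_e t_def
    using pos by (simp add: power2_eq_square field_simps)
  have combo_add: "(of_int i *\<^sub>R \<alpha> + of_int j *\<^sub>R \<beta>) + (of_int i' *\<^sub>R \<alpha> + of_int j' *\<^sub>R \<beta>) =
      of_int (i + i') *\<^sub>R \<alpha> + of_int (j + j') *\<^sub>R \<beta>" for i j i' j' :: int
    by (simp add: algebra_simps)
  have combo_diff: "(of_int i *\<^sub>R \<alpha> + of_int j *\<^sub>R \<beta>) - (of_int i' *\<^sub>R \<alpha> + of_int j' *\<^sub>R \<beta>) =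
      of_int (i - i') *\<^sub>R \<alpha> + of_int (j - j') *\<^sub>R \<beta>" for i j i' j' :: int
    by (simp add: algebra_simps)
  \<comment> \<open>Subtracting \<beta> or \<beta> - \<alpha>, whichever is not on the opposite side
    of the perpendicular from x, lowers the level by \<open>h\<close>. No level lies strictly
    between 0 and \<open>h\<close>, so the descent ends on the line of \<alpha>.\<close>
  have reach: "x \<in> R \<Longrightarrow> 0 \<le> x \<bullet> e \<Longrightarrow> x \<bullet> e < of_nat (Suc n) * h \<Longrightarrow>
      \<exists>i j :: int. x = of_int i *\<^sub>R \<alpha> + of_int j *\<^sub>R \<beta>" for x n
  proof (induction n arbitrary: x)
    case 0
    then have "x \<bullet> e = 0" using h_le[of x] by fastforce
    then have x: "x = (x \<bullet> \<alpha> / A) *\<^sub>R \<alpha>" using decomp'[of x] 0 V by auto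
    with 0 line obtain i :: int where "x \<bullet> \<alpha> / A = of_int i" by metis
    with x have "x = of_int i *\<^sub>R \<alpha> + of_int 0 *\<^sub>R \<beta>" by simp
    then show ?case by blast
  next
    case (Suc n)
    show ?case
    proof (cases "x \<bullet> e = 0")
      case True
      then show ?thesis using Suc.IH[of x] Suc.prems h by simp
    next
      case False
      then have xe: "x \<bullet> e \<ge> h" using h_le Suc.prems by simp
      then have xe0: "x \<bullet> e > 0" using h by simp
      have xV: "x \<in> V" using Suc.prems V by auto
      have step: ?thesis if d: "\<delta> \<in> R" "\<delta> \<bullet> e = h" "\<delta> = of_int k *\<^sub>R \<alpha> + of_int 1 *\<^sub>R \<beta>"
          "(x \<bullet> \<alpha>) * (\<delta> \<bullet> \<alpha>) \<ge> 0" for \<delta> and k :: int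
      proof -
        have "(x \<bullet> \<alpha>) * (\<delta> \<bullet> \<alpha>) / A \<ge> 0" using d pos by simp
        moreover have "(x \<bullet> e) * (\<delta> \<bullet> e) / E > 0" using d pos h xe0 by simp
        ultimately have "x \<bullet> \<delta> > 0" using inner[OF xV, of \<delta>] by linarith
        then have "x - \<delta> \<in> R" using ax Suc.prems d by blast
        moreover have "(x - \<delta>) \<bullet> e = x \<bullet> e - h" using d by (simp add: inner_diff_left)
        ultimately obtain i j :: int where "x - \<delta> = of_int i *\<^sub>R \<alpha> + of_int j *\<^sub>R \<beta>"
          using Suc.IH[of "x - \<delta>"] Suc.prems xe by (auto simp: algebra_simps)
        then have "x = (of_int i *\<^sub>R \<alpha> + of_int j *\<^sub>R \<beta>) + \<delta>" by (simp add: algebra_simps)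
        then show ?thesis unfolding d(3) combo_add by blast
      qed
      show ?thesis
      proof (cases "x \<bullet> \<alpha> \<ge> 0 \<or> s = 0")
        case True
        show ?thesis
        proof (rule step[of \<beta> 0])
          show "(x \<bullet> \<alpha>) * (\<beta> \<bullet> \<alpha>) \<ge> 0" using True sA s0 pos by auto
        qed (use \<beta> in simp_all)
      next
        case False
        then have "\<beta> \<bullet> \<alpha> > 0" using s0 sA pos by simp
        then have "\<beta> - \<alpha> \<in> R" using ax \<beta> \<alpha> by blast
        moreover have "(x \<bullet> \<alpha>) * ((\<beta> - \<alpha>) \<bullet> \<alpha>) \<ge> 0"
        proof (rule mult_nonpos_nonpos)
          show "(\<beta> - \<alpha>) \<bullet> \<alpha> \<le> 0"
            using s2 pos by (simp add: inner_diff_left sA \<alpha>(3) mult_le_cancel_right1)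
        qed (use False in simp)
        ultimately show ?thesis using \<beta> \<alpha>
          by (intro step[of "\<beta> - \<alpha>" "- 1"]) (auto simp: inner_diff_left)
      qed
    qed
  qed
  have reach': "\<exists>i j :: int. x = of_int i *\<^sub>R \<alpha> + of_int j *\<^sub>R \<beta>" if x: "x \<in> R" for x
  proof -
    obtain n where n: "\<bar>x \<bullet> e\<bar> < of_nat n * h" using reals_Archimedean3[OF h] by blast
    then have n': "\<bar>x \<bullet> e\<bar> < of_nat (Suc n) * h" using h by (simp add: algebra_simps)
    show ?thesis
    proof (cases "x \<bullet> e \<ge> 0")
      case False
      then obtain i j :: int where "- x = of_int i *\<^sub>R \<alpha> + of_int j *\<^sub>R \<beta>"
        using reach[OF grs_uminus[OF G x], of n] n' by auto
      then have "x = of_int (- i) *\<^sub>R \<alpha> + of_int (- j) *\<^sub>R \<beta>"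
        by (metis (no_types, opaque_lifting) add_uminus_conv_diff minus_add_distrib minus_minus of_int_minus
            scaleR_minus_left uminus_add_conv_diff)
      then show ?thesis by blast
    qed (use reach[OF x] n' in auto)
  qed
  have RS: "R = (\<lambda>(i, j). of_int i *\<^sub>R \<alpha> + of_int j *\<^sub>R \<beta>) ` S"
    using reach' by (fastforce simp: S_def)
  have "row_system S m s t"
  proof
    show "finite S"
    proof (rule finite_imageD)
      show "finite ((\<lambda>(i, j). of_int i *\<^sub>R \<alpha> + of_int j *\<^sub>R \<beta>) ` S)" using RS fin by simp
      show "inj_on (\<lambda>(i, j). of_int i *\<^sub>R \<alpha> + of_int j *\<^sub>R \<beta>) S"
      proof (rule inj_onI, clarify)
        fix i j i' j' :: int
        assume "of_int i *\<^sub>R \<alpha> + of_int j *\<^sub>R \<beta> = of_int i' *\<^sub>R \<alpha> + of_int j' *\<^sub>R \<beta>"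
        then have "of_int (i - i') *\<^sub>R \<alpha> + of_int (j - j') *\<^sub>R \<beta> = 0"
          unfolding combo_diff[symmetric] by simp
        from indep[OF this] show "i = i' \<and> j = j'" by simp
      qed
    qed
    show "(- i, - j) \<in> S" if "(i, j) \<in> S" for i j
      using grs_uminus[OF G, of "of_int i *\<^sub>R \<alpha> + of_int j *\<^sub>R \<beta>"] that
      by (simp only: S_def mem_Collect_eq case_prod_conv of_int_minus scaleR_minus_left
          minus_add_distrib)
    fix i j i' j'
    assume ij: "(i, j) \<in> S" "(i', j') \<in> S"
    note a = ax[of "of_int i *\<^sub>R \<alpha> + of_int j *\<^sub>R \<beta>" "of_int i' *\<^sub>R \<alpha> + of_int j' *\<^sub>R \<beta>",
        unfolded ip combo_add combo_diff]
    show "(i + i', j + j') \<in> S"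
      if "(of_int i + of_int j * s) * (of_int i' + of_int j' * s) + of_int j * of_int j' * t < 0"
      using a ij that pos by (simp add: S_def mult_less_0_iff del: of_int_add)
    show "(i - i', j - j') \<in> S"
      if "(of_int i + of_int j * s) * (of_int i' + of_int j' * s) + of_int j * of_int j' * t > 0"
      using a ij that pos by (simp add: S_def del: of_int_diff)
    show "(i + i', j + j') \<in> S \<longleftrightarrow> (i - i', j - j') \<in> S"
      if "(of_int i + of_int j * s) * (of_int i' + of_int j' * s) + of_int j * of_int j' * t = 0"
      using a ij that by (simp add: S_def del: of_int_add of_int_diff)
  next
    show "(i, 0) \<in> S \<longleftrightarrow> \<bar>i\<bar> \<le> m" for i using line[of "of_int i"] by (simp add: S_def)
    show "\<bar>of_int i + of_int j * s\<bar> < of_int m" if ij: "(i, j) \<in> S" "j \<noteq> 0" for i j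
    proof -
      let ?x = "of_int i *\<^sub>R \<alpha> + of_int j *\<^sub>R \<beta>"
      have "A * ((of_int i + of_int j * s)\<^sup>2 + (of_int j)\<^sup>2 * t) = ?x \<bullet> ?x"
        unfolding ip by (simp add: power2_eq_square)
      also have "\<dots> \<le> (of_int m)\<^sup>2 * A" using long'[of ?x] ij by (simp add: S_def A_def)
      finally have "A * ((of_int i + of_int j * s)\<^sup>2 + (of_int j)\<^sup>2 * t) \<le> A * (of_int m)\<^sup>2"
        by (simp add: mult.commute)
      then have "(of_int i + of_int j * s)\<^sup>2 + (of_int j)\<^sup>2 * t \<le> (of_int m)\<^sup>2"
        using pos by simp
      \<comment> \<open>The distance from the line of \<alpha> contributes to the length, so the
        bound on the position is strict.\<close>
      moreover have "(of_int j)\<^sup>2 * t > 0" using ij pos h by (simp add: t_def)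
      ultimately have "(of_int i + of_int j * s)\<^sup>2 < (of_int m)\<^sup>2" by linarith
      then show ?thesis using m by (metis abs_le_square_iff abs_of_nonneg linorder_not_le of_int_0_le_iff
            order_trans zero_le_one)
    qed
    show "(0, 1) \<in> S" using \<beta> by (simp add: S_def)
    show "1 \<le> m" "0 \<le> s" "s \<le> 1/2" "0 < t" using m s0 s2 pos h by (simp_all add: t_def)
    from generic obtain x where x: "x \<in> R" "x \<bullet> \<alpha>' \<noteq> 0" "x \<bullet> e \<noteq> 0" by blast
    then obtain i j :: int where ij: "x = of_int i *\<^sub>R \<alpha> + of_int j *\<^sub>R \<beta>" using reach' by blast
    have "x \<bullet> e = of_int j * h" unfolding ij by (rule combo_e)
    moreover have "x \<bullet> \<alpha> = (of_int i + of_int j * s) * A" unfolding ij by (rule combo_\<alpha>)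
    moreover have "x \<bullet> \<alpha> \<noteq> 0" using x abs_\<alpha>[of x] by auto
    ultimately show "\<exists>i j. (i, j) \<in> S \<and> j \<noteq> 0 \<and> of_int i + of_int j * s \<noteq> 0"
      using x ij by (intro exI[of _ i] exI[of _ j]) (auto simp: S_def)
  qed
  moreover have "V = span {\<alpha>, \<beta>}"
  proof
    show "span {\<alpha>, \<beta>} \<subseteq> V" using \<alpha>V \<beta>V V(1) by (intro span_minimal) auto
    have "R \<subseteq> span {\<alpha>, \<beta>}"
      unfolding RS by (auto intro!: span_add span_scale[OF span_base])
    then show "V \<subseteq> span {\<alpha>, \<beta>}" using V by (simp add: span_minimal)
  qed
  ultimately show thesis using that RS indep by blast
qed

theorem theorem5p5:
  fixes R V :: "'a::real_inner set"
  assumes "grs_irreducible R V" and "dim V = 2"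
  shows "\<exists>(Q :: fseq set) W. root_system_quotient Q W \<and> grs_equivalent R V Q W"
proof (rule rank_2_coordinates[OF assms])
  fix \<alpha> \<beta> :: 'a and S and m :: int and s t
  assume rs: "row_system S m s t"
    and R: "R = (\<lambda>(i, j). of_int i *\<^sub>R \<alpha> + of_int j *\<^sub>R \<beta>) ` S" and V: "V = span {\<alpha>, \<beta>}"
    and indep: "\<And>a b. a *\<^sub>R \<alpha> + b *\<^sub>R \<beta> = 0 \<Longrightarrow> a = 0 \<and> b = 0"
  interpret row_system S m s t by (rule rs)
  from classified obtain l where l: "(m, l) \<in> rank2_rows" "S = set (rows_list m l)"
    unfolding classified_def by blast
  then obtain n p r a b c d where entry: "(m, l, n, p, r, a, b, c, d) \<in> set rank2_table"
    unfolding rank2_rows_def by auto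
  with quotient_table_e8 have npr: "n \<le> 8" "p < n" "r < n" "p \<noteq> r" and det: "a * d - b * c \<noteq> 0"
    and pairs: "plane_map a b c d ` S = set (e8_pairs n p r)"
    unfolding quotient_table_def list_all_iff l(2) by (auto simp del: set_map simp flip: set_map)
  obtain Q W :: "fseq set" and w1 w2 where Q: "root_system_quotient Q W" "grs Q W"
    and W: "W = span {w1, w2}" and w_indep: "\<And>a b. a *\<^sub>R w1 + b *\<^sub>R w2 = 0 \<Longrightarrow> a = 0 \<and> b = 0"
    and Q_eq: "Q = (\<lambda>(x, y). of_int x *\<^sub>R w1 + of_int y *\<^sub>R w2) ` set (e8_pairs n p r)"
    using e8_quotient[OF npr] by blast
  \<comment> \<open>The images of \<alpha> and \<beta>: the columns of the matrix in the table, read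
    in the basis \<open>w1\<close>, \<open>w2\<close>.\<close>
  define u v where "u = of_int a *\<^sub>R w1 + of_int c *\<^sub>R w2" and "v = of_int b *\<^sub>R w1 + of_int d *\<^sub>R w2"
  have \<alpha>\<beta>: "\<alpha> \<noteq> \<beta>" using indep[of 1 "- 1"] by auto
  have "independent {\<alpha>, \<beta>}"
  proof (rule independent_insertI)
    show "\<alpha> \<notin> span {\<beta>}"
    proof
      assume "\<alpha> \<in> span {\<beta>}"
      then obtain k where "\<alpha> = k *\<^sub>R \<beta>" by (auto simp: span_singleton)
      then show False using indep[of 1 "- k"] by simp
    qed
    show "independent {\<beta>}" using indep[of 0 1] by (auto simp: independent_insert)
  qed
  from linear_independent_extend[OF this, of "\<lambda>x. if x = \<alpha> then u else v"]
  obtain f where f: "linear f" "f \<alpha> = u" "f \<beta> = v" using \<alpha>\<beta> by auto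
  have f_combo: "f (x *\<^sub>R \<alpha> + y *\<^sub>R \<beta>) =
      (of_int a * x + of_int b * y) *\<^sub>R w1 + (of_int c * x + of_int d * y) *\<^sub>R w2" for x y
    using f by (simp add: linear_add linear_scale u_def v_def algebra_simps)
  have V_combo: "\<exists>x y. z = x *\<^sub>R \<alpha> + y *\<^sub>R \<beta>" if "z \<in> V" for z
    using that unfolding V span_insert by (auto simp: span_singleton algebra_simps)
  define D where "D = real_of_int (a * d - b * c)"
  have D: "D \<noteq> 0" using det unfolding D_def of_int_eq_0_iff .
  have ker: "z = 0" if "z \<in> V" "f z = 0" for z
  proof -
    obtain x y where z: "z = x *\<^sub>R \<alpha> + y *\<^sub>R \<beta>" using V_combo[OF \<open>z \<in> V\<close>] by blast
    have 1: "of_int a * x + of_int b * y = 0" and 2: "of_int c * x + of_int d * y = 0"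
      using w_indep that(2) unfolding z f_combo by blast+
    have "D * x = of_int d * (of_int a * x + of_int b * y) - of_int b * (of_int c * x + of_int d * y)"
      "D * y = of_int a * (of_int c * x + of_int d * y) - of_int c * (of_int a * x + of_int b * y)"
      by (simp_all add: D_def algebra_simps)
    then have "D * x = 0" "D * y = 0" unfolding 1 2 by simp_all
    then have "x = 0" "y = 0" using D by simp_all
    then show ?thesis by (simp add: z)
  qed
  have subV: "subspace V" by (simp add: V)
  have inj: "inj_on f V"
  proof (rule inj_onI)
    fix x y assume "x \<in> V" "y \<in> V" "f x = f y"
    then have "x - y = 0" using subV f by (intro ker) (auto simp: subspace_diff linear_diff)
    then show "x = y" by simp
  qed
  have uv_W: "u \<in> W" "v \<in> W"
    unfolding u_def v_def W by (auto intro!: span_add span_scale[OF span_base])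
  have "f ` V = W"
  proof
    show "f ` V \<subseteq> W"
      unfolding V linear_span_image[OF f(1), symmetric] using uv_W f W by (intro span_minimal) auto
    have "w1 \<in> f ` V \<and> w2 \<in> f ` V"
    proof
      \<comment> \<open>Cramer's rule: preimages of \<open>w1\<close> and \<open>w2\<close> come
        from the adjugate matrix divided by \<open>D\<close>.\<close>
      have "f (of_int d *\<^sub>R \<alpha> + (- of_int c) *\<^sub>R \<beta>) = D *\<^sub>R w1"
        unfolding f_combo by (simp add: D_def)
      then have "f ((1 / D) *\<^sub>R (of_int d *\<^sub>R \<alpha> + (- of_int c) *\<^sub>R \<beta>)) = w1"
        using D f(1) by (simp add: linear_scale)
      moreover have "(1 / D) *\<^sub>R (of_int d *\<^sub>R \<alpha> + (- of_int c) *\<^sub>R \<beta>) \<in> V"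
        unfolding V by (intro span_scale span_add span_base) auto
      ultimately show "w1 \<in> f ` V" by force
      have "f ((- of_int b) *\<^sub>R \<alpha> + of_int a *\<^sub>R \<beta>) = D *\<^sub>R w2"
        unfolding f_combo by (simp add: D_def mult.commute)
      then have "f ((1 / D) *\<^sub>R ((- of_int b) *\<^sub>R \<alpha> + of_int a *\<^sub>R \<beta>)) = w2"
        using D f(1) by (simp add: linear_scale)
      moreover have "(1 / D) *\<^sub>R ((- of_int b) *\<^sub>R \<alpha> + of_int a *\<^sub>R \<beta>) \<in> V"
        unfolding V by (intro span_scale span_add span_base) auto
      ultimately show "w2 \<in> f ` V" by force
    qed
    then show "W \<subseteq> f ` V"
      unfolding W using linear_subspace_image[OF f(1) subV] by (intro span_minimal) auto
  qed
  with inj have bij: "bij_betw f V W" by (simp add: bij_betw_def)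
  have "f ` R = Q"
    unfolding R Q_eq pairs[symmetric] image_image
    by (intro image_cong) (auto simp: f_combo plane_map_def)
  moreover have "R \<subseteq> V"
    unfolding R V by (auto intro!: span_add span_scale[OF span_base])
  ultimately have bij': "bij_betw f R Q" using inj by (auto simp: bij_betw_def intro: inj_on_subset)
  have "grs_equivalent R V Q W"
    unfolding grs_equivalent_def
    using assms(1) grs_irreducible_transfer[OF assms(1) Q(2) f(1) bij bij'] f(1) bij bij' by blast
  with Q(1) show ?thesis by blast
qed

end
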